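(* Let $\kappa>0$, $\Lambda>0$, $R>\sqrt{3/\Lambda}$ and $h_0\in\mathcal{C}^k([0,R])$ with $k\geq 1$. There exists $\delta>0$ (depending on $\Lambda,R$) such that if $\|h_0\|_{X_R}:=\sup_{[0,R]}|h_0|+\sup_{[0,R]}|h_0'|<\delta$, then for some $U=U(\|h_0\|_{X_R};R,\Lambda)>0$ the initial value problem $$Dh=G\,(h-\bar h),\qquad h(0,r)=h_0(r),$$ has a unique solution $h\in\mathcal{C}^k([0,U]\times[0,R])$. Moreover $$\sup_{[0,U]\times[0,R]}|h|=\sup_{[0,R]}|h_0|$$ and $$\sup_{[0,U]\times[0,R]}|h|+\sup_{[0,U]\times[0,R]}|\partial_r h|\leq (1+C^* )\,\|h_0\|_{X_R},$$ where the constant $C^*>0$ does not depend on $U$.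
   Context: For a function $h(u,r)$ on $[0,U]\times[0,R]$, define its radial average $\bar h(u,r):=\frac1r\int_0^r h(u,s)\,ds$, and the associated functions $$f(u,r)=\exp\!\left(\frac{\kappa}{2}\int_0^r\frac{(h-\bar h)^2(u,s)}{s}\,ds\right),\qquad \tilde f(u,r)=\bar f(u,r)-\frac{\Lambda}{r}\int_0^r f(u,s)\,s^2\,ds,$$ where $\bar f$ is the radial average of $f$. Then set $D=\partial_u-\frac{\tilde f}{2}\partial_r$ and $G=\frac{1}{2r}\left[(f-\tilde f)-\Lambda f r^2\right]$. (This integro-differential equation encodes the Bondi-spherically symmetric Einstein-$\Lambda$-scalar field system $R_{\mu\nu}=\kappa\partial_\mu\phi\partial_\nu\phi+\Lambda\mathbf{g}_{\mu\nu}$ with metric $-f\tilde f du^2-2f du dr+r^2\sigma_{\mathbb{S}^2}$, via $h=\partial_r(r\phi)$, $\phi=\bar h$, gauge $f(u,0)=1$.) *)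

theory Defs
  imports "HOL-Analysis.Analysis"
begin

text \<open>Radial average of a function of r on [0,r]; at r = 0 it is the limiting value g 0.\<close>
definition ravg :: "(real \<Rightarrow> real) \<Rightarrow> real \<Rightarrow> real" where
  "ravg g r = (if r = 0 then g 0 else integral {0..r} g / r)"

definition ffun :: "real \<Rightarrow> (real \<Rightarrow> real \<Rightarrow> real) \<Rightarrow> real \<Rightarrow> real \<Rightarrow> real" where
  "ffun \<kappa> h u r = exp (\<kappa> / 2 * integral {0..r} (\<lambda>s. (h u s - ravg (h u) s)^2 / s))"

definition ftil :: "real \<Rightarrow> real \<Rightarrow> (real \<Rightarrow> real \<Rightarrow> real) \<Rightarrow> real \<Rightarrow> real \<Rightarrow> real" where
  "ftil \<kappa> \<Lambda> h u r =
     ravg (ffun \<kappa> h u) r - \<Lambda> / r * integral {0..r} (\<lambda>s. ffun \<kappa> h u s * s^2)"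

definition Gfun :: "real \<Rightarrow> real \<Rightarrow> (real \<Rightarrow> real \<Rightarrow> real) \<Rightarrow> real \<Rightarrow> real \<Rightarrow> real" where
  "Gfun \<kappa> \<Lambda> h u r =
     1 / (2 * r) * ((ffun \<kappa> h u r - ftil \<kappa> \<Lambda> h u r) - \<Lambda> * ffun \<kappa> h u r * r^2)"

definition pu :: "real \<Rightarrow> (real \<Rightarrow> real \<Rightarrow> real) \<Rightarrow> real \<Rightarrow> real \<Rightarrow> real" where
  "pu U h u r = vector_derivative (\<lambda>v. h v r) (at u within {0..U})"

definition pr :: "real \<Rightarrow> (real \<Rightarrow> real \<Rightarrow> real) \<Rightarrow> real \<Rightarrow> real \<Rightarrow> real" where
  "pr R h u r = vector_derivative (\<lambda>s. h u s) (at r within {0..R})"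

fun Ck1 :: "nat \<Rightarrow> real \<Rightarrow> (real \<Rightarrow> real) \<Rightarrow> bool" where
  "Ck1 0 R g = continuous_on {0..R} g"
| "Ck1 (Suc k) R g = (continuous_on {0..R} g \<and>
      (\<forall>x\<in>{0..R}. g differentiable (at x within {0..R})) \<and>
      Ck1 k R (\<lambda>x. vector_derivative g (at x within {0..R})))"

fun Ck2 :: "nat \<Rightarrow> real \<Rightarrow> real \<Rightarrow> (real \<Rightarrow> real \<Rightarrow> real) \<Rightarrow> bool" where
  "Ck2 0 U R h = continuous_on ({0..U} \<times> {0..R}) (\<lambda>p. h (fst p) (snd p))"
| "Ck2 (Suc k) U R h = (continuous_on ({0..U} \<times> {0..R}) (\<lambda>p. h (fst p) (snd p)) \<and>
      (\<forall>u\<in>{0..U}. \<forall>r\<in>{0..R}.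
          (\<lambda>v. h v r) differentiable (at u within {0..U}) \<and>
          (\<lambda>s. h u s) differentiable (at r within {0..R})) \<and>
      Ck2 k U R (pu U h) \<and> Ck2 k U R (pr R h))"

definition XR_norm :: "real \<Rightarrow> (real \<Rightarrow> real) \<Rightarrow> real" where
  "XR_norm R h0 = (SUP r\<in>{0..R}. \<bar>h0 r\<bar>) +
                  (SUP r\<in>{0..R}. \<bar>vector_derivative h0 (at r within {0..R})\<bar>)"

definition is_solution :: "real \<Rightarrow> real \<Rightarrow> real \<Rightarrow> real \<Rightarrow> (real \<Rightarrow> real)
    \<Rightarrow> (real \<Rightarrow> real \<Rightarrow> real) \<Rightarrow> bool" where
  "is_solution \<kappa> \<Lambda> U R h0 h \<longleftrightarrow>
     (\<forall>r\<in>{0..R}. h 0 r = h0 r) \<and>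
     (\<forall>u\<in>{0..U}. \<forall>r\<in>{0..R}.
        pu U h u r - ftil \<kappa> \<Lambda> h u r / 2 * pr R h u r
          = Gfun \<kappa> \<Lambda> h u r * (h u r - ravg (h u) r))"

end

(* With w = d_r h and a = f~/2, the coefficient G equals d_r a, and all coefficients are smooth functions
   of weighted averages of w, so that the equation reads d_u h = a d_r h + G (h - ravg h). For small w one
   has G <= 0, a(0) = 1/2 > 0 and, because R > sqrt(3/Lambda), a(R) <= 0: both ends of [0,R] are outflow ends.

   Existence: the explicit scheme h(r) := h(r + s a(r)) + s G (h - ravg h)(r) needs no characteristic flow,
   since outflow and G <= 0 make r + s a(r) a 1-Lipschitz self-map of [0,R]. The r-derivatives of its iterates
   obey similar schemes whose sources are affine in the highest derivative; hence all of them, and the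
   moduli of continuity of the highest one, are bounded uniformly in the step size on a time interval that
   depends on the size of w only. Arzela-Ascoli for h, together with interpolation between h and the moduli
   of continuity of its derivatives, gives a limit that is C^k in r; regularity in u is read off the equation.

   Uniqueness and sup |h| = sup |h0| come from the maximum principle applied to squares. At a maximum of
   |h| over r, G h (h - ravg h) <= 0. For the difference of two solutions, the coefficients depend in a
   Lipschitz way on the sup norm of h alone, as long as w stays bounded. *)

theory Submission
  imports Defs "HOL-Complex_Analysis.Great_Picard"
begin

section \<open>Weighted radial averages\<close>

text \<open>Two obstacles shape the argument. The first is the division by r at the origin. The
  substitution s = r t turns every radial average into an integral over [0,1] with a weight t^p, and
  differentiation in r merely raises p, so the origin becomes an ordinary point.

  The second is a possible loss of derivatives: the equation for w contains the r-derivative of G.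
  But r times the derivative of an average is, by parts, a combination of undifferentiated terms,
  and h - ravg h supplies the factor r. Hence the source in the equation for w involves w alone and
  is bounded by a constant times sup |w|. So sup |w| grows at most like exp (\<open>C0\<close> u),
  and the time \<open>U0\<close> = ln 2 / \<open>C0\<close> on which it at most doubles fixes the
  rest: data with |w| at most B/2 stay below B, where the signs of G and a(R) are known, and C* = 1
  is enough. The higher derivatives obey affine inequalities on the same interval, so one
  \<open>U0\<close> serves every k.\<close>

lemma DERIV_Icc_unique:
  fixes f :: "real \<Rightarrow> real"
  assumes "(f has_real_derivative D) (at x within {a..b})" "(f has_real_derivative E) (at x within {a..b})"
    and "a < b" "x \<in> {a..b}"
  shows "D = E"
  using vector_derivative_unique_within_closed_interval[of a b x f D E] assms
  by (auto simp: has_real_derivative_iff_has_vector_derivative)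

lemma DERIV_chain_within:
  fixes g y :: "real \<Rightarrow> real"
  assumes "(g has_real_derivative D) (at (y x) within T)" "(y has_real_derivative E) (at x within S)"
    and "\<And>x. x \<in> S \<Longrightarrow> y x \<in> T"
  shows "((\<lambda>x. g (y x)) has_real_derivative D * E) (at x within S)"
  using DERIV_image_chain[OF has_field_derivative_subset[OF assms(1)] assms(2)] assms(3)
  by (auto simp: o_def)

text \<open>For r > 0 this is r^(-p-1) times the integral of s^p g(s) over [0,r]. Written without a
  quotient, it can be differentiated under the integral sign up to the origin.\<close>

definition Av :: "nat \<Rightarrow> (real \<Rightarrow> real) \<Rightarrow> real \<Rightarrow> real" where
  "Av p g r = integral {0..1} (\<lambda>t. t ^ p * g (r * t))"

lemma scale_mem:
  fixes r t R :: real
  assumes "r \<in> {0..R}" "t \<in> {0..1}" shows "r * t \<in> {0..R}"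
  using assms mult_mono[of r R t 1] by auto

lemma continuous_on_scale:
  fixes g :: "real \<Rightarrow> real"
  assumes "continuous_on {0..R} g" "r \<in> {0..R}"
  shows "continuous_on {0..1} (\<lambda>t. g (r * t))"
  by (rule continuous_on_compose2[OF assms(1)]) (use assms scale_mem in \<open>auto intro!: continuous_intros\<close>)

lemma Av_integrable:
  fixes g :: "real \<Rightarrow> real"
  assumes "continuous_on {0..R} g" "r \<in> {0..R}"
  shows "(\<lambda>t. t ^ p * g (r * t)) integrable_on {0..1}"
  by (rule integrable_continuous_real) (intro continuous_intros continuous_on_scale[OF assms])

lemma Av_cong:
  assumes "\<And>s. s \<in> {0..R} \<Longrightarrow> g s = g' s" "r \<in> {0..R}"
  shows "Av p g r = Av p g' r"
  unfolding Av_def using assms scale_mem[OF assms(2)] by (intro integral_cong) auto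

lemma Av_const: "Av p (\<lambda>s. c) r = c / (p + 1)"
proof -
  have "integral {0..1} (\<lambda>t::real. t ^ p * c) = integral {0..1} (\<lambda>t::real. t ^ p) * c"
    by (rule integral_mult_left)
  moreover have "((\<lambda>t::real. t ^ p) has_integral (1 ^ Suc p / real (Suc p) - 0 ^ Suc p / real (Suc p))) {0..1}"
    by (rule fundamental_theorem_of_calculus)
       (auto simp flip: has_real_derivative_iff_has_vector_derivative intro!: derivative_eq_intros simp del: of_nat_Suc power_Suc)
  ultimately show ?thesis unfolding Av_def
    by (simp add: integral_unique add.commute)
qed

lemma Av_mono:
  assumes "continuous_on {0..R} g" "continuous_on {0..R} g'" "r \<in> {0..R}"
    and "\<And>s. s \<in> {0..r} \<Longrightarrow> g s \<le> g' s"
  shows "Av p g r \<le> Av p g' r"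
  unfolding Av_def
proof (rule integral_le)
  fix t :: real assume t: "t \<in> {0..1}"
  have "r * t \<in> {0..r}" using scale_mem[of r r t] assms(3) t by auto
  then show "t ^ p * g (r * t) \<le> t ^ p * g' (r * t)" using assms(4) t by (intro mult_left_mono) auto
qed (rule Av_integrable[OF assms(1,3)] Av_integrable[OF assms(2,3)])+

text \<open>The factor 1/(p+1), the mass of the weight, is kept because the sign of
  \<open>GG\<close> rests on the numbers 1/2 and 1/3 that it produces.\<close>

lemma Av_abs_le:
  assumes "continuous_on {0..R} g" "r \<in> {0..R}" "\<And>s. s \<in> {0..r} \<Longrightarrow> \<bar>g s\<bar> \<le> C"
  shows "\<bar>Av p g r\<bar> \<le> C / (p + 1)"
proof -
  have "Av p g r \<le> Av p (\<lambda>s. C) r"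
    by (rule Av_mono[OF assms(1) _ assms(2)]) (use assms(3) in \<open>force+\<close>)
  moreover have "Av p (\<lambda>s. -C) r \<le> Av p g r"
    by (rule Av_mono[OF _ assms(1,2)]) (use assms(3) in \<open>force+\<close>)
  ultimately show ?thesis by (simp add: Av_const)
qed

lemma Av_abs_le':
  assumes "continuous_on {0..R} g" "r \<in> {0..R}" "\<And>s. s \<in> {0..R} \<Longrightarrow> \<bar>g s\<bar> \<le> C"
  shows "\<bar>Av p g r\<bar> \<le> C"
proof -
  have C: "C \<ge> 0" using assms(2) assms(3)[of r] by auto
  have "\<bar>Av p g r\<bar> \<le> C / (p + 1)"
    by (rule Av_abs_le[OF assms(1,2)]) (use assms in auto)
  also have "\<dots> \<le> C / 1" using C by (intro divide_left_mono) auto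
  finally show ?thesis by simp
qed

text \<open>Two functions and two radii at once: equal radii give Lipschitz dependence on the
  function, equal functions give moduli of continuity.\<close>

lemma Av_diff_abs_le:
  assumes "continuous_on {0..R} g" "continuous_on {0..R} g'" "r \<in> {0..R}" "r' \<in> {0..R}"
    and "\<And>t. t \<in> {0..1} \<Longrightarrow> \<bar>g (r * t) - g' (r' * t)\<bar> \<le> C"
  shows "\<bar>Av p g r - Av p g' r'\<bar> \<le> C"
proof -
  have "Av p g r - Av p g' r' = integral {0..1} (\<lambda>t. t ^ p * g (r * t) - t ^ p * g' (r' * t))"
    unfolding Av_def by (rule integral_diff[symmetric]) (rule Av_integrable[OF assms(1,3)] Av_integrable[OF assms(2,4)])+
  also have "norm \<dots> \<le> C * (1 - 0)"
  proof (rule integral_bound)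
    show "continuous_on {0..1} (\<lambda>t. t ^ p * g (r * t) - t ^ p * g' (r' * t))"
      by (intro continuous_intros continuous_on_scale[OF assms(1,3)] continuous_on_scale[OF assms(2,4)])
    fix t :: real assume t: "t \<in> {0..1}"
    have "norm (t ^ p * g (r * t) - t ^ p * g' (r' * t)) = t ^ p * \<bar>g (r * t) - g' (r' * t)\<bar>"
      using t by (simp flip: right_diff_distrib add: abs_mult)
    also have "\<dots> \<le> 1 * C"
      using t assms(5)[OF t] by (intro mult_mono) (auto simp: power_le_one)
    finally show "norm (t ^ p * g (r * t) - t ^ p * g' (r' * t)) \<le> C" by simp
  qed auto
  finally show ?thesis by simp
qed

lemma Av_cont2:
  fixes h :: "'a::topological_space \<Rightarrow> real \<Rightarrow> real"
  assumes "continuous_on (S \<times> {0..R}) (\<lambda>q. h (fst q) (snd q))"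
  shows "continuous_on (S \<times> {0..R}) (\<lambda>q. Av p (h (fst q)) (snd q))"
proof -
  have "continuous_on (S \<times> {0..R}) (\<lambda>q. integral (cbox 0 1) (\<lambda>t. t ^ p * h (fst q) (snd q * t)))"
  proof (rule integral_continuous_on_param)
    have "continuous_on ((S \<times> {0..R}) \<times> cbox 0 1) (\<lambda>z. h (fst (fst z)) (snd (fst z) * snd z))"
      by (rule continuous_on_compose2[OF assms, of _ "\<lambda>z. (fst (fst z), snd (fst z) * snd z)", simplified])
         (auto intro!: continuous_intros simp: mult_left_le mult_le_one mult_mono order_trans[OF mult_left_le])
    then show "continuous_on ((S \<times> {0..R}) \<times> cbox 0 1) (\<lambda>(q, t). t ^ p * h (fst q) (snd q * t))"
      by (auto simp: split_beta intro!: continuous_intros)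
  qed
  then show ?thesis by (simp add: Av_def)
qed

lemma Av_cont:
  assumes "continuous_on {0..R} g"
  shows "continuous_on {0..R} (Av p g)"
proof -
  have "continuous_on ({0::real} \<times> {0..R}) (\<lambda>q. Av p ((\<lambda>_. g) (fst q)) (snd q))"
    by (rule Av_cont2) (auto intro!: continuous_on_compose2[OF assms] continuous_intros)
  then have "continuous_on {0..R} (\<lambda>r. (\<lambda>q. Av p ((\<lambda>_. g) (fst q)) (snd q)) (0::real, r))"
    by (rule continuous_on_compose2) (auto intro!: continuous_on_Pair)
  then show ?thesis by simp
qed

lemma Av_deriv:
  assumes g: "\<And>r. r \<in> {0..R} \<Longrightarrow> (g has_real_derivative g' r) (at r within {0..R})"
    and g': "continuous_on {0..R} g'" and r: "r \<in> {0..R}"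
  shows "(Av p g has_real_derivative Av (Suc p) g' r) (at r within {0..R})"
proof -
  have cg: "continuous_on {0..R} g"
    using g by (meson DERIV_continuous_on)
  have "((\<lambda>x. integral (cbox 0 1) (\<lambda>t. t ^ p * g (x * t))) has_real_derivative
      integral (cbox 0 1) (\<lambda>t. t ^ p * (g' (r * t) * t))) (at r within {0..R})"
  proof (rule leibniz_rule_field_derivative)
    fix x t :: real assume x: "x \<in> {0..R}" and t: "t \<in> cbox 0 1"
    have m: "x * t \<in> {0..R}" using scale_mem x t by auto
    have "((\<lambda>x. g (x * t)) has_real_derivative g' (x * t) * t) (at x within {0..R})"
      by (rule DERIV_chain_within[where y = "\<lambda>x. x * t", OF g[OF m]])
         (use t scale_mem in \<open>auto intro!: derivative_eq_intros\<close>)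
    then show "((\<lambda>x. t ^ p * g (x * t)) has_real_derivative t ^ p * (g' (x * t) * t)) (at x within {0..R})"
      by (rule DERIV_cmult)
  next
    have "continuous_on ({0..R} \<times> cbox 0 1) (\<lambda>z. g' (fst z * snd z))"
      by (rule continuous_on_compose2[OF g'])
         (auto intro!: continuous_intros simp: mult_left_le mult_le_one mult_mono order_trans[OF mult_left_le])
    then show "continuous_on ({0..R} \<times> cbox 0 1) (\<lambda>(x, t). t ^ p * (g' (x * t) * t))"
      by (auto simp: split_beta intro!: continuous_intros)
  qed (use r Av_integrable[OF cg] in auto)
  then show ?thesis by (simp add: Av_def[abs_def] algebra_simps)
qed

lemma Av_eq_integral:
  assumes "continuous_on {0..R} g" "r \<in> {0..R}"
  shows "r ^ Suc p * Av p g r = integral {0..r} (\<lambda>s. s ^ p * g s)"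
proof (cases "r = 0")
  case False
  then have r: "r > 0" using assms by auto
  have "((\<lambda>s. s ^ p * g s) has_integral integral {0..r} (\<lambda>s. s ^ p * g s)) {0..r}"
    by (intro integrable_integral integrable_continuous_real continuous_intros continuous_on_subset[OF assms(1)])
      (use assms in auto)
  from has_integral_affinity'[OF this[folded cbox_interval] r, of 0]
  have "((\<lambda>t. (r * t) ^ p * g (r * t)) has_integral integral {0..r} (\<lambda>s. s ^ p * g s) / r) {0..1}"
    using r by (simp add: divide_inverse mult.commute)
  then have "((\<lambda>t. r ^ p * (t ^ p * g (r * t))) has_integral integral {0..r} (\<lambda>s. s ^ p * g s) / r) {0..1}"
    by (simp add: power_mult_distrib mult.assoc)
  moreover have "((\<lambda>t. r ^ p * (t ^ p * g (r * t))) has_integral r ^ p * Av p g r) {0..1}"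
    unfolding Av_def by (intro has_integral_mult_right integrable_integral Av_integrable[OF assms])
  ultimately have "integral {0..r} (\<lambda>s. s ^ p * g s) / r = r ^ p * Av p g r"
    by (rule has_integral_unique)
  then show ?thesis using r by (simp add: field_simps)
qed auto

lemma Av_at_0: "Av p g 0 = g 0 / (p + 1)"
  using Av_const[of p "g 0" 0] by (simp add: Av_def)

text \<open>The derivative of r^(p+1) \<open>Av p g\<close> is computed in two ways, by the
  fundamental theorem and under the integral sign. A factor r thus pays for the removal of a
  derivative of g.\<close>

lemma Av_parts:
  assumes g: "\<And>r. r \<in> {0..R} \<Longrightarrow> (g has_real_derivative g' r) (at r within {0..R})"
    and g': "continuous_on {0..R} g'" and r: "r \<in> {0..R}"
  shows "r * Av (Suc p) g' r = g r - (p + 1) * Av p g r"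
proof (cases "r = 0")
  case True then show ?thesis by (simp add: Av_at_0 field_simps)
next
  case False
  then have r0: "r > 0" using r by auto
  have cg: "continuous_on {0..R} g"
    using g by (meson DERIV_continuous_on)
  have c: "continuous_on {0..R} (\<lambda>s. s ^ p * g s)" using cg by (intro continuous_intros)
  have "((\<lambda>x. integral {0..x} (\<lambda>s. s ^ p * g s)) has_real_derivative r ^ p * g r) (at r within {0..R})"
    by (rule integral_has_real_derivative[OF c r])
  then have 1: "((\<lambda>x. x ^ Suc p * Av p g x) has_real_derivative r ^ p * g r) (at r within {0..R})"
    by (rule has_field_derivative_transform_within[OF _ zero_less_one r]) (simp add: Av_eq_integral[OF cg] del: power_Suc)
  have 2: "((\<lambda>x. x ^ Suc p * Av p g x) has_real_derivative
      r ^ Suc p * Av (Suc p) g' r + (1 + p) * r ^ p * Av p g r) (at r within {0..R})"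
    using Av_deriv[OF g g' r, of p]
    by (auto intro!: derivative_eq_intros simp del: power_Suc simp: algebra_simps)
  have "r ^ p * g r = r ^ Suc p * Av (Suc p) g' r + (1 + p) * r ^ p * Av p g r"
    by (rule DERIV_Icc_unique[OF 1 2]) (use r r0 in auto)
  then have "r ^ p * (r * Av (Suc p) g' r) = r ^ p * (g r - (p + 1) * Av p g r)"
    by (simp add: algebra_simps)
  then show ?thesis using r0 by (simp only: mult_cancel_left) auto
qed

section \<open>The coefficients of the equation\<close>

declare One_nat_def [simp del]

locale bondi =
  fixes \<kappa> \<Lambda> R :: real
  assumes kappa_pos: "\<kappa> > 0" and Lambda_pos: "\<Lambda> > 0" and R_pos: "R > 0"
begin

text \<open>With \<open>w = \<partial>\<^sub>r h\<close> these are \<open>f\<close>, \<open>\<partial>\<^sub>r f\<close>, \<open>a = f~/2\<close>, \<open>G\<close>, \<open>G (h - ravg h)\<close>, an auxiliary coefficient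
  (equal to \<open>r \<partial>\<^sub>r G\<close> wherever \<open>G\<close> is differentiable) and \<open>\<partial>\<^sub>r (G (h - ravg h))\<close>. Moreover \<open>G = \<partial>\<^sub>r a\<close>, and
  everything is written through averages of \<open>w\<close>, without a division by \<open>r\<close>.\<close>

definition Ff :: "(real \<Rightarrow> real) \<Rightarrow> real \<Rightarrow> real" where
  "Ff w r = exp (\<kappa> / 2 * integral {0..r} (\<lambda>s. s * (Av 1 w s)\<^sup>2))"

definition Fd :: "(real \<Rightarrow> real) \<Rightarrow> real \<Rightarrow> real" where
  "Fd w r = \<kappa> / 2 * (r * (Av 1 w r)\<^sup>2) * Ff w r"

definition aa :: "(real \<Rightarrow> real) \<Rightarrow> real \<Rightarrow> real" where
  "aa w r = (Av 0 (Ff w) r - \<Lambda> * r\<^sup>2 * Av 2 (Ff w) r) / 2"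

definition GG :: "(real \<Rightarrow> real) \<Rightarrow> real \<Rightarrow> real" where
  "GG w r = (Av 1 (Fd w) r + \<Lambda> * r * (Av 2 (Ff w) r - Ff w r)) / 2"

definition TT :: "(real \<Rightarrow> real) \<Rightarrow> real \<Rightarrow> real" where
  "TT w r = GG w r * (r * Av 1 w r)"

definition cc :: "(real \<Rightarrow> real) \<Rightarrow> real \<Rightarrow> real" where
  "cc w r = Fd w r * (1 - \<Lambda> * r\<^sup>2) / 2 - \<Lambda> * r * Ff w r - 2 * GG w r"

definition TTd :: "(real \<Rightarrow> real) \<Rightarrow> real \<Rightarrow> real" where
  "TTd w r = cc w r * Av 1 w r + GG w r * (w r - Av 1 w r)"

context
  fixes w :: "real \<Rightarrow> real"
  assumes w: "continuous_on {0..R} w"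
begin

lemma Ff_integrand_cont: "continuous_on {0..R} (\<lambda>s. s * (Av 1 w s)\<^sup>2)"
  by (intro continuous_intros Av_cont w)

lemma Ff_deriv:
  assumes "r \<in> {0..R}"
  shows "(Ff w has_real_derivative Fd w r) (at r within {0..R})"
  using integral_has_real_derivative[OF Ff_integrand_cont assms]
  unfolding Ff_def[abs_def] Fd_def by (auto intro!: derivative_eq_intros)

lemma Ff_cont: "continuous_on {0..R} (Ff w)"
  using Ff_deriv by (meson DERIV_continuous_on)

lemma Fd_cont: "continuous_on {0..R} (Fd w)"
  unfolding Fd_def[abs_def] by (intro continuous_intros Ff_cont Av_cont w)

lemma GG_cont: "continuous_on {0..R} (GG w)"
  unfolding GG_def[abs_def] by (intro continuous_intros Ff_cont Fd_cont Av_cont) auto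

lemma Av2_Ff_parts: "r \<in> {0..R} \<Longrightarrow> r * Av 3 (Fd w) r = Ff w r - 3 * Av 2 (Ff w) r"
  using Av_parts[OF Ff_deriv Fd_cont, of r 2] by simp

lemma Av0_Ff_parts: "r \<in> {0..R} \<Longrightarrow> r * Av 1 (Fd w) r = Ff w r - Av 0 (Ff w) r"
  using Av_parts[OF Ff_deriv Fd_cont, of r 0, folded One_nat_def] by simp

text \<open>Integration by parts replaces r \<open>Av 3 (Fd w)\<close> by
  \<open>Ff w r - 3 * Av 2 (Ff w) r\<close>; the 3 against the 2 from differentiating r^2 leaves the
  single average in \<open>GG\<close>.\<close>

lemma aa_deriv:
  assumes "r \<in> {0..R}"
  shows "(aa w has_real_derivative GG w r) (at r within {0..R})"
proof -
  have "(aa w has_real_derivative (Av 1 (Fd w) r - (2 * \<Lambda> * r * Av 2 (Ff w) r + \<Lambda> * r\<^sup>2 * Av 3 (Fd w) r)) / 2)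
     (at r within {0..R})"
    using Av_deriv[OF Ff_deriv Fd_cont assms, of 0, folded One_nat_def] Av_deriv[OF Ff_deriv Fd_cont assms, of 2]
    unfolding aa_def[abs_def] by (auto intro!: derivative_eq_intros)
  moreover have "\<Lambda> * r\<^sup>2 * Av 3 (Fd w) r = \<Lambda> * r * (Ff w r - 3 * Av 2 (Ff w) r)"
    using Av2_Ff_parts[OF assms] by (simp add: power2_eq_square)
  moreover from this have "(Av 1 (Fd w) r - (2 * \<Lambda> * r * Av 2 (Ff w) r + \<Lambda> * r\<^sup>2 * Av 3 (Fd w) r)) / 2 = GG w r"
    by (simp add: GG_def field_simps)
  ultimately show ?thesis by (simp only:)
qed

lemma GG_eq:
  assumes "r \<in> {0..R}"
  shows "2 * r * GG w r = Ff w r - 2 * aa w r - \<Lambda> * Ff w r * r\<^sup>2"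
proof -
  have "2 * r * GG w r = r * Av 1 (Fd w) r + \<Lambda> * r\<^sup>2 * (Av 2 (Ff w) r - Ff w r)"
    by (simp add: GG_def field_simps power2_eq_square)
  then show ?thesis
    unfolding Av0_Ff_parts[OF assms] aa_def by (simp add: field_simps)
qed

lemma GG_0: "GG w 0 = 0"
  by (simp add: GG_def Av_at_0 Fd_def)

lemma aa_0: "aa w 0 = 1 / 2"
  by (simp add: aa_def Av_at_0 Ff_def)

lemma primitive_deriv:
  "r \<in> {0..R} \<Longrightarrow> ((\<lambda>x. integral {0..x} w) has_real_derivative w r) (at r within {0..R})"
  using integral_has_real_derivative[OF w] .

text \<open>Only continuity of w is available, so \<open>GG\<close> and \<open>Av 1 w\<close> are
  not differentiated separately. At r = 0 the difference quotient is their product, which is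
  continuous. For r > 0, \<open>TT\<close> equals P q / (2 r), where P = 2 r \<open>GG\<close> and q
  = h - \<open>Av 0 h\<close> are built from functions with known derivatives; any primitive h of w
  serves.\<close>

lemma TT_deriv:
  assumes r: "r \<in> {0..R}"
  shows "(TT w has_real_derivative TTd w r) (at r within {0..R})"
proof (cases "r = 0")
  case True
  have "((\<lambda>x. GG w x * Av 1 w x) \<longlongrightarrow> GG w 0 * Av 1 w 0) (at 0 within {0..R})"
    using continuous_on_mult[OF GG_cont Av_cont[OF w, of 1]] r True unfolding continuous_on_def by blast
  moreover have "TTd w 0 = GG w 0 * Av 1 w 0"
    by (simp add: TTd_def cc_def GG_0 Fd_def)
  ultimately have "((\<lambda>x. (TT w x - TT w 0) / (x - 0)) \<longlongrightarrow> TTd w 0) (at 0 within {0..R})"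
    by (auto intro: Lim_transform_eventually simp: eventually_at_filter TT_def)
  then show ?thesis using True by (simp add: has_field_derivative_iff)
next
  case False
  define h where "h x = integral {0..x} w" for x
  have h: "(h has_real_derivative w x) (at x within {0..R})" if "x \<in> {0..R}" for x
    using primitive_deriv[OF that] by (simp add: h_def[abs_def])
  define P where "P x = Ff w x - 2 * aa w x - \<Lambda> * Ff w x * x\<^sup>2" for x
  define q where "q x = h x - Av 0 h x" for x
  have q: "q x = x * Av 1 w x" if "x \<in> {0..R}" for x
    using Av_parts[OF h w that, of 0, folded One_nat_def] by (simp add: q_def)
  have P: "P x = 2 * x * GG w x" if "x \<in> {0..R}" for x
    using GG_eq[OF that] by (simp add: P_def)
  define Pd where "Pd = Fd w r - 2 * GG w r - \<Lambda> * (Fd w r * r\<^sup>2 + 2 * r * Ff w r)"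
  have Pd: "(P has_real_derivative Pd) (at r within {0..R})"
    unfolding P_def[abs_def] Pd_def using Ff_deriv[OF r] aa_deriv[OF r]
    by (auto intro!: derivative_eq_intros simp: algebra_simps)
  have qd: "(q has_real_derivative w r - Av 1 w r) (at r within {0..R})"
    unfolding q_def[abs_def] using h[OF r] Av_deriv[OF h w r, of 0, folded One_nat_def]
    by (auto intro!: derivative_eq_intros)
  have "((\<lambda>x. P x * q x / (2 * x)) has_real_derivative
     ((Pd * q r + P r * (w r - Av 1 w r)) * (2 * r) - P r * q r * 2) / (2 * r)\<^sup>2) (at r within {0..R})"
    using False Pd qd by (auto intro!: derivative_eq_intros simp: power2_eq_square algebra_simps)
  also have "((Pd * q r + P r * (w r - Av 1 w r)) * (2 * r) - P r * q r * 2) / (2 * r)\<^sup>2 = TTd w r"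
    unfolding q[OF r] P[OF r] TTd_def cc_def Pd_def using False
    by (simp add: field_simps power2_eq_square)
  finally show ?thesis
    by (rule has_field_derivative_transform_within[OF _ zero_less_one r])
       (simp add: P q TT_def)
qed

section \<open>Signs and bounds of the coefficients\<close>

lemma Ff_le_mono: "r \<in> {0..R} \<Longrightarrow> s \<in> {0..r} \<Longrightarrow> Ff w s \<le> Ff w r"
  unfolding Ff_def using kappa_pos
  by (auto intro!: mult_left_mono integral_subset_le integrable_continuous_real
       intro: continuous_on_subset[OF Ff_integrand_cont])

lemma Ff_ge_1: "r \<in> {0..R} \<Longrightarrow> Ff w r \<ge> 1"
  using Ff_le_mono[of r 0] by (simp add: Ff_def)

text \<open>\<open>Av 1 w\<close> is at most B/2 in absolute value, and s (B/2)^2 integrates to r^2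
  B^2 / 8. The factor \<kappa>/2 in \<open>Ff\<close> then gives the exponent with 1/16.\<close>

lemma Ff_integral_le:
  assumes B: "\<And>r. r \<in> {0..R} \<Longrightarrow> \<bar>w r\<bar> \<le> B" and r: "r \<in> {0..R}"
  shows "integral {0..r} (\<lambda>s. s * (Av 1 w s)\<^sup>2) \<le> R\<^sup>2 * B\<^sup>2 / 8"
proof -
  have "((\<lambda>s. s * (B / 2)\<^sup>2) has_integral r\<^sup>2 / 2 * (B / 2)\<^sup>2 - 0\<^sup>2 / 2 * (B / 2)\<^sup>2) {0..r}"
    using r by (intro fundamental_theorem_of_calculus)
      (auto simp flip: has_real_derivative_iff_has_vector_derivative intro!: derivative_eq_intros)
  then have i: "((\<lambda>s. s * (B / 2)\<^sup>2) has_integral r\<^sup>2 * B\<^sup>2 / 8) {0..r}"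
    by (simp add: power2_eq_square field_simps)
  have "integral {0..r} (\<lambda>s. s * (Av 1 w s)\<^sup>2) \<le> integral {0..r} (\<lambda>s. s * (B / 2)\<^sup>2)"
  proof (rule integral_le)
    fix s assume s: "s \<in> {0..r}"
    have "\<bar>Av 1 w s\<bar> \<le> B / 2" using Av_abs_le[OF w, of s B 1] B s r by auto
    then show "s * (Av 1 w s)\<^sup>2 \<le> s * (B / 2)\<^sup>2"
      using s by (intro mult_left_mono power2_le_iff_abs_le[THEN iffD2]) auto
  qed (use r in \<open>auto intro!: integrable_continuous_real has_integral_integrable[OF i] intro: continuous_on_subset[OF Ff_integrand_cont]\<close>)
  also have "\<dots> = r\<^sup>2 * B\<^sup>2 / 8" using i by (rule integral_unique)
  also have "\<dots> \<le> R\<^sup>2 * B\<^sup>2 / 8" using r by (intro divide_right_mono mult_right_mono power_mono) auto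
  finally show ?thesis .
qed

lemma Ff_le:
  assumes "\<And>r. r \<in> {0..R} \<Longrightarrow> \<bar>w r\<bar> \<le> B" "r \<in> {0..R}"
  shows "Ff w r \<le> exp (\<kappa> * R\<^sup>2 * B\<^sup>2 / 16)"
  using mult_left_mono[OF Ff_integral_le[OF assms], of "\<kappa> / 2"] kappa_pos by (simp add: Ff_def)

text \<open>Two terms compete. As \<open>Ff\<close> is nondecreasing and at least 1,
  \<open>Av 1 (Fd w) r\<close> is at most \<kappa> B^2 / 16 times r \<open>Ff w r\<close>, while the
  cosmological term is at most -2 \<Lambda> / 3 times the same quantity. The bound on \<kappa> B^2
  makes the first number at most \<Lambda> / 2.\<close>

lemma GG_nonpos:
  assumes B: "\<And>r. r \<in> {0..R} \<Longrightarrow> \<bar>w r\<bar> \<le> B" and kB: "\<kappa> * B\<^sup>2 \<le> 8 * \<Lambda>" and r: "r \<in> {0..R}"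
  shows "GG w r \<le> 0"
proof -
  have F: "1 \<le> Ff w s" "Ff w s \<le> Ff w r" if "s \<in> {0..r}" for s
    using Ff_ge_1[of s] Ff_le_mono[OF r that] that r by auto
  have F0: "Ff w r \<ge> 1" using F r by auto
  have "\<bar>Av 2 (Ff w) r\<bar> \<le> Ff w r / (real 2 + 1)"
    using Av_abs_le[OF Ff_cont r, of "Ff w r" 2] F by fastforce
  then have 1: "Av 2 (Ff w) r \<le> Ff w r / 3" by simp
  have "\<bar>Fd w s\<bar> \<le> \<kappa> / 2 * (r * (B / 2)\<^sup>2) * Ff w r" if s: "s \<in> {0..r}" for s
  proof -
    have "\<bar>Av 1 w s\<bar> \<le> B / 2" using Av_abs_le[OF w, of s B 1] B s r by auto
    then have "(Av 1 w s)\<^sup>2 \<le> (B / 2)\<^sup>2" by (meson abs_le_square_iff abs_ge_self order_trans power2_abs power2_le_iff_abs_le abs_ge_zero)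
    then have "\<kappa> / 2 * (s * (Av 1 w s)\<^sup>2) * Ff w s \<le> \<kappa> / 2 * (r * (B / 2)\<^sup>2) * Ff w r"
      using s F[OF s] F0 kappa_pos by (intro mult_mono) auto
    moreover have "Fd w s \<ge> 0" unfolding Fd_def using s F[OF s] kappa_pos by auto
    ultimately show ?thesis by (simp add: Fd_def)
  qed
  from Av_abs_le[OF Fd_cont r this, of 1]
  have 2: "Av 1 (Fd w) r \<le> \<kappa> * B\<^sup>2 / 16 * (r * Ff w r)" by (simp add: power2_eq_square mult_ac abs_le_iff)
  have "2 * GG w r \<le> \<kappa> * B\<^sup>2 / 16 * (r * Ff w r) + \<Lambda> * r * (Ff w r / 3 - Ff w r)"
  proof -
    have "\<Lambda> * r * (Av 2 (Ff w) r - Ff w r) \<le> \<Lambda> * r * (Ff w r / 3 - Ff w r)"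
      using 1 r Lambda_pos by (intro mult_left_mono) auto
    moreover have "2 * GG w r = Av 1 (Fd w) r + \<Lambda> * r * (Av 2 (Ff w) r - Ff w r)"
      by (simp add: GG_def)
    ultimately show ?thesis using add_mono[OF 2] by (simp only:)
  qed
  also have "\<dots> = (\<kappa> * B\<^sup>2 / 16 - 2 * \<Lambda> / 3) * (r * Ff w r)" by (simp add: field_simps)
  also have "\<dots> \<le> 0" using kB r F0 Lambda_pos by (intro mult_nonpos_nonneg) auto
  finally show ?thesis by simp
qed

text \<open>\<open>Ff\<close> lies between 1 and \<Lambda> R^2 / 3, so both averages in
  \<open>aa\<close> compare with the same number \<Lambda> R^2 / 3. The size of R enters here: for B
  > 0 the hypothesis \<open>E\<close> forces \<Lambda> R^2 > 3.\<close>

lemma aa_R_nonpos: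
  assumes B: "\<And>r. r \<in> {0..R} \<Longrightarrow> \<bar>w r\<bar> \<le> B"
    and E: "exp (\<kappa> * R\<^sup>2 * B\<^sup>2 / 16) \<le> \<Lambda> * R\<^sup>2 / 3"
  shows "aa w R \<le> 0"
proof -
  have "Av 0 (Ff w) R \<le> Av 0 (\<lambda>_. \<Lambda> * R\<^sup>2 / 3) R"
    using R_pos order_trans[OF Ff_le[OF B] E] by (intro Av_mono[OF Ff_cont]) auto
  moreover have "Av 2 (\<lambda>_. 1) R \<le> Av 2 (Ff w) R"
    using R_pos Ff_ge_1 by (intro Av_mono[OF _ Ff_cont]) auto
  then have "\<Lambda> * R\<^sup>2 * (1/3) \<le> \<Lambda> * R\<^sup>2 * Av 2 (Ff w) R"
    using Lambda_pos by (intro mult_left_mono) (auto simp: Av_const)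
  ultimately show ?thesis by (simp add: aa_def Av_const)
qed

section \<open>The coefficients in terms of the original definitions\<close>

lemma ravg_Av:
  assumes "continuous_on {0..R} g" "r \<in> {0..R}"
  shows "ravg g r = Av 0 g r"
  using Av_eq_integral[OF assms, of 0] Av_at_0[of 0 g] by (auto simp: ravg_def field_simps)

lemma ravg_diff:
  assumes h: "\<And>r. r \<in> {0..R} \<Longrightarrow> (h has_real_derivative w r) (at r within {0..R})"
    and r: "r \<in> {0..R}"
  shows "h r - ravg h r = r * Av 1 w r"
  using Av_parts[OF h w r, of 0, folded One_nat_def] ravg_Av[OF DERIV_continuous_on[OF h] r] by simp

context
  fixes H :: "real \<Rightarrow> real \<Rightarrow> real" and u :: real
  assumes H: "\<And>r. r \<in> {0..R} \<Longrightarrow> (H u has_real_derivative w r) (at r within {0..R})"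
begin

lemma ffun_eq:
  assumes r: "r \<in> {0..R}"
  shows "ffun \<kappa> H u r = Ff w r"
proof -
  have "(H u s - ravg (H u) s)\<^sup>2 / s = s * (Av 1 w s)\<^sup>2" if "s \<in> {0..r}" for s
    using ravg_diff[where h = "H u", OF H, of s] that r by (simp add: power2_eq_square)
  then show ?thesis
    unfolding ffun_def Ff_def by (metis (no_types, lifting) integral_cong)
qed

lemma ftil_eq:
  assumes r: "r \<in> {0..R}"
  shows "ftil \<kappa> \<Lambda> H u r = 2 * aa w r"
proof -
  have c: "continuous_on {0..R} (ffun \<kappa> H u)"
    using Ff_cont by (subst continuous_on_cong[OF refl ffun_eq]) auto
  have "ravg (ffun \<kappa> H u) r = Av 0 (Ff w) r"
    unfolding ravg_Av[OF c r] by (rule Av_cong[OF ffun_eq r]) auto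
  moreover have "integral {0..r} (\<lambda>s. ffun \<kappa> H u s * s\<^sup>2) = integral {0..r} (\<lambda>s. s\<^sup>2 * Ff w s)"
    using r by (intro integral_cong) (auto simp: ffun_eq)
  ultimately show ?thesis
    using Av_eq_integral[OF Ff_cont r, of 2, symmetric]
    by (simp add: ftil_def aa_def power2_eq_square power3_eq_cube)
qed

text \<open>At r = 0 the quotient in \<open>Gfun\<close> takes the value 0 of a division by zero,
  which agrees with the limit \<open>GG w 0 = 0\<close>.\<close>

lemma Gfun_eq:
  assumes r: "r \<in> {0..R}"
  shows "Gfun \<kappa> \<Lambda> H u r = GG w r"
  using GG_eq[OF r] GG_0 unfolding Gfun_def ftil_eq[OF r] ffun_eq[OF r]
  by (cases "r = 0") (auto simp: field_simps)

lemma source_eq: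
  assumes r: "r \<in> {0..R}"
  shows "Gfun \<kappa> \<Lambda> H u r * (H u r - ravg (H u) r) = TT w r"
  using ravg_diff[where h = "H u", OF H r] by (simp only: Gfun_eq[OF r] TT_def)

end

end

end

section \<open>Lipschitz dependence of the coefficients\<close>

lemma exp_diff_abs_le:
  fixes x y :: real
  assumes "exp x \<le> E" "exp y \<le> E"
  shows "\<bar>exp x - exp y\<bar> \<le> E * \<bar>x - y\<bar>"
proof -
  have *: "exp a - exp b \<le> E * \<bar>a - b\<bar>" if "exp a \<le> E" for a b :: real
  proof -
    have "exp b = exp a * exp (b - a)" by (simp flip: exp_add)
    also have "exp a * (1 + (b - a)) \<le> exp a * exp (b - a)"
      by (intro mult_left_mono exp_ge_add_one_self) auto
    finally have "exp a - exp b \<le> exp a * (a - b)" by (simp add: algebra_simps)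
    also have "\<dots> \<le> exp a * \<bar>a - b\<bar>" by (intro mult_left_mono) auto
    also have "\<dots> \<le> E * \<bar>a - b\<bar>" using that by (intro mult_right_mono) auto
    finally show ?thesis .
  qed
  show ?thesis using *[OF assms(1), of y] *[OF assms(2), of x] by (auto simp: abs_if)
qed

lemma mult_diff_abs_le:
  fixes a b c d :: real
  assumes "\<bar>a - c\<bar> \<le> p" "\<bar>b - d\<bar> \<le> q" "\<bar>b\<bar> \<le> P" "\<bar>c\<bar> \<le> Q"
  shows "\<bar>a * b - c * d\<bar> \<le> p * P + Q * q"
proof -
  have "a * b - c * d = (a - c) * b + c * (b - d)" by (simp add: algebra_simps)
  also have "\<bar>\<dots>\<bar> \<le> \<bar>(a - c) * b\<bar> + \<bar>c * (b - d)\<bar>" by (rule abs_triangle_ineq)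
  also have "\<dots> \<le> p * P + Q * q" unfolding abs_mult using assms by (intro add_mono mult_mono) auto
  finally show ?thesis .
qed

lemma Icc_Lipschitz:
  fixes g :: "real \<Rightarrow> real"
  assumes "\<And>r. r \<in> {a..b} \<Longrightarrow> (g has_real_derivative g' r) (at r within {a..b})"
    and "\<And>r. r \<in> {a..b} \<Longrightarrow> \<bar>g' r\<bar> \<le> C" and "r \<in> {a..b}" "r' \<in> {a..b}"
  shows "\<bar>g r - g r'\<bar> \<le> C * \<bar>r - r'\<bar>"
  using field_differentiable_bound[of "{a..b}" g g' C r r'] assms by auto

lemma abs_half_le: "x = n / 2 \<Longrightarrow> \<bar>n\<bar> \<le> K \<Longrightarrow> \<bar>x\<bar> \<le> K / 2" for x n K :: real
  by simp

context bondi begin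

definition C1_bounded :: "real \<Rightarrow> (real \<Rightarrow> real) \<Rightarrow> (real \<Rightarrow> real) \<Rightarrow> bool" where
  "C1_bounded M h w \<longleftrightarrow> (\<forall>r\<in>{0..R}. (h has_real_derivative w r) (at r within {0..R})) \<and>
     continuous_on {0..R} w \<and> (\<forall>r\<in>{0..R}. \<bar>w r\<bar> \<le> M)"

text \<open>Only the sup norm of \<open>h1 - h2\<close> enters, not that of the derivatives.\<close>

lemma functional_Lipschitz:
  fixes M :: real
  assumes M: "M \<ge> 0"
  obtains C where "C \<ge> 0"
    "\<And>h1 w1 h2 w2 e r. C1_bounded M h1 w1 \<Longrightarrow> C1_bounded M h2 w2 \<Longrightarrow>
      (\<And>r. r \<in> {0..R} \<Longrightarrow> \<bar>h1 r - h2 r\<bar> \<le> e) \<Longrightarrow> r \<in> {0..R} \<Longrightarrow>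
      \<bar>aa w1 r - aa w2 r\<bar> \<le> C * e \<and> \<bar>TT w1 r - TT w2 r\<bar> \<le> C * e"
proof -
  \<comment> \<open>\<open>C1\<close>, \<open>C2\<close>, \<open>C3\<close> will be Lipschitz
    constants of \<open>Ff\<close>, \<open>Fd\<close>, \<open>GG\<close> in terms of the sup norm of
    \<open>h1 - h2\<close>, and \<open>CG\<close> a bound for \<open>GG\<close>; the two summands of
    \<open>C\<close> serve \<open>aa\<close> and \<open>TT\<close>.\<close>
  define E where "E = exp (\<kappa> * R\<^sup>2 * M\<^sup>2 / 16)"
  define C1 where "C1 = E * (\<kappa> / 2 * (4 * M * R))"
  define C2 where "C2 = \<kappa> / 2 * (4 * M * E + R * M\<^sup>2 * C1)"
  define C3 where "C3 = (C2 + \<Lambda> * R * (2 * C1)) / 2"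
  define CG where "CG = (\<kappa> / 2 * (R * M\<^sup>2) * E + \<Lambda> * R * (2 * E)) / 2"
  define C where "C = (C1 + \<Lambda> * R\<^sup>2 * C1) / 2 + (C3 * (R * M) + CG * 2)"
  have E: "E > 0" by (simp add: E_def)
  have C1: "C1 \<ge> 0" using E M kappa_pos R_pos by (simp add: C1_def)
  have C2: "C2 \<ge> 0" using C1 E M kappa_pos R_pos by (simp add: C2_def)
  have C3: "C3 \<ge> 0" using C1 C2 E M Lambda_pos R_pos by (simp add: C3_def)
  have CG: "CG \<ge> 0" using E M Lambda_pos R_pos kappa_pos by (simp add: CG_def)
  have C: "C \<ge> 0" using C1 C3 CG M Lambda_pos R_pos by (simp add: C_def)
  show ?thesis
  proof (rule that[OF C])
    fix h1 w1 h2 w2 e r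
    assume C1b: "C1_bounded M h1 w1" "C1_bounded M h2 w2"
      and eps: "\<And>r. r \<in> {0..R} \<Longrightarrow> \<bar>h1 r - h2 r\<bar> \<le> e" and r: "r \<in> {0..R}"
    have h1: "\<And>r. r \<in> {0..R} \<Longrightarrow> (h1 has_real_derivative w1 r) (at r within {0..R})"
      and h2: "\<And>r. r \<in> {0..R} \<Longrightarrow> (h2 has_real_derivative w2 r) (at r within {0..R})"
      and w1: "continuous_on {0..R} w1" and w2: "continuous_on {0..R} w2"
      and M1: "\<And>r. r \<in> {0..R} \<Longrightarrow> \<bar>w1 r\<bar> \<le> M" and M2: "\<And>r. r \<in> {0..R} \<Longrightarrow> \<bar>w2 r\<bar> \<le> M"
      using C1b unfolding C1_bounded_def by blast+
    have e0: "e \<ge> 0" using eps[OF r] by linarith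
    have q1: "\<bar>Av 1 w1 s\<bar> \<le> M" and q2: "\<bar>Av 1 w2 s\<bar> \<le> M" if "s \<in> {0..R}" for s
      using Av_abs_le'[OF w1 that M1] Av_abs_le'[OF w2 that M2] by auto
    have h1c: "continuous_on {0..R} h1" and h2c: "continuous_on {0..R} h2"
      using h1 h2 by (meson DERIV_continuous_on)+
    \<comment> \<open>The factor s turns an average of w into h minus its radial average, which no
      longer contains a derivative.\<close>
    have d: "\<bar>s * Av 1 w1 s - s * Av 1 w2 s\<bar> \<le> 2 * e" if s: "s \<in> {0..R}" for s
    proof -
      have "\<bar>Av 0 h1 s - Av 0 h2 s\<bar> \<le> e"
        by (rule Av_diff_abs_le[OF h1c h2c s s]) (use eps scale_mem[OF s] in auto)
      with eps[OF s] Av_parts[OF h1 w1 s, of 0] Av_parts[OF h2 w2 s, of 0] show ?thesis by (simp add: One_nat_def)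
    qed
    have sq: "\<bar>s * (Av 1 w1 s)\<^sup>2 - s * (Av 1 w2 s)\<^sup>2\<bar> \<le> 4 * M * e" if s: "s \<in> {0..R}" for s
    proof -
      \<comment> \<open>The weight s is spent on the difference; the sum is controlled by the
        derivative bound M.\<close>
      have "s * (Av 1 w1 s)\<^sup>2 - s * (Av 1 w2 s)\<^sup>2 = (s * Av 1 w1 s - s * Av 1 w2 s) * (Av 1 w1 s + Av 1 w2 s)"
        by (simp add: power2_eq_square algebra_simps)
      also have "\<bar>\<dots>\<bar> \<le> (2 * e) * (M + M)"
        unfolding abs_mult using d[OF s] q1[OF s] q2[OF s] e0 by (intro mult_mono) auto
      finally show ?thesis by (simp add: algebra_simps)
    qed
    have FE: "Ff w1 s \<le> E" "Ff w2 s \<le> E" if "s \<in> {0..R}" for s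
      using Ff_le[OF w1 M1 that] Ff_le[OF w2 M2 that] by (auto simp: E_def)
    have F0: "Ff w s > 0" for w s by (simp add: Ff_def)
    have F: "\<bar>Ff w1 s - Ff w2 s\<bar> \<le> C1 * e" if s: "s \<in> {0..R}" for s
    proof -
      have c: "continuous_on {0..s} (\<lambda>s. s * (Av 1 w s)\<^sup>2)" if "continuous_on {0..R} w" for w
        by (rule continuous_on_subset[OF Ff_integrand_cont[OF that]]) (use s in auto)
      have "norm (integral {0..s} (\<lambda>s. s * (Av 1 w1 s)\<^sup>2 - s * (Av 1 w2 s)\<^sup>2)) \<le> 4 * M * e * (s - 0)"
        by (rule integral_bound) (use s sq in \<open>auto intro!: continuous_on_diff c w1 w2\<close>)
      also have "\<dots> \<le> 4 * M * e * R" using s M e0 by (intro mult_left_mono) auto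
      finally have I: "\<bar>integral {0..s} (\<lambda>s. s * (Av 1 w1 s)\<^sup>2) - integral {0..s} (\<lambda>s. s * (Av 1 w2 s)\<^sup>2)\<bar> \<le> 4 * M * e * R"
        using c w1 w2 by (subst (asm) integral_diff) (auto intro: integrable_continuous_real)
      have "\<bar>Ff w1 s - Ff w2 s\<bar> \<le> E * \<bar>\<kappa> / 2 * integral {0..s} (\<lambda>s. s * (Av 1 w1 s)\<^sup>2) - \<kappa> / 2 * integral {0..s} (\<lambda>s. s * (Av 1 w2 s)\<^sup>2)\<bar>"
        using FE[OF s] unfolding Ff_def by (rule exp_diff_abs_le)
      also have "\<dots> = E * (\<kappa> / 2 * \<bar>integral {0..s} (\<lambda>s. s * (Av 1 w1 s)\<^sup>2) - integral {0..s} (\<lambda>s. s * (Av 1 w2 s)\<^sup>2)\<bar>)"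
        using kappa_pos by (simp only: right_diff_distrib[symmetric] abs_mult abs_of_pos half_gt_zero)
      also have "\<dots> \<le> E * (\<kappa> / 2 * (4 * M * e * R))"
        using E kappa_pos I by (intro mult_left_mono) auto
      finally show ?thesis by (simp add: C1_def algebra_simps)
    qed
    have sqb: "\<bar>s * (Av 1 w2 s)\<^sup>2\<bar> \<le> R * M\<^sup>2" if s: "s \<in> {0..R}" for s
      unfolding abs_mult using s q2[OF s] M by (intro mult_mono) (auto simp: power2_le_iff_abs_le)
    have Fd: "\<bar>Fd w1 s - Fd w2 s\<bar> \<le> C2 * e" if s: "s \<in> {0..R}" for s
    proof -
      have "\<bar>s * (Av 1 w1 s)\<^sup>2 * Ff w1 s - s * (Av 1 w2 s)\<^sup>2 * Ff w2 s\<bar> \<le> 4 * M * e * E + R * M\<^sup>2 * (C1 * e)"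
        by (rule mult_diff_abs_le[OF sq[OF s] F[OF s] _ sqb[OF s]]) (use FE[OF s] F0[of w1 s] in simp)
      then have "\<kappa> / 2 * \<bar>s * (Av 1 w1 s)\<^sup>2 * Ff w1 s - s * (Av 1 w2 s)\<^sup>2 * Ff w2 s\<bar> \<le> \<kappa> / 2 * (4 * M * e * E + R * M\<^sup>2 * (C1 * e))"
        using kappa_pos by (intro mult_left_mono) auto
      moreover have "Fd w1 s - Fd w2 s = \<kappa> / 2 * (s * (Av 1 w1 s)\<^sup>2 * Ff w1 s - s * (Av 1 w2 s)\<^sup>2 * Ff w2 s)"
        by (simp add: Fd_def algebra_simps)
      then have "\<bar>Fd w1 s - Fd w2 s\<bar> = \<kappa> / 2 * \<bar>s * (Av 1 w1 s)\<^sup>2 * Ff w1 s - s * (Av 1 w2 s)\<^sup>2 * Ff w2 s\<bar>"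
        using kappa_pos by (simp only: abs_mult)
      ultimately show ?thesis by (simp add: C2_def algebra_simps)
    qed
    have Fdb: "\<bar>Fd w2 s\<bar> \<le> \<kappa> / 2 * (R * M\<^sup>2) * E" if s: "s \<in> {0..R}" for s
      unfolding Fd_def abs_mult[of "_ * _" "Ff _ _"] abs_mult[of "\<kappa> / 2"]
      using kappa_pos sqb[OF s] FE[OF s] F0[of w2 s] M R_pos
      by (intro mult_mono[of _ _ "\<bar>Ff w2 s\<bar>"] mult_mono[of "\<bar>\<kappa> / 2\<bar>"]) auto
    have AF: "\<bar>Av p (Ff w1) r - Av p (Ff w2) r\<bar> \<le> C1 * e" for p
      by (rule Av_diff_abs_le[OF Ff_cont[OF w1] Ff_cont[OF w2] r r]) (use F scale_mem[OF r] in auto)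
    have AFb: "\<bar>Av p (Ff w2) r\<bar> \<le> E" for p
      by (rule Av_abs_le'[OF Ff_cont[OF w2] r]) (use FE in \<open>simp add: abs_of_pos[OF F0]\<close>)
    have AFd: "\<bar>Av 1 (Fd w1) r - Av 1 (Fd w2) r\<bar> \<le> C2 * e"
      by (rule Av_diff_abs_le[OF Fd_cont[OF w1] Fd_cont[OF w2] r r]) (use Fd scale_mem[OF r] in auto)
    have AFdb: "\<bar>Av 1 (Fd w2) r\<bar> \<le> \<kappa> / 2 * (R * M\<^sup>2) * E"
      by (rule Av_abs_le'[OF Fd_cont[OF w2] r Fdb])
    have aa: "\<bar>aa w1 r - aa w2 r\<bar> \<le> (C1 + \<Lambda> * R\<^sup>2 * C1) / 2 * e"
    proof -
      have "\<bar>\<Lambda> * r\<^sup>2 * (Av 2 (Ff w1) r - Av 2 (Ff w2) r)\<bar> \<le> \<Lambda> * R\<^sup>2 * (C1 * e)"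
        unfolding abs_mult using r Lambda_pos AF[of 2] C1 e0 by (intro mult_mono) (auto simp: power_mono)
      with AF[of 0] have "\<bar>Av 0 (Ff w1) r - Av 0 (Ff w2) r - \<Lambda> * r\<^sup>2 * (Av 2 (Ff w1) r - Av 2 (Ff w2) r)\<bar> \<le> C1 * e + \<Lambda> * R\<^sup>2 * (C1 * e)"
        by linarith
      moreover have "aa w1 r - aa w2 r = (Av 0 (Ff w1) r - Av 0 (Ff w2) r - \<Lambda> * r\<^sup>2 * (Av 2 (Ff w1) r - Av 2 (Ff w2) r)) / 2"
        by (simp add: aa_def field_simps)
      ultimately have "\<bar>aa w1 r - aa w2 r\<bar> \<le> (C1 * e + \<Lambda> * R\<^sup>2 * (C1 * e)) / 2" by (metis abs_half_le)
      then show ?thesis by (simp add: algebra_simps)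
    qed
    have G: "\<bar>GG w1 r - GG w2 r\<bar> \<le> C3 * e"
    proof -
      have "\<bar>\<Lambda> * r * ((Av 2 (Ff w1) r - Av 2 (Ff w2) r) - (Ff w1 r - Ff w2 r))\<bar> \<le> \<Lambda> * R * (2 * (C1 * e))"
        unfolding abs_mult using r Lambda_pos AF[of 2] F[OF r] C1 e0 by (intro mult_mono) auto
      with AFd have "\<bar>Av 1 (Fd w1) r - Av 1 (Fd w2) r + \<Lambda> * r * ((Av 2 (Ff w1) r - Av 2 (Ff w2) r) - (Ff w1 r - Ff w2 r))\<bar> \<le> C2 * e + \<Lambda> * R * (2 * (C1 * e))"
        by linarith
      moreover have "GG w1 r - GG w2 r = (Av 1 (Fd w1) r - Av 1 (Fd w2) r + \<Lambda> * r * ((Av 2 (Ff w1) r - Av 2 (Ff w2) r) - (Ff w1 r - Ff w2 r))) / 2"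
        by (simp add: GG_def field_simps)
      ultimately have "\<bar>GG w1 r - GG w2 r\<bar> \<le> (C2 * e + \<Lambda> * R * (2 * (C1 * e))) / 2" by (metis abs_half_le)
      then show ?thesis by (simp add: C3_def algebra_simps)
    qed
    have Gb: "\<bar>GG w2 r\<bar> \<le> CG"
    proof -
      have "\<bar>\<Lambda> * r * (Av 2 (Ff w2) r - Ff w2 r)\<bar> \<le> \<Lambda> * R * (2 * E)"
        unfolding abs_mult using r Lambda_pos AFb[of 2] FE[OF r] F0[of w2 r] E by (intro mult_mono) auto
      with AFdb have "\<bar>Av 1 (Fd w2) r + \<Lambda> * r * (Av 2 (Ff w2) r - Ff w2 r)\<bar> \<le> \<kappa> / 2 * (R * M\<^sup>2) * E + \<Lambda> * R * (2 * E)"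
        by linarith
      then show ?thesis by (simp add: GG_def CG_def)
    qed
    have "\<bar>r * Av 1 w1 r\<bar> \<le> R * M" unfolding abs_mult using r q1[OF r] M by (intro mult_mono) auto
    from mult_diff_abs_le[OF G d[OF r] this Gb]
    have T: "\<bar>TT w1 r - TT w2 r\<bar> \<le> (C3 * (R * M) + CG * 2) * e"
      by (simp add: TT_def algebra_simps)
    have "(C1 + \<Lambda> * R\<^sup>2 * C1) / 2 * e \<le> C * e" "(C3 * (R * M) + CG * 2) * e \<le> C * e"
      unfolding C_def using e0 C1 C3 CG M R_pos Lambda_pos by (intro mult_right_mono; simp)+
    with aa T show "\<bar>aa w1 r - aa w2 r\<bar> \<le> C * e \<and> \<bar>TT w1 r - TT w2 r\<bar> \<le> C * e"
      by linarith
  qed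
qed

end

section \<open>Expressions in the jets\<close>

text \<open>Expressions in the jets \<open>V i = \<partial>\<^sub>r\<^sup>i w\<close>, in the step size \<open>Tau\<close> and in the operation \<open>Cmp\<close> of composing
  with the foot map \<open>r + Tau * a(r)\<close> of one step. They are closed under the formal \<open>r\<close>-derivative
  \<open>tderiv\<close>, so that uniform estimates for the derivatives of the scheme of all orders follow by structural induction.\<close>

datatype trm = V nat | Fs | Cn real | Rr | Tau | Add trm trm | Mul trm trm | Avt nat trm | Cmp trm

primrec order_le :: "nat \<Rightarrow> trm \<Rightarrow> bool" where
  "order_le j (V i) = (i \<le> j)"
| "order_le j Fs = True"
| "order_le j (Cn c) = True"
| "order_le j Rr = True"
| "order_le j Tau = True"
| "order_le j (Add a b) = (order_le j a \<and> order_le j b)"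
| "order_le j (Mul a b) = (order_le j a \<and> order_le j b)"
| "order_le j (Avt p a) = order_le j a"
| "order_le j (Cmp a) = order_le j a"

lemma order_le_mono: "order_le i e \<Longrightarrow> i \<le> j \<Longrightarrow> order_le j e"
  by (induction e) auto

context bondi begin

definition foot :: "real \<Rightarrow> (real \<Rightarrow> real) \<Rightarrow> real \<Rightarrow> real" where
  "foot s w r = r + s * aa w r"

primrec tval :: "real \<Rightarrow> (nat \<Rightarrow> real \<Rightarrow> real) \<Rightarrow> trm \<Rightarrow> real \<Rightarrow> real" where
  "tval s v (V i) = v i"
| "tval s v Fs = Ff (v 0)"
| "tval s v (Cn c) = (\<lambda>r. c)"
| "tval s v Rr = (\<lambda>r. r)"
| "tval s v Tau = (\<lambda>r. s)"
| "tval s v (Add a b) = (\<lambda>r. tval s v a r + tval s v b r)"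
| "tval s v (Mul a b) = (\<lambda>r. tval s v a r * tval s v b r)"
| "tval s v (Avt p a) = Av p (tval s v a)"
| "tval s v (Cmp a) = (\<lambda>r. tval s v a (foot s (v 0) r))"

definition Fd_trm :: trm where
  "Fd_trm = Mul (Mul (Cn (\<kappa> / 2)) (Mul Rr (Mul (Avt 1 (V 0)) (Avt 1 (V 0))))) Fs"

definition GG_trm :: trm where
  "GG_trm = Mul (Cn (1/2)) (Add (Avt 1 Fd_trm) (Mul (Mul (Cn \<Lambda>) Rr) (Add (Avt 2 Fs) (Mul (Cn (-1)) Fs))))"

definition cc_trm :: trm where
  "cc_trm = Add (Mul (Mul (Cn (1/2)) Fd_trm) (Add (Cn 1) (Mul (Cn (-\<Lambda>)) (Mul Rr Rr))))
     (Add (Mul (Mul (Cn (-\<Lambda>)) Rr) Fs) (Mul (Cn (-2)) GG_trm))"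

definition TTd_trm :: trm where
  "TTd_trm = Add (Mul cc_trm (Avt 1 (V 0))) (Mul GG_trm (Add (V 0) (Mul (Cn (-1)) (Avt 1 (V 0)))))"

primrec tderiv :: "trm \<Rightarrow> trm" where
  "tderiv (V i) = V (Suc i)"
| "tderiv Fs = Fd_trm"
| "tderiv (Cn c) = Cn 0"
| "tderiv Rr = Cn 1"
| "tderiv Tau = Cn 0"
| "tderiv (Add a b) = Add (tderiv a) (tderiv b)"
| "tderiv (Mul a b) = Add (Mul (tderiv a) b) (Mul a (tderiv b))"
| "tderiv (Avt p a) = Avt (Suc p) (tderiv a)"
| "tderiv (Cmp a) = Mul (Add (Cn 1) (Mul Tau GG_trm)) (Cmp (tderiv a))"

text \<open>One step of the scheme replaces \<open>V j\<close> by \<open>Cmp (V j) + Tau * jet_source j\<close>.\<close>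

primrec jet_source :: "nat \<Rightarrow> trm" where
  "jet_source 0 = Add (Mul GG_trm (Cmp (V 0))) TTd_trm"
| "jet_source (Suc j) = Add (tderiv (jet_source j)) (Mul GG_trm (Cmp (V (Suc j))))"

lemma tval_Fd_trm: "tval s v Fd_trm = Fd (v 0)"
  by (auto simp: Fd_trm_def Fd_def power2_eq_square)

lemma tval_GG_trm: "tval s v GG_trm = GG (v 0)"
  by (auto simp: GG_trm_def GG_def tval_Fd_trm)

lemma tval_TTd_trm: "tval s v TTd_trm = TTd (v 0)"
  by (auto simp: TTd_trm_def TTd_def cc_trm_def cc_def tval_Fd_trm tval_GG_trm power2_eq_square algebra_simps)

lemma order_le_Fd_trm: "order_le j Fd_trm" and order_le_GG_trm: "order_le j GG_trm" and order_le_TTd_trm: "order_le j TTd_trm"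
  by (auto simp: Fd_trm_def GG_trm_def cc_trm_def TTd_trm_def)

lemma order_le_tderiv: "order_le j e \<Longrightarrow> order_le (Suc j) (tderiv e)"
  by (induction e) (auto simp: order_le_Fd_trm order_le_GG_trm intro: order_le_mono)

lemma order_le_jet_source: "order_le j (jet_source j)"
  by (induction j) (auto simp: order_le_GG_trm order_le_TTd_trm order_le_tderiv)

text \<open>The self-map property gives meaning to \<open>Cmp\<close>, the 1-Lipschitz property lets
  \<open>Cmp\<close> preserve moduli of continuity, and the range of s bounds
  \<open>Tau\<close>.\<close>

definition adm :: "real \<Rightarrow> (nat \<Rightarrow> real \<Rightarrow> real) \<Rightarrow> bool" where
  "adm s v \<longleftrightarrow> s \<in> {0..1} \<and> continuous_on {0..R} (v 0) \<and> (\<forall>r\<in>{0..R}. foot s (v 0) r \<in> {0..R}) \<and>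
     (\<forall>r\<in>{0..R}. \<forall>r'\<in>{0..R}. \<bar>foot s (v 0) r - foot s (v 0) r'\<bar> \<le> \<bar>r - r'\<bar>)"

lemma adm_0: "continuous_on {0..R} (v 0) \<Longrightarrow> adm 0 v"
  by (auto simp: adm_def foot_def)

lemma foot_deriv:
  "continuous_on {0..R} w \<Longrightarrow> r \<in> {0..R} \<Longrightarrow> (foot s w has_real_derivative 1 + s * GG w r) (at r within {0..R})"
  unfolding foot_def[abs_def] by (auto intro!: derivative_eq_intros aa_deriv)

lemma tval_cont:
  assumes "adm s v" "\<And>i. i \<le> j \<Longrightarrow> continuous_on {0..R} (v i)" "order_le j e"
  shows "continuous_on {0..R} (tval s v e)"
  using assms(3)
proof (induction e)
  case (Cmp e)
  have v0: "continuous_on {0..R} (v 0)" using assms(1) by (simp add: adm_def)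
  have "continuous_on {0..R} (foot s (v 0))" using foot_deriv[OF v0] by (meson DERIV_continuous_on)
  then show ?case
    using Cmp assms(1) by (auto simp: adm_def intro!: continuous_on_compose2[of "{0..R}" "tval s v e"])
qed (use assms in \<open>auto intro!: continuous_intros Av_cont Ff_cont simp: adm_def\<close>)

lemma tval_deriv:
  assumes adm: "adm s v" and c: "\<And>i. i \<le> Suc j \<Longrightarrow> continuous_on {0..R} (v i)"
    and d: "\<And>i r. i \<le> j \<Longrightarrow> r \<in> {0..R} \<Longrightarrow> (v i has_real_derivative v (Suc i) r) (at r within {0..R})"
  shows "order_le j e \<Longrightarrow> r \<in> {0..R} \<Longrightarrow> (tval s v e has_real_derivative tval s v (tderiv e) r) (at r within {0..R})"
proof (induction e arbitrary: r)
  case (Avt p e)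
  have "continuous_on {0..R} (tval s v (tderiv e))"
    by (rule tval_cont[OF adm c order_le_tderiv]) (use Avt in auto)
  then show ?case using Avt by (auto intro!: Av_deriv)
next
  case (Cmp e)
  have v0: "continuous_on {0..R} (v 0)" using adm by (simp add: adm_def)
  have y: "foot s (v 0) r \<in> {0..R}" using adm Cmp by (simp add: adm_def)
  from Cmp have "order_le j e" by simp
  from DERIV_chain_within[OF Cmp.IH[OF this y] foot_deriv[OF v0 Cmp.prems(2)]]
  show ?case using adm by (auto simp: adm_def tval_GG_trm mult.commute)
next
  case Fs
  then show ?case using adm by (auto simp: adm_def tval_Fd_trm intro!: Ff_deriv)
qed (use d in \<open>auto intro!: derivative_eq_intros\<close>)

section \<open>Estimates uniform in the step size\<close>

definition bdd :: "nat \<Rightarrow> real \<Rightarrow> real \<Rightarrow> (nat \<Rightarrow> real \<Rightarrow> real) \<Rightarrow> bool" where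
  "bdd j B s v \<longleftrightarrow> adm s v \<and> (\<forall>i\<le>j. continuous_on {0..R} (v i) \<and> (\<forall>r\<in>{0..R}. \<bar>v i r\<bar> \<le> B))"

lemma bdd_cont: "bdd j B s v \<Longrightarrow> order_le j e \<Longrightarrow> continuous_on {0..R} (tval s v e)"
  by (rule tval_cont) (auto simp: bdd_def)

text \<open>The constant is chosen before s and v, hence is independent of the step size and of the
  number of steps already made. Composition costs nothing, because the foot map does not leave
  [0,R].\<close>

lemma tval_bound:
  assumes "order_le j e"
  shows "\<exists>C\<ge>0. \<forall>s v. bdd j B s v \<longrightarrow> (\<forall>r\<in>{0..R}. \<bar>tval s v e r\<bar> \<le> C)"
  using assms
proof (induction e)
  case (V i)
  have "\<bar>v i r\<bar> \<le> \<bar>B\<bar>" if "bdd j B s v" "r \<in> {0..R}" for s v r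
  proof -
    have "\<bar>v i r\<bar> \<le> B" using that V by (simp add: bdd_def)
    then show ?thesis by simp
  qed
  then show ?case by (intro exI[of _ "\<bar>B\<bar>"]) auto
next
  case Fs
  show ?case
  proof (intro exI[of _ "exp (\<kappa> * R\<^sup>2 * B\<^sup>2 / 16)"] conjI allI impI ballI)
    fix s v r assume v: "bdd j B s v" and r: "r \<in> {0..R}"
    have "Ff (v 0) r \<le> exp (\<kappa> * R\<^sup>2 * B\<^sup>2 / 16)" by (rule Ff_le) (use v r in \<open>auto simp: bdd_def\<close>)
    moreover have "Ff (v 0) r > 0" by (simp add: Ff_def)
    ultimately show "\<bar>tval s v Fs r\<bar> \<le> exp (\<kappa> * R\<^sup>2 * B\<^sup>2 / 16)" by simp
  qed simp
next
  case (Cn c) then show ?case by (auto intro!: exI[of _ "\<bar>c\<bar>"])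
next
  case Rr then show ?case using R_pos by (auto intro!: exI[of _ R])
next
  case Tau then show ?case by (auto intro!: exI[of _ 1] simp: bdd_def adm_def)
next
  case (Add a b)
  then obtain C D where "C \<ge> 0" "D \<ge> 0" "\<forall>s v. bdd j B s v \<longrightarrow> (\<forall>r\<in>{0..R}. \<bar>tval s v a r\<bar> \<le> C)"
    "\<forall>s v. bdd j B s v \<longrightarrow> (\<forall>r\<in>{0..R}. \<bar>tval s v b r\<bar> \<le> D)" by auto
  then show ?case by (intro exI[of _ "C + D"]) (auto intro!: order_trans[OF abs_triangle_ineq] add_mono)
next
  case (Mul a b)
  then obtain C D where "C \<ge> 0" "D \<ge> 0" "\<forall>s v. bdd j B s v \<longrightarrow> (\<forall>r\<in>{0..R}. \<bar>tval s v a r\<bar> \<le> C)"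
    "\<forall>s v. bdd j B s v \<longrightarrow> (\<forall>r\<in>{0..R}. \<bar>tval s v b r\<bar> \<le> D)" by auto
  then show ?case by (intro exI[of _ "C * D"]) (auto simp: abs_mult intro!: mult_mono)
next
  case (Avt p e)
  then obtain C where C: "C \<ge> 0" "\<forall>s v. bdd j B s v \<longrightarrow> (\<forall>r\<in>{0..R}. \<bar>tval s v e r\<bar> \<le> C)" by auto
  show ?case
  proof (intro exI[of _ C] conjI allI impI ballI C)
    fix s v r assume "bdd j B s v" "r \<in> {0..R}"
    then show "\<bar>tval s v (Avt p e) r\<bar> \<le> C"
      using C bdd_cont[of j B s v e] Avt.prems by (auto intro!: Av_abs_le')
  qed
next
  case (Cmp e)
  then show ?case by (auto simp: bdd_def adm_def)
qed

abbreviation "next_bnd j B M s v \<equiv> bdd j B s v \<and> continuous_on {0..R} (v (Suc j)) \<and> 0 \<le> M \<and> (\<forall>r\<in>{0..R}. \<bar>v (Suc j) r\<bar> \<le> M)"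

abbreviation "tame j B C e \<equiv> \<forall>s v M. next_bnd j B M s v \<longrightarrow>
    (\<forall>r\<in>{0..R}. \<bar>tval s v (tderiv e) r\<bar> \<le> C * (1 + M))"

text \<open>The bound is affine in the new top-order jet, which is why the higher derivatives survive
  exactly as long as the first one.\<close>

lemma tval_tderiv_bound:
  assumes "order_le j e"
  shows "\<exists>C\<ge>0. tame j B C e"
  using assms
proof (induction e)
  case (V i)
  show ?case
  proof (intro exI[of _ "1 + \<bar>B\<bar>"] conjI allI impI ballI; (elim conjE)?)
    fix s v M r assume v: "bdd j B s v" and M: "0 \<le> M" "\<forall>r\<in>{0..R}. \<bar>v (Suc j) r\<bar> \<le> M" and r: "r \<in> {0..R}"
    have "\<bar>v (Suc i) r\<bar> \<le> \<bar>B\<bar> + M"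
    proof (cases "i = j")
      case False
      then have "\<bar>v (Suc i) r\<bar> \<le> B" using v r V by (auto simp: bdd_def)
      then show ?thesis using M by auto
    qed (use M r in force)
    moreover have "0 \<le> \<bar>B\<bar> * M" using M by auto
    ultimately show "\<bar>tval s v (tderiv (V i)) r\<bar> \<le> (1 + \<bar>B\<bar>) * (1 + M)" by (simp add: algebra_simps)
  qed simp
next
  case Fs
  obtain C where C: "C \<ge> 0" "\<forall>s v. bdd j B s v \<longrightarrow> (\<forall>r\<in>{0..R}. \<bar>tval s v Fd_trm r\<bar> \<le> C)"
    using tval_bound[OF order_le_Fd_trm] by blast
  show ?case
  proof (intro exI[of _ C] conjI allI impI ballI C; (elim conjE)?)
    fix s v M r assume v: "bdd j B s v" and M: "0 \<le> (M::real)" and r: "r \<in> {0..R}"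
    have "\<bar>tval s v (tderiv Fs) r\<bar> \<le> C" using C v r by simp
    also have "\<dots> \<le> C * (1 + M)" using C M by (simp add: algebra_simps)
    finally show "\<bar>tval s v (tderiv Fs) r\<bar> \<le> C * (1 + M)" .
  qed
next
  case (Cn c) then show ?case by (auto intro!: exI[of _ 1])
next
  case Rr then show ?case by (auto intro!: exI[of _ 1])
next
  case Tau then show ?case by (auto intro!: exI[of _ 1])
next
  case (Add a b)
  then obtain C D where CD: "C \<ge> 0" "D \<ge> 0"
    "tame j B C a"
    "tame j B D b" by auto
  show ?case
  proof (intro exI[of _ "C + D"] conjI allI impI ballI)
    fix s v M r assume *: "next_bnd j B M s v" and r: "r \<in> {0..R}"
    have "\<bar>tval s v (tderiv a) r\<bar> \<le> C * (1 + M)" "\<bar>tval s v (tderiv b) r\<bar> \<le> D * (1 + M)"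
      using CD(3,4) * r by blast+
    then show "\<bar>tval s v (tderiv (Add a b)) r\<bar> \<le> (C + D) * (1 + M)" by (simp add: distrib_right)
  qed (use CD in auto)
next
  case (Mul a b)
  then obtain C D where CD: "C \<ge> 0" "D \<ge> 0"
    "tame j B C a"
    "tame j B D b" by auto
  obtain C' where C': "C' \<ge> 0" "\<forall>s v. bdd j B s v \<longrightarrow> (\<forall>r\<in>{0..R}. \<bar>tval s v a r\<bar> \<le> C')"
    using tval_bound[of j a B] Mul.prems by auto
  obtain D' where D': "D' \<ge> 0" "\<forall>s v. bdd j B s v \<longrightarrow> (\<forall>r\<in>{0..R}. \<bar>tval s v b r\<bar> \<le> D')"
    using tval_bound[of j b B] Mul.prems by auto
  show ?case
  proof (intro exI[of _ "C * D' + C' * D"] conjI allI impI ballI)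
    fix s v M r assume *: "next_bnd j B M s v" and r: "r \<in> {0..R}"
    have 1: "\<bar>tval s v (tderiv a) r\<bar> \<le> C * (1 + M)" "\<bar>tval s v (tderiv b) r\<bar> \<le> D * (1 + M)"
      using CD(3,4) * r by blast+
    have 2: "\<bar>tval s v a r\<bar> \<le> C'" "\<bar>tval s v b r\<bar> \<le> D'" using C' D' * r by blast+
    \<comment> \<open>In the product rule only one factor of each summand is differentiated, so M
      enters to the first power; the other factor is bounded by the lower jets.\<close>
    have "\<bar>tval s v (tderiv (Mul a b)) r\<bar> \<le> \<bar>tval s v (tderiv a) r\<bar> * \<bar>tval s v b r\<bar> + \<bar>tval s v a r\<bar> * \<bar>tval s v (tderiv b) r\<bar>"
      by (simp flip: abs_mult)
    also have "\<dots> \<le> (C * (1 + M)) * D' + C' * (D * (1 + M))"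
      using 1 2 CD C' D' * by (intro add_mono mult_mono) auto
    finally show "\<bar>tval s v (tderiv (Mul a b)) r\<bar> \<le> (C * D' + C' * D) * (1 + M)" by (simp add: algebra_simps)
  qed (use CD C' D' in auto)
next
  case (Avt p e)
  then obtain C where C: "C \<ge> 0"
    "tame j B C e" by auto
  show ?case
  proof (intro exI[of _ C] conjI allI impI ballI C(1))
    fix s v M r assume *: "next_bnd j B M s v" and r: "r \<in> {0..R}"
    have "continuous_on {0..R} (tval s v (tderiv e))"
      by (rule tval_cont[OF _ _ order_le_tderiv[of j]]) (use * Avt.prems in \<open>auto simp: bdd_def le_Suc_eq\<close>)
    then show "\<bar>tval s v (tderiv (Avt p e)) r\<bar> \<le> C * (1 + M)"
      using C(2) * r by (auto intro!: Av_abs_le')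
  qed
next
  case (Cmp e)
  then obtain C where C: "C \<ge> 0"
    "tame j B C e" by auto
  obtain D where D: "D \<ge> 0" "\<forall>s v. bdd j B s v \<longrightarrow> (\<forall>r\<in>{0..R}. \<bar>tval s v (Add (Cn 1) (Mul Tau GG_trm)) r\<bar> \<le> D)"
    using tval_bound[of j "Add (Cn 1) (Mul Tau GG_trm)" B] order_le_GG_trm by auto
  show ?case
  proof (intro exI[of _ "D * C"] conjI allI impI ballI)
    fix s v M r assume *: "next_bnd j B M s v" and r: "r \<in> {0..R}"
    have "foot s (v 0) r \<in> {0..R}" using * r by (auto simp: bdd_def adm_def)
    then have "\<bar>tval s v (tderiv e) (foot s (v 0) r)\<bar> \<le> C * (1 + M)" using C * by blast
    moreover have "\<bar>tval s v (Add (Cn 1) (Mul Tau GG_trm)) r\<bar> \<le> D" using D * r by blast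
    ultimately have "\<bar>tval s v (Add (Cn 1) (Mul Tau GG_trm)) r\<bar> * \<bar>tval s v (tderiv e) (foot s (v 0) r)\<bar> \<le> D * (C * (1 + M))"
      using D C * by (intro mult_mono) auto
    then show "\<bar>tval s v (tderiv (Cmp e)) r\<bar> \<le> D * C * (1 + M)" by (simp add: abs_mult mult.assoc)
  qed (use C D in auto)
qed

text \<open>One distance \<eta> and one oscillation W replace a modulus function: the foot map never
  increases distances, so \<eta> stays fixed along the scheme and only W evolves.\<close>

definition jets_modulus :: "nat \<Rightarrow> real \<Rightarrow> real \<Rightarrow> (nat \<Rightarrow> real \<Rightarrow> real) \<Rightarrow> bool" where
  "jets_modulus j \<eta> W v \<longleftrightarrow> (\<forall>i\<le>j. \<forall>r\<in>{0..R}. \<forall>r'\<in>{0..R}. \<bar>r - r'\<bar> \<le> \<eta> \<longrightarrow> \<bar>v i r - v i r'\<bar> \<le> W)"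

abbreviation "equicont j B C e \<equiv> \<forall>s v \<eta> W. bdd j B s v \<and> 0 \<le> \<eta> \<and> 0 \<le> W \<and> jets_modulus j \<eta> W v \<longrightarrow>
    (\<forall>r\<in>{0..R}. \<forall>r'\<in>{0..R}. \<bar>r - r'\<bar> \<le> \<eta> \<longrightarrow> \<bar>tval s v e r - tval s v e r'\<bar> \<le> C * (\<eta> + W))"

text \<open>Linearity in \<eta> + W is what a discrete Gronwall argument can iterate. In the case
  \<open>Cmp\<close>, a foot map with Lipschitz constant above 1 would enlarge \<eta> at every
  step.\<close>

lemma tval_modulus:
  assumes "order_le j e"
  shows "\<exists>C\<ge>0. equicont j B C e"
  using assms
proof (induction e)
  case (V i)
  show ?case
  proof (intro exI[of _ 1] conjI allI impI ballI)
    fix s v \<eta> W r r'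
    assume "bdd j B s v \<and> 0 \<le> \<eta> \<and> 0 \<le> W \<and> jets_modulus j \<eta> W v" "r \<in> {0..R}" "r' \<in> {0..R}" "\<bar>r - r'\<bar> \<le> \<eta>"
    then have "\<bar>v i r - v i r'\<bar> \<le> W" "0 \<le> \<eta>" using V unfolding jets_modulus_def by auto
    then show "\<bar>tval s v (V i) r - tval s v (V i) r'\<bar> \<le> 1 * (\<eta> + W)" by simp
  qed simp
next
  case Fs
  obtain C where C: "C \<ge> 0" "\<forall>s v. bdd j B s v \<longrightarrow> (\<forall>r\<in>{0..R}. \<bar>tval s v Fd_trm r\<bar> \<le> C)"
    using tval_bound[OF order_le_Fd_trm] by blast
  show ?case
  proof (intro exI[of _ C] conjI allI impI ballI C(1))
    fix s v \<eta> W r r'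
    assume *: "bdd j B s v \<and> 0 \<le> \<eta> \<and> 0 \<le> (W::real) \<and> jets_modulus j \<eta> W v" and r: "r \<in> {0..R}" "r' \<in> {0..R}" "\<bar>r - r'\<bar> \<le> \<eta>"
    have "\<bar>Ff (v 0) r - Ff (v 0) r'\<bar> \<le> C * \<bar>r - r'\<bar>"
    proof (rule Icc_Lipschitz[OF Ff_deriv])
      fix r assume "r \<in> {0..R}"
      then show "\<bar>Fd (v 0) r\<bar> \<le> C" using C(2) * unfolding tval_Fd_trm by blast
    qed (use * r in \<open>auto simp: bdd_def\<close>)
    also have "\<dots> \<le> C * (\<eta> + W)" using C(1) * r by (intro mult_left_mono) auto
    finally show "\<bar>tval s v Fs r - tval s v Fs r'\<bar> \<le> C * (\<eta> + W)" by simp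
  qed
next
  case (Cn c) then show ?case by (auto intro!: exI[of _ 1])
next
  case Rr then show ?case by (auto intro!: exI[of _ 1])
next
  case Tau then show ?case by (auto intro!: exI[of _ 1])
next
  case (Add a b)
  then obtain C D where CD: "C \<ge> 0" "D \<ge> 0"
    "equicont j B C a"
    "equicont j B D b" by auto
  show ?case
  proof (intro exI[of _ "C + D"] conjI allI impI ballI)
    fix s v \<eta> W r r'
    assume *: "bdd j B s v \<and> 0 \<le> \<eta> \<and> 0 \<le> W \<and> jets_modulus j \<eta> W v" "r \<in> {0..R}" "r' \<in> {0..R}" "\<bar>r - r'\<bar> \<le> \<eta>"
    have "\<bar>tval s v a r - tval s v a r'\<bar> \<le> C * (\<eta> + W)" "\<bar>tval s v b r - tval s v b r'\<bar> \<le> D * (\<eta> + W)"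
      using CD(3,4) * by blast+
    then show "\<bar>tval s v (Add a b) r - tval s v (Add a b) r'\<bar> \<le> (C + D) * (\<eta> + W)"
      unfolding tval.simps distrib_right by linarith
  qed (use CD in auto)
next
  case (Mul a b)
  then obtain C D where CD: "C \<ge> 0" "D \<ge> 0"
    "equicont j B C a"
    "equicont j B D b" by auto
  obtain C' where C': "C' \<ge> 0" "\<forall>s v. bdd j B s v \<longrightarrow> (\<forall>r\<in>{0..R}. \<bar>tval s v a r\<bar> \<le> C')"
    using tval_bound[of j a B] Mul.prems by auto
  obtain D' where D': "D' \<ge> 0" "\<forall>s v. bdd j B s v \<longrightarrow> (\<forall>r\<in>{0..R}. \<bar>tval s v b r\<bar> \<le> D')"
    using tval_bound[of j b B] Mul.prems by auto
  show ?case
  proof (intro exI[of _ "C * D' + C' * D"] conjI allI impI ballI)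
    fix s v \<eta> W r r'
    assume *: "bdd j B s v \<and> 0 \<le> \<eta> \<and> 0 \<le> W \<and> jets_modulus j \<eta> W v" "r \<in> {0..R}" "r' \<in> {0..R}" "\<bar>r - r'\<bar> \<le> \<eta>"
    have 1: "\<bar>tval s v a r - tval s v a r'\<bar> \<le> C * (\<eta> + W)" "\<bar>tval s v b r - tval s v b r'\<bar> \<le> D * (\<eta> + W)"
      using CD(3,4) * by blast+
    have 2: "\<bar>tval s v b r\<bar> \<le> D'" "\<bar>tval s v a r'\<bar> \<le> C'" using C' D' * by blast+
    from mult_diff_abs_le[OF 1 2]
    show "\<bar>tval s v (Mul a b) r - tval s v (Mul a b) r'\<bar> \<le> (C * D' + C' * D) * (\<eta> + W)"
      by (simp add: algebra_simps)
  qed (use CD C' D' in auto)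
next
  case (Avt p e)
  then obtain C where C: "C \<ge> 0"
    "equicont j B C e" by auto
  show ?case
  proof (intro exI[of _ C] conjI allI impI ballI C(1))
    fix s v \<eta> W r r'
    assume *: "bdd j B s v \<and> 0 \<le> \<eta> \<and> 0 \<le> W \<and> jets_modulus j \<eta> W v" and r: "r \<in> {0..R}" "r' \<in> {0..R}" "\<bar>r - r'\<bar> \<le> \<eta>"
    have c: "continuous_on {0..R} (tval s v e)" using * Avt.prems by (auto intro: bdd_cont)
    have "\<bar>tval s v e (r * t) - tval s v e (r' * t)\<bar> \<le> C * (\<eta> + W)" if t: "t \<in> {0..1}" for t
    proof -
      have "\<bar>r * t - r' * t\<bar> = \<bar>r - r'\<bar> * t" using t by (simp add: abs_mult flip: left_diff_distrib)
      also have "\<dots> \<le> \<eta>" using t r by (auto intro: order_trans[OF mult_left_le])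
      finally show ?thesis using C(2) * scale_mem[OF r(1) t] scale_mem[OF r(2) t] by blast
    qed
    then show "\<bar>tval s v (Avt p e) r - tval s v (Avt p e) r'\<bar> \<le> C * (\<eta> + W)"
      using Av_diff_abs_le[OF c c r(1,2)] by simp
  qed
next
  case (Cmp e)
  then obtain C where C: "C \<ge> 0"
    "equicont j B C e" by auto
  show ?case
  proof (intro exI[of _ C] conjI allI impI ballI C(1))
    fix s v \<eta> W r r'
    assume *: "bdd j B s v \<and> 0 \<le> \<eta> \<and> 0 \<le> W \<and> jets_modulus j \<eta> W v" and r: "r \<in> {0..R}" "r' \<in> {0..R}" "\<bar>r - r'\<bar> \<le> \<eta>"
    have "foot s (v 0) r \<in> {0..R}" "foot s (v 0) r' \<in> {0..R}" "\<bar>foot s (v 0) r - foot s (v 0) r'\<bar> \<le> \<bar>r - r'\<bar>"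
      using * r unfolding bdd_def adm_def by blast+
    then have "foot s (v 0) r \<in> {0..R}" "foot s (v 0) r' \<in> {0..R}" "\<bar>foot s (v 0) r - foot s (v 0) r'\<bar> \<le> \<eta>"
      using r(3) by auto
    then show "\<bar>tval s v (Cmp e) r - tval s v (Cmp e) r'\<bar> \<le> C * (\<eta> + W)"
      using C(2) * by (simp only: tval.simps)
  qed
qed

end

section \<open>The explicit scheme\<close>

text \<open>B is the bound on w below which the coefficients have the right signs: \<open>kB\<close>
  is the hypothesis of \<open>GG_nonpos\<close>, \<open>outflow\<close> that of
  \<open>aa_R_nonpos\<close>.\<close>

locale bondi_small = bondi +
  fixes B :: real
  assumes B_pos: "B > 0" and kB: "\<kappa> * B\<^sup>2 \<le> 8 * \<Lambda>"
    and outflow: "exp (\<kappa> * R\<^sup>2 * B\<^sup>2 / 16) \<le> \<Lambda> * R\<^sup>2 / 3"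
begin

definition small :: "(real \<Rightarrow> real) \<Rightarrow> bool" where
  "small w \<longleftrightarrow> continuous_on {0..R} w \<and> (\<forall>r\<in>{0..R}. \<bar>w r\<bar> \<le> B)"

lemma GG_bound_ex: "\<exists>C\<ge>0. \<forall>w. small w \<longrightarrow> (\<forall>r\<in>{0..R}. \<bar>GG w r\<bar> \<le> C)"
proof -
  obtain C where C: "C \<ge> 0" "\<forall>s v. bdd 0 B s v \<longrightarrow> (\<forall>r\<in>{0..R}. \<bar>tval s v GG_trm r\<bar> \<le> C)"
    using tval_bound[OF order_le_GG_trm] by blast
  have "\<bar>GG w r\<bar> \<le> C" if "small w" "r \<in> {0..R}" for w r
  proof -
    have "bdd 0 B 0 (\<lambda>_. w)" using that by (auto simp: bdd_def small_def intro: adm_0)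
    then show ?thesis using C(2) that(2) unfolding tval_GG_trm by blast
  qed
  with C(1) show ?thesis by blast
qed

definition CG :: real where
  "CG = (SOME C. C \<ge> 0 \<and> (\<forall>w. small w \<longrightarrow> (\<forall>r\<in>{0..R}. \<bar>GG w r\<bar> \<le> C)))"

lemma CG: "CG \<ge> 0" "small w \<Longrightarrow> r \<in> {0..R} \<Longrightarrow> \<bar>GG w r\<bar> \<le> CG"
  using someI_ex[OF GG_bound_ex, folded CG_def] by auto

text \<open>For s up to this size, s |\<open>GG\<close>| is at most 1, so the slope 1 + s
  \<open>GG\<close> of the foot map lies in [0,1]. The added 1 also keeps s in the range required by
  \<open>adm\<close>.\<close>

definition max_step :: real where "max_step = 1 / (CG + 1)"

lemma max_step: "0 < max_step" "max_step \<le> 1" "max_step * CG \<le> 1"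
  using CG(1) by (auto simp: max_step_def field_simps)

lemma small_GG_nonpos: "small w \<Longrightarrow> r \<in> {0..R} \<Longrightarrow> GG w r \<le> 0"
  using GG_nonpos[of w B r] kB by (auto simp: small_def)

lemma small_aa_R: "small w \<Longrightarrow> aa w R \<le> 0"
  using aa_R_nonpos[of w B] outflow by (auto simp: small_def)

lemma foot_mono_Lip:
  assumes w: "small w" and s: "0 \<le> s" "s \<le> max_step" and r: "r \<in> {0..R}" "r' \<in> {0..R}" "r \<le> r'"
  shows "foot s w r \<le> foot s w r'" "foot s w r' - foot s w r \<le> r' - r"
proof -
  \<comment> \<open>After subtracting r/2, a slope in [0,1] becomes a slope of absolute value at
    most 1/2, so that one Lipschitz estimate gives monotonicity and the upper bound
    together.\<close>
  have "\<bar>(foot s w r' - r' / 2) - (foot s w r - r / 2)\<bar> \<le> 1 / 2 * \<bar>r' - r\<bar>"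
  proof (rule Icc_Lipschitz)
    fix r assume r: "r \<in> {0..R}"
    show "((\<lambda>r. foot s w r - r / 2) has_real_derivative 1 + s * GG w r - 1 / 2) (at r within {0..R})"
      using w r by (auto intro!: derivative_eq_intros foot_deriv simp: small_def)
    have "s * \<bar>GG w r\<bar> \<le> max_step * CG" using s max_step CG(2)[OF w r] by (intro mult_mono) auto
    then have "s * \<bar>GG w r\<bar> \<le> 1" using max_step(3) by linarith
    moreover have "\<bar>GG w r\<bar> = - GG w r" using small_GG_nonpos[OF w r] by simp
    moreover have "s * GG w r \<le> 0" using small_GG_nonpos[OF w r] s by (intro mult_nonneg_nonpos) auto
    ultimately show "\<bar>1 + s * GG w r - 1 / 2\<bar> \<le> 1 / 2" unfolding abs_le_iff by simp
  qed (use r in auto)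
  moreover have "(foot s w r' - r' / 2) - (foot s w r - r / 2) = (foot s w r' - foot s w r) - (r' - r) / 2"
    by (simp add: diff_divide_distrib)
  ultimately have 1: "\<bar>(foot s w r' - foot s w r) - (r' - r) / 2\<bar> \<le> 1 / 2 * \<bar>r' - r\<bar>"
    by (simp only:)
  have 2: "0 \<le> D \<and> D \<le> d" if "\<bar>D - d / 2\<bar> \<le> 1 / 2 * \<bar>d\<bar>" "0 \<le> d" for D d :: real
    using that by (intro conjI; linarith)
  have "0 \<le> foot s w r' - foot s w r \<and> foot s w r' - foot s w r \<le> r' - r"
    by (rule 2[OF 1]) (use r(3) in simp)
  then show "foot s w r \<le> foot s w r'" "foot s w r' - foot s w r \<le> r' - r" by auto
qed

text \<open>By monotonicity only the end points matter, where the signs of \<open>aa\<close> push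
  inwards.\<close>

lemma foot_mem:
  assumes w: "small w" and s: "0 \<le> s" "s \<le> max_step" and r: "r \<in> {0..R}"
  shows "foot s w r \<in> {0..R}"
proof -
  have "0 \<le> foot s w 0" using s w by (simp add: foot_def aa_0 small_def)
  also have "\<dots> \<le> foot s w r" using foot_mono_Lip[OF w s, of 0 r] r by auto
  finally have "0 \<le> foot s w r" .
  have "foot s w r \<le> foot s w R" using foot_mono_Lip[OF w s, of r R] r by auto
  also have "\<dots> \<le> R" using small_aa_R[OF w] s by (simp add: foot_def mult_nonneg_nonpos)
  finally show ?thesis using \<open>0 \<le> foot s w r\<close> by simp
qed

lemma adm_small:
  assumes w: "small (v 0)" and s: "0 \<le> s" "s \<le> max_step"
  shows "adm s v"
proof -
  have "\<bar>foot s (v 0) r - foot s (v 0) r'\<bar> \<le> \<bar>r - r'\<bar>" if "r \<in> {0..R}" "r' \<in> {0..R}" for r r'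
    using foot_mono_Lip[OF w s that] foot_mono_Lip[OF w s that(2,1)] by (cases "r \<le> r'") auto
  then show ?thesis
    using foot_mem[OF w s] s max_step(2) w by (auto simp: adm_def small_def)
qed

definition CA :: real where "CA = R / max_step"

lemma CA_nonneg: "CA \<ge> 0" using max_step R_pos by (simp add: CA_def)

text \<open>A step of size \<open>max_step\<close> stays in [0,R] and so moves a point by at most
  R.\<close>

lemma aa_bound:
  assumes w: "small w" and r: "r \<in> {0..R}"
  shows "\<bar>aa w r\<bar> \<le> CA"
proof -
  have "foot max_step w r \<in> {0..R}" by (rule foot_mem[OF w _ _ r]) (use max_step in auto)
  then have "\<bar>max_step * aa w r\<bar> \<le> R" using r by (auto simp: foot_def)
  then show ?thesis using max_step by (simp add: CA_def abs_mult field_simps)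
qed

definition CT :: real where "CT = CG * (R * B)"

lemma CT_nonneg: "CT \<ge> 0" using CG R_pos B_pos by (simp add: CT_def)

lemma TT_bound:
  assumes w: "small w" and r: "r \<in> {0..R}"
  shows "\<bar>TT w r\<bar> \<le> CT"
proof -
  have "\<bar>Av 1 w r\<bar> \<le> B" by (rule Av_abs_le'[OF _ r]) (use w in \<open>auto simp: small_def\<close>)
  then show ?thesis unfolding TT_def CT_def abs_mult
    using r CG(1) CG(2)[OF w r] by (intro mult_mono) auto
qed

definition step_h :: "real \<Rightarrow> (real \<Rightarrow> real) \<Rightarrow> (nat \<Rightarrow> real \<Rightarrow> real) \<Rightarrow> real \<Rightarrow> real" where
  "step_h s h v r = h (foot s (v 0) r) + s * TT (v 0) r"

definition step_jet :: "real \<Rightarrow> (nat \<Rightarrow> real \<Rightarrow> real) \<Rightarrow> nat \<Rightarrow> real \<Rightarrow> real" where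
  "step_jet s v i r = v i (foot s (v 0) r) + s * tval s v (jet_source i) r"

lemma step_h_0: "step_h 0 h v = h" and step_jet_0: "step_jet 0 v = v"
  by (auto simp: step_h_def step_jet_def foot_def fun_eq_iff)

definition jet :: "nat \<Rightarrow> (real \<Rightarrow> real) \<Rightarrow> (nat \<Rightarrow> real \<Rightarrow> real) \<Rightarrow> bool" where
  "jet m h v \<longleftrightarrow> (\<forall>r\<in>{0..R}. (h has_real_derivative v 0 r) (at r within {0..R})) \<and>
     (\<forall>i<m. \<forall>r\<in>{0..R}. (v i has_real_derivative v (Suc i) r) (at r within {0..R})) \<and>
     (\<forall>i\<le>m. continuous_on {0..R} (v i))"

text \<open>The derivative of v_i(foot) + s S_i is v_(i+1)(foot) (1 + s \<open>GG\<close>) + s S_i'.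
  Collecting the terms with factor s is precisely the recursion of
  \<open>jet_source\<close>.\<close>

lemma step_preserves_jet:
  assumes j: "jet m h v" and w: "small (v 0)" and s: "0 \<le> s" "s \<le> max_step"
  shows "jet m (step_h s h v) (step_jet s v)"
proof -
  have adm: "adm s v" by (rule adm_small[where v = v, OF w s])
  have wc: "continuous_on {0..R} (v 0)" using w by (simp add: small_def)
  have ym: "\<And>r. r \<in> {0..R} \<Longrightarrow> foot s (v 0) r \<in> {0..R}" by (rule foot_mem[OF w s])
  have y: "\<And>r. r \<in> {0..R} \<Longrightarrow> (foot s (v 0) has_real_derivative 1 + s * GG (v 0) r) (at r within {0..R})"
    by (rule foot_deriv[OF wc])
  have yc: "continuous_on {0..R} (foot s (v 0))" using y by (meson DERIV_continuous_on)
  have d: "((\<lambda>r. g (foot s (v 0) r)) has_real_derivative g' (foot s (v 0) r) * (1 + s * GG (v 0) r)) (at r within {0..R})"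
    if "\<forall>r\<in>{0..R}. (g has_real_derivative g' r) (at r within {0..R})" and r: "r \<in> {0..R}" for g g' r
    by (rule DERIV_chain_within[of g _ "foot s (v 0)" r "{0..R}", OF _ y[OF r] ym]) (use that ym in auto)
  have "(step_h s h v has_real_derivative step_jet s v 0 r) (at r within {0..R})" if r: "r \<in> {0..R}" for r
    unfolding step_h_def[abs_def] step_jet_def jet_source.simps tval.simps tval_TTd_trm tval_GG_trm
    using d[of h "v 0" r] j r TT_deriv[OF wc r]
    by (auto intro!: derivative_eq_intros simp: jet_def algebra_simps)
  moreover have "(step_jet s v i has_real_derivative step_jet s v (Suc i) r) (at r within {0..R})"
    if i: "i < m" and r: "r \<in> {0..R}" for i r
  proof -
    have "(tval s v (jet_source i) has_real_derivative tval s v (tderiv (jet_source i)) r) (at r within {0..R})"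
      by (rule tval_deriv[OF adm _ _ order_le_jet_source r]) (use j i in \<open>auto simp: jet_def\<close>)
    moreover have "((\<lambda>r. v i (foot s (v 0) r)) has_real_derivative v (Suc i) (foot s (v 0) r) * (1 + s * GG (v 0) r)) (at r within {0..R})"
      by (rule d) (use j i r in \<open>auto simp: jet_def\<close>)
    ultimately show ?thesis
      unfolding step_jet_def[abs_def] jet_source.simps tval.simps tval_GG_trm
      by (auto intro!: derivative_eq_intros simp: algebra_simps)
  qed
  moreover have "continuous_on {0..R} (step_jet s v i)" if "i \<le> m" for i
  proof -
    have "continuous_on {0..R} (tval s v (jet_source i))"
      by (rule tval_cont[OF adm _ order_le_jet_source]) (use j that in \<open>auto simp: jet_def\<close>)
    moreover have "continuous_on {0..R} (\<lambda>r. v i (foot s (v 0) r))"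
      by (rule continuous_on_compose2[OF _ yc]) (use j that ym in \<open>auto simp: jet_def\<close>)
    ultimately show ?thesis unfolding step_jet_def[abs_def] by (intro continuous_intros)
  qed
  ultimately show ?thesis by (auto simp: jet_def)
qed

text \<open>Every summand carries a factor w or an average of w, so the bound is proportional to M,
  sharper than mere boundedness. This makes the final derivative bound proportional to the data. The
  constant is taken positive since \<open>U0\<close> divides by it.\<close>

lemma jet_source_0_bound: "\<exists>C>0. \<forall>s v M. small (v 0) \<longrightarrow> 0 \<le> s \<longrightarrow> s \<le> max_step \<longrightarrow> (\<forall>r\<in>{0..R}. \<bar>v 0 r\<bar> \<le> M) \<longrightarrow>
   (\<forall>r\<in>{0..R}. \<bar>tval s v (jet_source 0) r\<bar> \<le> C * M)"
proof -
  have "order_le 0 cc_trm" by (auto simp: cc_trm_def order_le_Fd_trm order_le_GG_trm)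
  then obtain D where D: "D \<ge> 0" "\<forall>s v. bdd 0 B s v \<longrightarrow> (\<forall>r\<in>{0..R}. \<bar>tval s v cc_trm r\<bar> \<le> D)"
    using tval_bound by blast
  have "\<bar>tval s v (jet_source 0) r\<bar> \<le> (3 * CG + D + 1) * M"
    if w: "small (v 0)" and s: "0 \<le> s" "s \<le> max_step" and M: "\<And>r. r \<in> {0..R} \<Longrightarrow> \<bar>v 0 r\<bar> \<le> M" and r: "r \<in> {0..R}" for s v M r
  proof -
    have M0: "M \<ge> 0" using M[OF r] by linarith
    have "bdd 0 B s v" using adm_small[where v = v, OF w s] w by (auto simp: bdd_def small_def)
    then have c: "\<bar>tval s v cc_trm r\<bar> \<le> D" using D r by blast
    have g: "\<bar>GG (v 0) r\<bar> \<le> CG" by (rule CG(2)[OF w r])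
    have A: "\<bar>Av 1 (v 0) r\<bar> \<le> M" by (rule Av_abs_le'[OF _ r M]) (use w in \<open>auto simp: small_def\<close>)
    have y: "\<bar>v 0 (foot s (v 0) r)\<bar> \<le> M" by (rule M[OF foot_mem[OF w s r]])
    have "\<bar>GG (v 0) r * v 0 (foot s (v 0) r)\<bar> \<le> CG * M" unfolding abs_mult using g y CG M0 by (intro mult_mono) auto
    moreover have "\<bar>tval s v cc_trm r * Av 1 (v 0) r\<bar> \<le> D * M" unfolding abs_mult using c A D M0 by (intro mult_mono) auto
    moreover have "\<bar>GG (v 0) r * (v 0 r - Av 1 (v 0) r)\<bar> \<le> CG * (2 * M)" unfolding abs_mult
      using g A M[OF r] CG M0 by (intro mult_mono) auto
    moreover have "tval s v (jet_source 0) r = GG (v 0) r * v 0 (foot s (v 0) r) + (tval s v cc_trm r * Av 1 (v 0) r + GG (v 0) r * (v 0 r - Av 1 (v 0) r))"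
      by (simp add: TTd_trm_def tval_GG_trm)
    ultimately have "\<bar>tval s v (jet_source 0) r\<bar> \<le> CG * M + (D * M + CG * (2 * M))" by linarith
    then show ?thesis using M0 by (simp add: algebra_simps)
  qed
  then show ?thesis using CG D by (intro exI[of _ "3 * CG + D + 1"]) auto
qed

definition C0 :: real where
  "C0 = (SOME C. C > 0 \<and> (\<forall>s v M. small (v 0) \<longrightarrow> 0 \<le> s \<longrightarrow> s \<le> max_step \<longrightarrow> (\<forall>r\<in>{0..R}. \<bar>v 0 r\<bar> \<le> M) \<longrightarrow>
   (\<forall>r\<in>{0..R}. \<bar>tval s v (jet_source 0) r\<bar> \<le> C * M)))"

lemma C0: "C0 > 0"
  "small (v 0) \<Longrightarrow> 0 \<le> s \<Longrightarrow> s \<le> max_step \<Longrightarrow> (\<And>r. r \<in> {0..R} \<Longrightarrow> \<bar>v 0 r\<bar> \<le> M) \<Longrightarrow> r \<in> {0..R} \<Longrightarrow> \<bar>tval s v (jet_source 0) r\<bar> \<le> C0 * M"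
  using someI_ex[OF jet_source_0_bound, folded C0_def] by auto

definition U0 :: real where "U0 = ln 2 / C0"

lemma U0: "U0 > 0" "exp (C0 * U0) = 2"
  using C0(1) by (auto simp: U0_def)

text \<open>The step sizes are arbitrary so that the last, shortened step of a polygon is covered as well.\<close>

inductive reach :: "(real \<Rightarrow> real) \<Rightarrow> (nat \<Rightarrow> real \<Rightarrow> real) \<Rightarrow> real \<Rightarrow> (real \<Rightarrow> real) \<Rightarrow> (nat \<Rightarrow> real \<Rightarrow> real) \<Rightarrow> bool"
  for h0 v0 where
  reach_init: "reach h0 v0 0 h0 v0"
| reach_step: "reach h0 v0 u h v \<Longrightarrow> 0 \<le> s \<Longrightarrow> s \<le> max_step \<Longrightarrow> reach h0 v0 (u + s) (step_h s h v) (step_jet s v)"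

text \<open>Discrete Gronwall step, from 1 + x \<le> exp x. It is applied to the first jet, to the
  higher jets and to their oscillations.\<close>

lemma growth_step:
  fixes C s u a b X :: real
  assumes "a \<le> exp (C * u) * X" "b \<le> (1 + C * s) * a" "C \<ge> 0" "s \<ge> 0" "X \<ge> 0"
  shows "b \<le> exp (C * (u + s)) * X"
proof -
  have "b \<le> (1 + C * s) * (exp (C * u) * X)"
    using order_trans[OF assms(2) mult_left_mono[OF assms(1)]] assms(3,4) by simp
  also have "\<dots> \<le> exp (C * s) * (exp (C * u) * X)"
    using assms exp_ge_add_one_self[of "C * s"] by (intro mult_right_mono) auto
  also have "\<dots> = exp (C * (u + s)) * X" by (simp add: algebra_simps flip: exp_add)
  finally show ?thesis .
qed

end

section \<open>A priori estimates along the scheme\<close>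

locale bondi_run = bondi_small +
  fixes m :: nat and h0 :: "real \<Rightarrow> real" and v0 :: "nat \<Rightarrow> real \<Rightarrow> real" and M0 :: real
  assumes jet0: "jet m h0 v0" and M0: "\<And>r. r \<in> {0..R} \<Longrightarrow> \<bar>v0 0 r\<bar> \<le> M0" and M0B: "2 * M0 \<le> B"
begin

lemma M0_nonneg: "M0 \<ge> 0" using M0[of 0] R_pos by auto

text \<open>The sign conditions need \<open>small\<close> before each step, and the growth estimate
  returns it afterwards: up to time \<open>U0\<close> the bound \<open>M0\<close> at most doubles,
  and \<open>2 * M0 \<le> B\<close>.\<close>

lemma reach_basic:
  assumes "reach h0 v0 u h v" "u \<le> U0"
  shows "0 \<le> u \<and> jet m h v \<and> (\<forall>r\<in>{0..R}. \<bar>v 0 r\<bar> \<le> exp (C0 * u) * M0) \<and> small (v 0)"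
  using assms
proof (induction rule: reach.induct)
  case reach_init
  have "\<bar>v0 0 r\<bar> \<le> B" if "r \<in> {0..R}" for r using M0[OF that] M0B M0_nonneg by linarith
  then show ?case using jet0 M0 by (auto simp: small_def jet_def)
next
  case (reach_step u h v s)
  then have IH: "0 \<le> u" "jet m h v" "\<And>r. r \<in> {0..R} \<Longrightarrow> \<bar>v 0 r\<bar> \<le> exp (C0 * u) * M0" "small (v 0)" by auto
  have j: "jet m (step_h s h v) (step_jet s v)" by (rule step_preserves_jet[OF IH(2,4) reach_step.hyps(2,3)])
  have b: "\<bar>step_jet s v 0 r\<bar> \<le> exp (C0 * (u + s)) * M0" if r: "r \<in> {0..R}" for r
  proof (rule growth_step[OF order.refl])
    have "\<bar>v 0 (foot s (v 0) r)\<bar> \<le> exp (C0 * u) * M0"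
      by (rule IH(3)[OF foot_mem[OF IH(4) reach_step.hyps(2,3) r]])
    moreover have "\<bar>s * tval s v (jet_source 0) r\<bar> \<le> s * (C0 * (exp (C0 * u) * M0))"
      unfolding abs_mult using C0(2)[where v = v, OF IH(4) reach_step.hyps(2,3) IH(3) r] reach_step.hyps by (intro mult_mono) auto
    ultimately show "\<bar>step_jet s v 0 r\<bar> \<le> (1 + C0 * s) * (exp (C0 * u) * M0)"
      unfolding step_jet_def by (simp add: algebra_simps)
  qed (use C0 reach_step M0_nonneg in auto)
  have "exp (C0 * (u + s)) * M0 \<le> exp (C0 * U0) * M0"
    using reach_step.prems C0 M0_nonneg by (intro mult_right_mono) auto
  then have "\<bar>step_jet s v 0 r\<bar> \<le> B" if "r \<in> {0..R}" for r
    using b[OF that] M0B unfolding U0(2) by linarith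
  then show ?case using j b IH reach_step.hyps by (auto simp: small_def jet_def)
qed

lemma reach_bounds:
  "j \<le> m \<Longrightarrow> \<exists>Bj\<ge>0. \<forall>u h v. reach h0 v0 u h v \<longrightarrow> u \<le> U0 \<longrightarrow> (\<forall>i\<le>j. \<forall>r\<in>{0..R}. \<bar>v i r\<bar> \<le> Bj)"
proof (induction j)
  case 0
  then show ?case using reach_basic B_pos by (intro exI[of _ B]) (auto simp: small_def)
next
  case (Suc j)
  then obtain Bj where Bj: "Bj \<ge> 0" "\<And>u h v i r. reach h0 v0 u h v \<Longrightarrow> u \<le> U0 \<Longrightarrow> i \<le> j \<Longrightarrow> r \<in> {0..R} \<Longrightarrow> \<bar>v i r\<bar> \<le> Bj"
    by force
  obtain C where C: "C \<ge> 0" "tame j Bj C (jet_source j)"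
    using tval_tderiv_bound[OF order_le_jet_source] by blast
  define D where "D = C + CG"
  have D: "D \<ge> 0" using C CG by (simp add: D_def)
  have "continuous_on {0..R} (v0 (Suc j))" using jet0 Suc.prems by (auto simp: jet_def)
  then have "bounded (v0 (Suc j) ` {0..R})"
    by (intro compact_imp_bounded compact_continuous_image compact_Icc)
  then obtain K where K: "\<And>r. r \<in> {0..R} \<Longrightarrow> \<bar>v0 (Suc j) r\<bar> \<le> K"
    unfolding bounded_iff by (metis imageI real_norm_def)
  have K0: "K \<ge> 0" using K[of 0] R_pos by auto
  \<comment> \<open>The Gronwall quantity is 1 + |v|, not |v|: the 1 absorbs the inhomogeneous part
    of the affine bound.\<close>
  have main: "\<forall>r\<in>{0..R}. 1 + \<bar>v (Suc j) r\<bar> \<le> exp (D * u) * (1 + K)" if "reach h0 v0 u h v" "u \<le> U0" for u h v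
    using that
  proof (induction rule: reach.induct)
    case reach_init then show ?case using K by auto
  next
    case (reach_step u h v s)
    then have u: "u \<le> U0" and IH: "\<And>r. r \<in> {0..R} \<Longrightarrow> 1 + \<bar>v (Suc j) r\<bar> \<le> exp (D * u) * (1 + K)" by auto
    define M where "M = exp (D * u) * (1 + K) - 1"
    have v: "0 \<le> u" "jet m h v" "small (v 0)" using reach_basic[OF reach_step.hyps(1) u] by auto
    have M: "\<bar>v (Suc j) r\<bar> \<le> M" if "r \<in> {0..R}" for r using IH[OF that] by (simp add: M_def)
    have M0': "M \<ge> 0" using M[of 0] R_pos by auto
    have adm: "adm s v" by (rule adm_small[where v = v, OF v(3) reach_step.hyps(2,3)])
    have b: "bdd j Bj s v" using adm Bj(2)[OF reach_step.hyps(1) u] v Suc.prems by (auto simp: bdd_def jet_def)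
    show ?case
    proof
      fix r assume r: "r \<in> {0..R}"
      have y: "foot s (v 0) r \<in> {0..R}" by (rule foot_mem[OF v(3) reach_step.hyps(2,3) r])
      show "1 + \<bar>step_jet s v (Suc j) r\<bar> \<le> exp (D * (u + s)) * (1 + K)"
      proof (rule growth_step[OF order.refl])
        have "\<bar>tval s v (tderiv (jet_source j)) r\<bar> \<le> C * (1 + M)"
        proof -
          have "continuous_on {0..R} (v (Suc j))" using v(2) Suc.prems unfolding jet_def by blast
          then have "next_bnd j Bj M s v"
            using b M M0' by blast
          with C(2) r show ?thesis by blast
        qed
        moreover have "\<bar>GG (v 0) r * v (Suc j) (foot s (v 0) r)\<bar> \<le> CG * (1 + M)"
          unfolding abs_mult using CG CG(2)[OF v(3) r] M[OF y] by (intro mult_mono) auto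
        ultimately have "\<bar>tval s v (jet_source (Suc j)) r\<bar> \<le> D * (1 + M)"
          unfolding D_def by (simp add: tval_GG_trm distrib_right)
        then have "\<bar>s * tval s v (jet_source (Suc j)) r\<bar> \<le> s * (D * (1 + M))"
          unfolding abs_mult using reach_step.hyps by (intro mult_mono) auto
        with M[OF y] have "1 + \<bar>step_jet s v (Suc j) r\<bar> \<le> (1 + D * s) * (1 + M)"
          unfolding step_jet_def by (simp add: algebra_simps del: jet_source.simps)
        then show "1 + \<bar>step_jet s v (Suc j) r\<bar> \<le> (1 + D * s) * (exp (D * u) * (1 + K))" by (simp add: M_def)
      qed (use D K0 reach_step.hyps in auto)
    qed
  qed
  have fin: "\<bar>v i r\<bar> \<le> max Bj (exp (D * U0) * (1 + K))"
    if "reach h0 v0 u h v" "u \<le> U0" "i \<le> Suc j" "r \<in> {0..R}" for u h v i r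
  proof (cases "i = Suc j")
    case True
    have "1 + \<bar>v (Suc j) r\<bar> \<le> exp (D * u) * (1 + K)" using main that by auto
    also have "\<dots> \<le> exp (D * U0) * (1 + K)" using that D K0 by (intro mult_right_mono) (auto intro: mult_left_mono)
    finally show ?thesis using True by auto
  next
    case False
    then show ?thesis using Bj(2)[OF that(1,2) _ that(4), of i] that(3) by auto
  qed
  show ?case
    by (rule exI[of _ "max Bj (exp (D * U0) * (1 + K))"]) (use fin Bj(1) in auto)
qed

lemma reach_modulus:
  "\<exists>C\<ge>0. \<forall>u h v \<eta> W. reach h0 v0 u h v \<longrightarrow> u \<le> U0 \<longrightarrow> 0 \<le> \<eta> \<longrightarrow> 0 \<le> W \<longrightarrow> jets_modulus m \<eta> W v0 \<longrightarrow> jets_modulus m \<eta> (C * (\<eta> + W)) v"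
proof -
  obtain Bm where "\<forall>u h v. reach h0 v0 u h v \<longrightarrow> u \<le> U0 \<longrightarrow> (\<forall>i\<le>m. \<forall>r\<in>{0..R}. \<bar>v i r\<bar> \<le> Bm)"
    using reach_bounds[OF order.refl] by blast
  then have Bm: "\<And>u h v i r. reach h0 v0 u h v \<Longrightarrow> u \<le> U0 \<Longrightarrow> i \<le> m \<Longrightarrow> r \<in> {0..R} \<Longrightarrow> \<bar>v i r\<bar> \<le> Bm"
    by blast
  define P where "P i C \<longleftrightarrow> (\<forall>s v \<eta> W. bdd m Bm s v \<and> 0 \<le> \<eta> \<and> 0 \<le> W \<and> jets_modulus m \<eta> W v \<longrightarrow>
    (\<forall>r\<in>{0..R}. \<forall>r'\<in>{0..R}. \<bar>r - r'\<bar> \<le> \<eta> \<longrightarrow> \<bar>tval s v (jet_source i) r - tval s v (jet_source i) r'\<bar> \<le> C * (\<eta> + W)))" for i C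
  have "\<exists>C\<ge>0. P i C" if "i \<le> m" for i
    unfolding P_def by (rule tval_modulus[OF order_le_mono[OF order_le_jet_source that]])
  then have "\<forall>i. \<exists>C. i \<le> m \<longrightarrow> C \<ge> 0 \<and> P i C" by blast
  then obtain Cf where "\<forall>i. i \<le> m \<longrightarrow> Cf i \<ge> 0 \<and> P i (Cf i)" using choice by meson
  then have Cf: "\<And>i. i \<le> m \<Longrightarrow> Cf i \<ge> (0::real)" "\<And>i s v \<eta> W r r'. i \<le> m \<Longrightarrow> bdd m Bm s v \<Longrightarrow> 0 \<le> \<eta> \<Longrightarrow> 0 \<le> W \<Longrightarrow> jets_modulus m \<eta> W v \<Longrightarrow>
    r\<in>{0..R} \<Longrightarrow> r'\<in>{0..R} \<Longrightarrow> \<bar>r - r'\<bar> \<le> \<eta> \<Longrightarrow> \<bar>tval s v (jet_source i) r - tval s v (jet_source i) r'\<bar> \<le> Cf i * (\<eta> + W)"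
    unfolding P_def by blast+
  define D where "D = (\<Sum>i\<le>m. Cf i)"
  have D: "D \<ge> 0" using Cf by (auto simp: D_def intro: sum_nonneg)
  have CD: "Cf i \<le> D" if "i \<le> m" for i unfolding D_def using Cf that by (intro member_le_sum) auto
  \<comment> \<open>The quantity that grows exponentially is \<eta> plus the oscillation, so \<eta>
    is subtracted to recover the oscillation.\<close>
  have main: "jets_modulus m \<eta> (exp (D * u) * (\<eta> + W) - \<eta>) v"
    if "reach h0 v0 u h v" "u \<le> U0" and e: "0 \<le> \<eta>" "0 \<le> W" "jets_modulus m \<eta> W v0" for u h v \<eta> W
    using that(1,2)
  proof (induction rule: reach.induct)
    case reach_init then show ?case using e by simp
  next
    case (reach_step u h v s)
    then have u: "u \<le> U0" by auto
    define W' where "W' = exp (D * u) * (\<eta> + W) - \<eta>"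
    have IH: "jets_modulus m \<eta> W' v" using reach_step u by (simp add: W'_def)
    have v: "0 \<le> u" "jet m h v" "small (v 0)" using reach_basic[OF reach_step.hyps(1) u] by auto
    have W': "0 \<le> W'"
    proof -
      have "1 * (\<eta> + W) \<le> exp (D * u) * (\<eta> + W)" using D v e by (intro mult_right_mono) auto
      then show ?thesis using e by (simp add: W'_def)
    qed
    have adm: "adm s v" by (rule adm_small[where v = v, OF v(3) reach_step.hyps(2,3)])
    have b: "bdd m Bm s v" using adm Bm[OF reach_step.hyps(1) u] v by (auto simp: bdd_def jet_def)
    show ?case unfolding jets_modulus_def
    proof (intro allI impI ballI)
      fix i r r' assume i: "i \<le> m" and r: "r \<in> {0..R}" "r' \<in> {0..R}" "\<bar>r - r'\<bar> \<le> \<eta>"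
      have y: "foot s (v 0) r \<in> {0..R}" "foot s (v 0) r' \<in> {0..R}" "\<bar>foot s (v 0) r - foot s (v 0) r'\<bar> \<le> \<bar>r - r'\<bar>"
        using adm r unfolding adm_def by blast+
      then have 1: "\<bar>v i (foot s (v 0) r) - v i (foot s (v 0) r')\<bar> \<le> W'"
        using IH i r unfolding jets_modulus_def by auto
      have "\<bar>tval s v (jet_source i) r - tval s v (jet_source i) r'\<bar> \<le> Cf i * (\<eta> + W')"
        by (rule Cf(2)[OF i b e(1) W' IH r])
      also have "\<dots> \<le> D * (\<eta> + W')" using CD[OF i] W' e by (intro mult_right_mono) auto
      finally have "\<bar>s * (tval s v (jet_source i) r - tval s v (jet_source i) r')\<bar> \<le> s * (D * (\<eta> + W'))"
        unfolding abs_mult using reach_step.hyps by (intro mult_mono) auto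
      with 1 have "\<bar>step_jet s v i r - step_jet s v i r'\<bar> + \<eta> \<le> (1 + D * s) * (\<eta> + W')"
        unfolding step_jet_def by (simp add: algebra_simps)
      then have "\<bar>step_jet s v i r - step_jet s v i r'\<bar> + \<eta> \<le> exp (D * (u + s)) * (\<eta> + W)"
        by (intro growth_step[where a = "\<eta> + W'"]) (use D e reach_step.hyps in \<open>auto simp: W'_def\<close>)
      then show "\<bar>step_jet s v i r - step_jet s v i r'\<bar> \<le> exp (D * (u + s)) * (\<eta> + W) - \<eta>" by simp
    qed
  qed
  show ?thesis
  proof (intro exI[of _ "exp (D * U0)"] conjI allI impI)
    fix u h v \<eta> W assume a: "reach h0 v0 u h v" "u \<le> U0" "0 \<le> \<eta>" "0 \<le> W" "jets_modulus m \<eta> W v0"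
    have "exp (D * u) * (\<eta> + W) - \<eta> \<le> exp (D * U0) * (\<eta> + W)"
      using mult_right_mono[of "exp (D * u)" "exp (D * U0)" "\<eta> + W"] a D by (auto simp: mult_left_mono)
    then show "jets_modulus m \<eta> (exp (D * U0) * (\<eta> + W)) v"
      using main[OF a] unfolding jets_modulus_def by (meson order_trans)
  qed auto
qed

lemma reach_equicont:
  assumes "e > 0"
  shows "\<exists>\<eta>>0. \<forall>u h v. reach h0 v0 u h v \<longrightarrow> u \<le> U0 \<longrightarrow> jets_modulus m \<eta> e v"
proof -
  obtain C where C: "C \<ge> 0" "\<forall>u h v \<eta> W. reach h0 v0 u h v \<longrightarrow> u \<le> U0 \<longrightarrow> 0 \<le> \<eta> \<longrightarrow> 0 \<le> W \<longrightarrow> jets_modulus m \<eta> W v0 \<longrightarrow> jets_modulus m \<eta> (C * (\<eta> + W)) v"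
    using reach_modulus by blast
  \<comment> \<open>With \<eta> at most W, the factor C turns \<eta> + W into at most 2 (C + 1) W =
    e.\<close>
  define W where "W = e / (2 * (C + 1))"
  have W: "W > 0" using C assms by (simp add: W_def)
  have "\<exists>d>0. \<forall>r\<in>{0..R}. \<forall>r'\<in>{0..R}. \<bar>r - r'\<bar> < d \<longrightarrow> \<bar>v0 i r - v0 i r'\<bar> < W" if "i \<le> m" for i
    using compact_uniformly_continuous[of "{0..R}" "v0 i"] jet0 that W
    unfolding uniformly_continuous_on_def jet_def dist_real_def by (metis abs_minus_commute compact_Icc)
  then obtain d where d: "\<And>i. i \<le> m \<Longrightarrow> d i > 0 \<and> (\<forall>r\<in>{0..R}. \<forall>r'\<in>{0..R}. \<bar>r - r'\<bar> < d i \<longrightarrow> \<bar>v0 i r - v0 i r'\<bar> < W)"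
    by metis
  \<comment> \<open>Halving the minimum gives \<eta> < d i strictly, and the entry 2 W gives \<eta>
    \<le> W.\<close>
  define \<eta> where "\<eta> = Min (insert (2 * W) (d ` {..m})) / 2"
  have Mi: "Min (insert (2 * W) (d ` {..m})) > 0" using d W by (subst Min_gr_iff) auto
  have eta: "\<eta> > 0" using Mi by (simp add: \<eta>_def)
  have "Min (insert (2 * W) (d ` {..m})) \<le> 2 * W" by (intro Min_le) auto
  then have etaW: "\<eta> \<le> W" by (simp add: \<eta>_def)
  have "\<eta> < d i" if "i \<le> m" for i
  proof -
    have "Min (insert (2 * W) (d ` {..m})) \<le> d i" using that by (intro Min_le) auto
    then show ?thesis using Mi unfolding \<eta>_def by linarith
  qed
  then have "jets_modulus m \<eta> W v0" using d unfolding jets_modulus_def by (meson less_imp_le order.strict_trans1)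
  moreover have "C * (\<eta> + W) \<le> e"
  proof -
    have "C * (\<eta> + W) \<le> (C + 1) * (2 * W)" using etaW eta W C by (intro mult_mono) auto
    also have "\<dots> = e * ((C + 1) / (C + 1))" by (simp add: W_def field_simps)
    also have "\<dots> = e" using C(1) by simp
    finally show ?thesis .
  qed
  ultimately show ?thesis
    using C(2) eta W unfolding jets_modulus_def by (intro exI[of _ \<eta>]) (meson less_imp_le order_trans)
qed

end

section \<open>Mixed regularity and the maximum principle\<close>

definition contbox :: "real \<Rightarrow> real \<Rightarrow> (real \<Rightarrow> real \<Rightarrow> real) \<Rightarrow> bool" where
  "contbox U R g \<longleftrightarrow> continuous_on ({0..U} \<times> {0..R}) (\<lambda>p. g (fst p) (snd p))"

definition derr :: "real \<Rightarrow> real \<Rightarrow> (real \<Rightarrow> real \<Rightarrow> real) \<Rightarrow> (real \<Rightarrow> real \<Rightarrow> real) \<Rightarrow> bool" where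
  "derr U R g g' \<longleftrightarrow> (\<forall>u\<in>{0..U}. \<forall>r\<in>{0..R}. (g u has_real_derivative g' u r) (at r within {0..R}))"

definition deru :: "real \<Rightarrow> real \<Rightarrow> (real \<Rightarrow> real \<Rightarrow> real) \<Rightarrow> (real \<Rightarrow> real \<Rightarrow> real) \<Rightarrow> bool" where
  "deru U R g g' \<longleftrightarrow> (\<forall>u\<in>{0..U}. \<forall>r\<in>{0..R}. ((\<lambda>v. g v r) has_real_derivative g' u r) (at u within {0..U}))"

lemma contbox_r: "contbox U R g \<Longrightarrow> u \<in> {0..U} \<Longrightarrow> continuous_on {0..R} (g u)"
  unfolding contbox_def
  by (drule continuous_on_compose2[where f = "Pair u" and s = "{0..R}"]) (auto intro: continuous_on_Pair)

lemma contbox_u: "contbox U R g \<Longrightarrow> r \<in> {0..R} \<Longrightarrow> continuous_on {0..U} (\<lambda>u. g u r)"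
  unfolding contbox_def
  by (drule continuous_on_compose2[where f = "\<lambda>u. (u, r)" and s = "{0..U}"]) (auto intro!: continuous_intros)

lemma contbox_cong:
  "(\<And>u r. u \<in> {0..U} \<Longrightarrow> r \<in> {0..R} \<Longrightarrow> f u r = g u r) \<Longrightarrow> contbox U R f = contbox U R g"
  unfolding contbox_def by (intro continuous_on_cong) auto

lemma derr_cong:
  assumes "\<And>u r. u \<in> {0..U} \<Longrightarrow> r \<in> {0..R} \<Longrightarrow> f u r = g u r" "derr U R f f'"
  shows "derr U R g f'"
  unfolding derr_def
proof (intro ballI)
  fix u r assume *: "u \<in> {0..U}" "r \<in> {0..R}"
  show "(g u has_real_derivative f' u r) (at r within {0..R})"
    by (rule has_field_derivative_transform_within[of "f u" _ _ _ 1]) (use assms * in \<open>auto simp: derr_def\<close>)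
qed

lemma deru_cong:
  assumes "\<And>u r. u \<in> {0..U} \<Longrightarrow> r \<in> {0..R} \<Longrightarrow> f u r = g u r" "deru U R f f'"
  shows "deru U R g f'"
  unfolding deru_def
proof (intro ballI)
  fix u r assume *: "u \<in> {0..U}" "r \<in> {0..R}"
  show "((\<lambda>v. g v r) has_real_derivative f' u r) (at u within {0..U})"
    by (rule has_field_derivative_transform_within[of "\<lambda>v. f v r" _ _ _ 1]) (use assms * in \<open>auto simp: deru_def\<close>)
qed

text \<open>\<open>mixed_Ck U R a m g\<close>: all partial derivatives of \<open>g\<close> of total order at most \<open>m\<close> with at most \<open>a\<close>
  differentiations in \<open>u\<close> exist and are continuous. Since the evolution equation expresses \<open>\<partial>\<^sub>u h\<close>
  through \<open>\<partial>\<^sub>r h\<close>, the parameter \<open>a\<close> can be raised step by step.\<close>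

fun mixed_Ck :: "real \<Rightarrow> real \<Rightarrow> nat \<Rightarrow> nat \<Rightarrow> (real \<Rightarrow> real \<Rightarrow> real) \<Rightarrow> bool" where
  "mixed_Ck U R a 0 g = contbox U R g"
| "mixed_Ck U R a (Suc m) g = (contbox U R g \<and> (\<exists>g'. derr U R g g' \<and> mixed_Ck U R a m g') \<and>
     (a = 0 \<or> (\<exists>g'. deru U R g g' \<and> mixed_Ck U R (a - 1) m g')))"

lemma mixed_Ck_contbox: "mixed_Ck U R a m g \<Longrightarrow> contbox U R g"
  by (cases m) auto

lemma mixed_Ck_cong:
  "(\<And>u r. u \<in> {0..U} \<Longrightarrow> r \<in> {0..R} \<Longrightarrow> f u r = g u r) \<Longrightarrow> mixed_Ck U R a m f \<Longrightarrow> mixed_Ck U R a m g"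
  using contbox_cong[of U R f g] derr_cong[of U R f g] deru_cong[of U R f g]
  by (cases m) (simp_all, blast)

lemma mixed_Ck_Suc_D: "mixed_Ck U R a (Suc m) g \<Longrightarrow> mixed_Ck U R a m g"
  by (induction m arbitrary: a g) (simp, metis mixed_Ck.simps(2))

lemma mixed_Ck_mono_a: "mixed_Ck U R a m g \<Longrightarrow> b \<le> a \<Longrightarrow> mixed_Ck U R b m g"
proof (induction m arbitrary: a b g)
  case (Suc m)
  then obtain g1 where g1: "contbox U R g" "derr U R g g1" "mixed_Ck U R a m g1" by auto
  have "mixed_Ck U R b m g1" using Suc.IH[OF g1(3) Suc.prems(2)] .
  moreover have "b = 0 \<or> (\<exists>g'. deru U R g g' \<and> mixed_Ck U R (b - 1) m g')"
  proof (cases "b = 0")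
    case False
    then obtain g2 where "deru U R g g2" "mixed_Ck U R (a - 1) m g2" using Suc.prems by auto
    then show ?thesis using Suc.IH[of "a - 1" g2 "b - 1"] Suc.prems(2) by auto
  qed auto
  ultimately show ?case using g1 by auto
qed auto

lemma mixed_Ck_const: "mixed_Ck U R a m (\<lambda>u r. c)"
proof (induction m arbitrary: a c)
  case (Suc m)
  have "derr U R (\<lambda>u r. c) (\<lambda>u r. 0)" "deru U R (\<lambda>u r. c) (\<lambda>u r. 0)" by (auto simp: derr_def deru_def)
  then show ?case using Suc by (auto simp: contbox_def)
qed (auto simp: contbox_def)

lemma mixed_Ck_r: "mixed_Ck U R a m (\<lambda>u r. r)"
proof (cases m)
  case (Suc m)
  have "derr U R (\<lambda>u r. r) (\<lambda>u r. 1)" "deru U R (\<lambda>u r. r) (\<lambda>u r. 0)" by (auto simp: derr_def deru_def)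
  then show ?thesis using Suc mixed_Ck_const by (auto simp: contbox_def intro!: continuous_intros)
qed (auto simp: contbox_def intro!: continuous_intros)

lemma mixed_Ck_add: "mixed_Ck U R a m f \<Longrightarrow> mixed_Ck U R a m g \<Longrightarrow> mixed_Ck U R a m (\<lambda>u r. f u r + g u r)"
proof (induction m arbitrary: a f g)
  case (Suc m)
  have c: "contbox U R (\<lambda>u r. f u r + g u r)"
    using Suc.prems by (auto simp: contbox_def intro!: continuous_intros)
  obtain f' g' where r: "derr U R f f'" "mixed_Ck U R a m f'" "derr U R g g'" "mixed_Ck U R a m g'" using Suc.prems by auto
  have "derr U R (\<lambda>u r. f u r + g u r) (\<lambda>u r. f' u r + g' u r)"
    using r by (auto simp: derr_def intro!: derivative_eq_intros)
  with Suc.IH[OF r(2,4)] have r: "\<exists>g'. derr U R (\<lambda>u r. f u r + g u r) g' \<and> mixed_Ck U R a m g'" by blast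
  have "\<exists>g'. deru U R (\<lambda>u r. f u r + g u r) g' \<and> mixed_Ck U R (a - 1) m g'" if a0: "a \<noteq> 0"
  proof -
    obtain f' g' where u: "deru U R f f'" "mixed_Ck U R (a - 1) m f'" "deru U R g g'" "mixed_Ck U R (a - 1) m g'"
      using Suc.prems a0 by auto
    have "deru U R (\<lambda>u r. f u r + g u r) (\<lambda>u r. f' u r + g' u r)"
      using u by (auto simp: deru_def intro!: derivative_eq_intros)
    with Suc.IH[OF u(2,4)] show ?thesis by blast
  qed
  with c r show ?case by auto
qed (auto simp: contbox_def intro!: continuous_intros)

lemma mixed_Ck_mult: "mixed_Ck U R a m f \<Longrightarrow> mixed_Ck U R a m g \<Longrightarrow> mixed_Ck U R a m (\<lambda>u r. f u r * g u r)"
proof (induction m arbitrary: a f g)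
  case (Suc m)
  note low = mixed_Ck_Suc_D[OF Suc.prems(1)] mixed_Ck_Suc_D[OF Suc.prems(2)]
  have c: "contbox U R (\<lambda>u r. f u r * g u r)"
    using Suc.prems by (auto simp: contbox_def intro!: continuous_intros)
  obtain f' g' where r: "derr U R f f'" "mixed_Ck U R a m f'" "derr U R g g'" "mixed_Ck U R a m g'" using Suc.prems by auto
  have "derr U R (\<lambda>u r. f u r * g u r) (\<lambda>u r. f' u r * g u r + f u r * g' u r)"
    using r by (auto simp: derr_def intro!: derivative_eq_intros)
  with mixed_Ck_add[OF Suc.IH[OF r(2) low(2)] Suc.IH[OF low(1) r(4)]]
  have r: "\<exists>g'. derr U R (\<lambda>u r. f u r * g u r) g' \<and> mixed_Ck U R a m g'" by blast
  have "\<exists>g'. deru U R (\<lambda>u r. f u r * g u r) g' \<and> mixed_Ck U R (a - 1) m g'" if a0: "a \<noteq> 0"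
  proof -
    obtain f' g' where u: "deru U R f f'" "mixed_Ck U R (a - 1) m f'" "deru U R g g'" "mixed_Ck U R (a - 1) m g'"
      using Suc.prems a0 by auto
    have "deru U R (\<lambda>u r. f u r * g u r) (\<lambda>u r. f' u r * g u r + f u r * g' u r)"
      using u by (auto simp: deru_def intro!: derivative_eq_intros)
    moreover have "mixed_Ck U R (a - 1) m f" "mixed_Ck U R (a - 1) m g" using low mixed_Ck_mono_a by auto
    ultimately show ?thesis using mixed_Ck_add[OF Suc.IH[OF u(2)] Suc.IH[OF _ u(4)]] by blast
  qed
  with c r show ?case by auto
qed (auto simp: contbox_def intro!: continuous_intros)

lemma mixed_Ck_exp: "mixed_Ck U R a m g \<Longrightarrow> mixed_Ck U R a m (\<lambda>u r. exp (g u r))"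
proof (induction m arbitrary: a g)
  case (Suc m)
  note low = mixed_Ck_Suc_D[OF Suc.prems]
  have c: "contbox U R (\<lambda>u r. exp (g u r))"
    using Suc.prems by (auto simp: contbox_def intro!: continuous_intros)
  obtain g' where r: "derr U R g g'" "mixed_Ck U R a m g'" using Suc.prems by auto
  have "derr U R (\<lambda>u r. exp (g u r)) (\<lambda>u r. exp (g u r) * g' u r)"
    using r by (auto simp: derr_def intro!: derivative_eq_intros)
  with mixed_Ck_mult[OF Suc.IH[OF low] r(2)]
  have r: "\<exists>g'. derr U R (\<lambda>u r. exp (g u r)) g' \<and> mixed_Ck U R a m g'" by blast
  have "\<exists>g'. deru U R (\<lambda>u r. exp (g u r)) g' \<and> mixed_Ck U R (a - 1) m g'" if a0: "a \<noteq> 0"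
  proof -
    obtain g' where u: "deru U R g g'" "mixed_Ck U R (a - 1) m g'" using Suc.prems a0 by auto
    have "deru U R (\<lambda>u r. exp (g u r)) (\<lambda>u r. exp (g u r) * g' u r)"
      using u by (auto simp: deru_def intro!: derivative_eq_intros)
    moreover have "mixed_Ck U R (a - 1) m g" using low mixed_Ck_mono_a by auto
    ultimately show ?thesis using mixed_Ck_mult[OF Suc.IH u(2)] by blast
  qed
  with c r show ?case by auto
qed (auto simp: contbox_def intro!: continuous_intros)

lemma derr_Av: "derr U R g g' \<Longrightarrow> contbox U R g' \<Longrightarrow> derr U R (\<lambda>u. Av p (g u)) (\<lambda>u. Av (Suc p) (g' u))"
  unfolding derr_def using contbox_r by (blast intro: Av_deriv)

lemma deru_Av:
  assumes g: "deru U R g g'" "contbox U R g" and g': "contbox U R g'"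
  shows "deru U R (\<lambda>u. Av p (g u)) (\<lambda>u. Av p (g' u))"
  unfolding deru_def
proof (intro ballI)
  fix u r assume u: "u \<in> {0..U}" and r: "r \<in> {0..R}"
  have "((\<lambda>v. integral (cbox 0 1) (\<lambda>t. t ^ p * g v (r * t))) has_real_derivative
      integral (cbox 0 1) (\<lambda>t. t ^ p * g' u (r * t))) (at u within {0..U})"
  proof (rule leibniz_rule_field_derivative)
    fix x t :: real assume x: "x \<in> {0..U}" and t: "t \<in> cbox 0 1"
    have "r * t \<in> {0..R}" using scale_mem r t by auto
    then show "((\<lambda>x. t ^ p * g x (r * t)) has_real_derivative t ^ p * g' x (r * t)) (at x within {0..U})"
      using g(1) x unfolding deru_def by (auto intro!: DERIV_cmult)
  next
    show "(\<lambda>t. t ^ p * g x (r * t)) integrable_on cbox 0 1" if "x \<in> {0..U}" for x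
      using Av_integrable[OF contbox_r[OF g(2) that] r] by simp
    have "continuous_on ({0..U} \<times> cbox 0 1) (\<lambda>z. g' (fst z) (r * snd z))"
      using continuous_on_compose2[OF g'[unfolded contbox_def], of "{0..U} \<times> cbox 0 1" "\<lambda>z. (fst z, r * snd z)"] scale_mem[OF r]
      by (simp add: image_subset_iff continuous_intros)
    then show "continuous_on ({0..U} \<times> cbox 0 1) (\<lambda>(x, t). t ^ p * g' x (r * t))"
      by (auto simp: split_beta intro!: continuous_intros)
  qed (use u in auto)
  then show "((\<lambda>v. Av p (g v) r) has_real_derivative Av p (g' u) r) (at u within {0..U})"
    by (simp add: Av_def)
qed

lemma mixed_Ck_Av: "mixed_Ck U R a m g \<Longrightarrow> mixed_Ck U R a m (\<lambda>u. Av p (g u))"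
proof (induction m arbitrary: a g p)
  case 0 then show ?case using Av_cont2 by (auto simp: contbox_def)
next
  case (Suc m)
  have cg: "contbox U R g" using Suc.prems by auto
  have c: "contbox U R (\<lambda>u. Av p (g u))"
    using Av_cont2 cg by (auto simp: contbox_def)
  obtain g' where "derr U R g g'" "mixed_Ck U R a m g'" using Suc.prems by auto
  then have r: "\<exists>g'. derr U R (\<lambda>u. Av p (g u)) g' \<and> mixed_Ck U R a m g'"
    using derr_Av mixed_Ck_contbox Suc.IH by blast
  have "\<exists>g'. deru U R (\<lambda>u. Av p (g u)) g' \<and> mixed_Ck U R (a - 1) m g'" if a: "a \<noteq> 0"
  proof -
    obtain g' where "deru U R g g'" "mixed_Ck U R (a - 1) m g'" using Suc.prems a by auto
    then show ?thesis using deru_Av cg mixed_Ck_contbox Suc.IH by blast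
  qed
  with c r show ?case by auto
qed

text \<open>For a equal to the order, the limit on differentiations in u is void. Both intervals are
  nondegenerate, so the derivatives are unique and agree with \<open>pr\<close> and
  \<open>pu\<close>.\<close>

lemma mixed_Ck_imp_Ck2:
  assumes "U > 0" "R > 0"
  shows "mixed_Ck U R k k h \<Longrightarrow> Ck2 k U R h"
proof (induction k arbitrary: h)
  case 0 then show ?case by (simp add: contbox_def)
next
  case (Suc k)
  then obtain hr hu where r: "derr U R h hr" "mixed_Ck U R (Suc k) k hr" and u: "deru U R h hu" "mixed_Ck U R k k hu"
    and c: "contbox U R h" by auto
  have pr: "hr u r = pr R h u r" if "u \<in> {0..U}" "r \<in> {0..R}" for u r
    using r(1) that assms unfolding derr_def pr_def has_real_derivative_iff_has_vector_derivative
    by (intro vector_derivative_within_cbox[symmetric, of 0 R, unfolded cbox_interval]) auto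
  have pu: "hu u r = pu U h u r" if "u \<in> {0..U}" "r \<in> {0..R}" for u r
    using u(1) that assms unfolding deru_def pu_def has_real_derivative_iff_has_vector_derivative
    by (intro vector_derivative_within_cbox[symmetric, of 0 U, unfolded cbox_interval]) auto
  have "Ck2 k U R (pr R h)" by (rule Suc.IH, rule mixed_Ck_cong[OF pr]) (use r(2) mixed_Ck_mono_a in auto)
  moreover have "Ck2 k U R (pu U h)" by (rule Suc.IH, rule mixed_Ck_cong[OF pu]) (use u(2) in auto)
  moreover have "(\<lambda>v. h v r) differentiable (at u within {0..U})" "(\<lambda>s. h u s) differentiable (at r within {0..R})"
    if "u \<in> {0..U}" "r \<in> {0..R}" for u r
    using r(1) u(1) that unfolding derr_def deru_def by (meson has_field_derivative_imp_has_derivative differentiableI)+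
  ultimately show ?case
    using c unfolding contbox_def by simp
qed

lemma Ck2_imp_cont: "Ck2 k U R g \<Longrightarrow> contbox U R g"
  by (cases k) (auto simp: contbox_def)

lemma Ck2_imp_C1:
  assumes "Ck2 k U R h" "k \<ge> 1"
  shows "contbox U R h" "derr U R h (pr R h)" "deru U R h (pu U h)" "contbox U R (pr R h)" "contbox U R (pu U h)"
proof -
  obtain k' where k: "k = Suc k'" using assms(2) by (cases k) auto
  show "contbox U R h" "contbox U R (pr R h)" "contbox U R (pu U h)"
    using assms(1) Ck2_imp_cont unfolding k by (auto simp: contbox_def)
  show "derr U R h (pr R h)" "deru U R h (pu U h)"
    using assms(1) unfolding k derr_def deru_def pr_def pu_def has_real_derivative_iff_has_vector_derivative
    by (auto simp flip: vector_derivative_works)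
qed

section \<open>Maximum principle for the transport equation\<close>

lemma max_deriv_sign:
  fixes g :: "real \<Rightarrow> real"
  assumes d: "(g has_real_derivative D) (at x within {c..d})" and x: "x \<in> {c..d}" and m: "\<And>y. y \<in> {c..d} \<Longrightarrow> g y \<le> g x"
  shows "x < d \<Longrightarrow> D \<le> 0" "c < x \<Longrightarrow> D \<ge> 0"
proof -
  show "D \<le> 0" if "x < d"
  proof (rule ccontr)
    assume "\<not> D \<le> 0"
    then obtain e where e: "e > 0" "\<forall>h>0. x + h \<in> {c..d} \<longrightarrow> h < e \<longrightarrow> g x < g (x + h)"
      using has_real_derivative_pos_inc_right[OF d] by auto
    define h where "h = min (e / 2) (d - x)"
    have "h > 0" "h < e" "x + h \<in> {c..d}" using e(1) that x by (auto simp: h_def min_def)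
    then show False using e(2) m[of "x + h"] by force
  qed
  show "D \<ge> 0" if "c < x"
  proof (rule ccontr)
    assume "\<not> D \<ge> 0"
    then obtain e where e: "e > 0" "\<forall>h>0. x - h \<in> {c..d} \<longrightarrow> h < e \<longrightarrow> g x < g (x - h)"
      using has_real_derivative_neg_dec_left[OF d] by auto
    define h where "h = min (e / 2) (x - c)"
    have "h > 0" "h < e" "x - h \<in> {c..d}" using e(1) that x by (auto simp: h_def min_def)
    then show False using e(2) m[of "x - h"] by force
  qed
qed

text \<open>The boundary is of outflow type at both ends, so no boundary values enter: at a positive maximum
  of \<open>exp (- L u) z\<close> with \<open>u > 0\<close> the transport term has a sign.\<close>

lemma transport_maximum_principle:
  fixes z :: "real \<Rightarrow> real \<Rightarrow> real"
  assumes UR: "U > 0" "R > 0" and z: "contbox U R z" "derr U R z zr" "deru U R z zu"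
    and a: "\<And>u. u \<in> {0..U} \<Longrightarrow> a u 0 \<ge> 0" "\<And>u. u \<in> {0..U} \<Longrightarrow> a u R \<le> 0"
    and ineq: "\<And>u r. u \<in> {0..U} \<Longrightarrow> r \<in> {0..R} \<Longrightarrow> z u r > 0 \<Longrightarrow> (\<And>r'. r' \<in> {0..R} \<Longrightarrow> z u r' \<le> z u r) \<Longrightarrow>
       zu u r - a u r * zr u r \<le> C * z u r"
    and K: "K \<ge> 0" "\<And>r. r \<in> {0..R} \<Longrightarrow> z 0 r \<le> K" and lam: "L > C"
    and ur: "u \<in> {0..U}" "r \<in> {0..R}"
  shows "z u r \<le> exp (L * u) * K"
proof -
  let ?y = "\<lambda>u r. exp (- L * u) * z u r"
  have "continuous_on ({0..U} \<times> {0..R}) (\<lambda>p. ?y (fst p) (snd p))"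
    using z(1) unfolding contbox_def by (intro continuous_intros)
  then obtain p where p: "p \<in> {0..U} \<times> {0..R}" "\<forall>q\<in>{0..U} \<times> {0..R}. ?y (fst q) (snd q) \<le> ?y (fst p) (snd p)"
    using continuous_attains_sup[of "{0..U} \<times> {0..R}" "\<lambda>p. ?y (fst p) (snd p)"] UR by (auto simp: compact_Times)
  obtain s t where st: "p = (s, t)" by (cases p)
  have s: "s \<in> {0..U}" and t: "t \<in> {0..R}" using p(1) st by auto
  have mx: "?y u r \<le> ?y s t" if "u \<in> {0..U}" "r \<in> {0..R}" for u r using p(2) that st by fastforce
  have "?y s t \<le> K"
  proof (rule ccontr)
    assume "\<not> ?y s t \<le> K"
    then have big: "?y s t > K" by simp
    have s0: "s > 0" using big K(2)[OF t] s by (cases "s = 0") auto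
    have zpos: "z s t > 0" using big K(1) by (smt (verit) exp_gt_zero mult_nonneg_nonpos)
    have zmax: "z s r' \<le> z s t" if "r' \<in> {0..R}" for r' using mx[OF s that] by simp
    \<comment> \<open>The maximum may sit at the final time, so only the comparison with earlier
      times is used; it gives zu \<ge> L z.\<close>
    have "((\<lambda>v. ?y v t) has_real_derivative - L * exp (- L * s) * z s t + exp (- L * s) * zu s t) (at s within {0..U})"
      using z(3) s t unfolding deru_def by (auto intro!: derivative_eq_intros)
    from max_deriv_sign(2)[OF this s] mx t s0 have "- L * exp (- L * s) * z s t + exp (- L * s) * zu s t \<ge> 0" by auto
    then have "exp (- L * s) * (zu s t - L * z s t) \<ge> 0" by (simp add: algebra_simps)
    then have 1: "zu s t \<ge> L * z s t" by (simp add: zero_le_mult_iff)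
    have zr: "(z s has_real_derivative zr s t) (at t within {0..R})" using z(2) s t by (auto simp: derr_def)
    \<comment> \<open>At the left end the maximum gives zr \<le> 0 against a \<ge> 0, at the right
      end zr \<ge> 0 against a \<le> 0, and inside zr = 0.\<close>
    have "a s t * zr s t \<le> 0"
    proof (cases "t = 0 \<or> t = R")
      case True
      then show ?thesis
        using max_deriv_sign[OF zr t zmax] a[OF s] UR by (auto simp: mult_nonneg_nonpos mult_nonpos_nonneg)
    next
      case False
      then have "zr s t = 0" using max_deriv_sign[OF zr t zmax] t by force
      then show ?thesis by simp
    qed
    with ineq[OF s t zpos zmax] have "zu s t \<le> C * z s t" by linarith
    with 1 have "L * z s t \<le> C * z s t" by linarith
    then show False using zpos lam by simp
  qed
  then have "exp (L * u) * ?y u r \<le> exp (L * u) * K" using mx[OF ur] by (intro mult_left_mono) auto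
  then show ?thesis by (simp flip: exp_add mult.assoc)
qed

context bondi begin

context
  fixes U :: real and a m :: nat and W :: "real \<Rightarrow> real \<Rightarrow> real"
  assumes W: "mixed_Ck U R a m W"
begin

text \<open>The integral with upper limit r is r times an average, so closure under
  \<open>Av\<close>, products and exp covers it.\<close>

lemma mixed_Ck_Ff: "mixed_Ck U R a m (\<lambda>u. Ff (W u))"
proof (rule mixed_Ck_cong)
  show "mixed_Ck U R a m (\<lambda>u r. exp (\<kappa> / 2 * (r * Av 0 (\<lambda>s. s * (Av 1 (W u) s * Av 1 (W u) s)) r)))"
    by (intro mixed_Ck_exp mixed_Ck_mult mixed_Ck_const mixed_Ck_r mixed_Ck_Av W)
  fix u r assume "u \<in> {0..U}" "r \<in> {0..R}"
  then show "exp (\<kappa> / 2 * (r * Av 0 (\<lambda>s. s * (Av 1 (W u) s * Av 1 (W u) s)) r)) = Ff (W u) r"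
    using Av_eq_integral[OF Ff_integrand_cont[OF contbox_r[OF mixed_Ck_contbox[OF W]]], of u r 0]
    by (simp add: Ff_def power2_eq_square)
qed

lemma mixed_Ck_Fd: "mixed_Ck U R a m (\<lambda>u. Fd (W u))"
  unfolding Fd_def[abs_def] power2_eq_square by (intro mixed_Ck_mult mixed_Ck_const mixed_Ck_r mixed_Ck_Av W mixed_Ck_Ff)

lemma mixed_Ck_aa: "mixed_Ck U R a m (\<lambda>u. aa (W u))"
proof (rule mixed_Ck_cong)
  show "mixed_Ck U R a m (\<lambda>u r. (1 / 2) * (Av 0 (Ff (W u)) r + (- \<Lambda>) * (r * (r * Av 2 (Ff (W u)) r))))"
    by (intro mixed_Ck_add mixed_Ck_mult mixed_Ck_const mixed_Ck_r mixed_Ck_Av mixed_Ck_Ff)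
qed (simp add: aa_def power2_eq_square)

lemma mixed_Ck_GG: "mixed_Ck U R a m (\<lambda>u. GG (W u))"
proof (rule mixed_Ck_cong)
  show "mixed_Ck U R a m (\<lambda>u r. (1 / 2) * (Av 1 (Fd (W u)) r + \<Lambda> * r * (Av 2 (Ff (W u)) r + (- 1) * Ff (W u) r)))"
    by (intro mixed_Ck_add mixed_Ck_mult mixed_Ck_const mixed_Ck_r mixed_Ck_Av mixed_Ck_Ff mixed_Ck_Fd)
qed (simp add: GG_def)

lemma mixed_Ck_TT: "mixed_Ck U R a m (\<lambda>u. TT (W u))"
  unfolding TT_def[abs_def] by (intro mixed_Ck_mult mixed_Ck_GG mixed_Ck_r mixed_Ck_Av W)

end

end

section \<open>Limits of the polygons\<close>

text \<open>On an interval of length \<eta> the mean value theorem yields a point where the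
  derivatives differ by at most 2 \<delta> / \<eta>; from there to r each of them changes by at most
  e.\<close>

lemma deriv_interpolation:
  fixes g1 g2 :: "real \<Rightarrow> real"
  assumes g1: "\<And>r. r \<in> {0..R} \<Longrightarrow> (g1 has_real_derivative w1 r) (at r within {0..R})"
    and g2: "\<And>r. r \<in> {0..R} \<Longrightarrow> (g2 has_real_derivative w2 r) (at r within {0..R})"
    and m1: "\<And>r r'. r \<in> {0..R} \<Longrightarrow> r' \<in> {0..R} \<Longrightarrow> \<bar>r - r'\<bar> \<le> \<eta> \<Longrightarrow> \<bar>w1 r - w1 r'\<bar> \<le> e"
    and m2: "\<And>r r'. r \<in> {0..R} \<Longrightarrow> r' \<in> {0..R} \<Longrightarrow> \<bar>r - r'\<bar> \<le> \<eta> \<Longrightarrow> \<bar>w2 r - w2 r'\<bar> \<le> e"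
    and d: "\<And>r. r \<in> {0..R} \<Longrightarrow> \<bar>g1 r - g2 r\<bar> \<le> \<delta>"
    and eta: "0 < \<eta>" "\<eta> \<le> R / 2" and r: "r \<in> {0..R}"
  shows "\<bar>w1 r - w2 r\<bar> \<le> 2 * e + 2 * \<delta> / \<eta>"
proof -
  \<comment> \<open>An interval of length \<eta> containing r, to the right if it fits, otherwise to
    the left; \<eta> \<le> R/2 ensures that one of the two fits.\<close>
  define a where "a = (if r + \<eta> \<le> R then r else r - \<eta>)"
  have a: "0 \<le> a" "a + \<eta> \<le> R" "a \<le> r" "r \<le> a + \<eta>" using eta r by (auto simp: a_def)
  have "\<exists>x\<in>{a..a + \<eta>}. (g1 (a + \<eta>) - g2 (a + \<eta>)) - (g1 a - g2 a) = (\<lambda>h. (w1 x - w2 x) * h) ((a + \<eta>) - a)"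
  proof (rule mvt_very_simple)
    fix x assume x: "a \<le> x" "x \<le> a + \<eta>"
    then have "x \<in> {0..R}" using a by auto
    then have "((\<lambda>r. g1 r - g2 r) has_real_derivative w1 x - w2 x) (at x within {0..R})"
      using g1 g2 by (auto intro!: derivative_eq_intros)
    then have "((\<lambda>r. g1 r - g2 r) has_real_derivative w1 x - w2 x) (at x within {a..a + \<eta>})"
      by (rule has_field_derivative_subset) (use a in auto)
    then show "((\<lambda>r. g1 r - g2 r) has_derivative (\<lambda>h. (w1 x - w2 x) * h)) (at x within {a..a + \<eta>})"
      by (simp add: has_field_derivative_def)
  qed (use eta in auto)
  then obtain x where x: "x \<in> {a..a + \<eta>}" "(g1 (a + \<eta>) - g2 (a + \<eta>)) - (g1 a - g2 a) = (w1 x - w2 x) * \<eta>" by auto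
  have "\<bar>(w1 x - w2 x) * \<eta>\<bar> \<le> 2 * \<delta>"
    unfolding x(2)[symmetric] using d[of a] d[of "a + \<eta>"] a eta by auto
  then have "\<bar>w1 x - w2 x\<bar> \<le> 2 * \<delta> / \<eta>" using eta unfolding abs_mult by (simp add: field_simps)
  moreover have "\<bar>w1 r - w1 x\<bar> \<le> e" by (rule m1) (use r x a in auto)
  moreover have "\<bar>w2 r - w2 x\<bar> \<le> e" by (rule m2) (use r x a in auto)
  ultimately show ?thesis by linarith
qed

definition unifbox :: "real \<Rightarrow> real \<Rightarrow> (nat \<Rightarrow> real \<Rightarrow> real \<Rightarrow> real) \<Rightarrow> (real \<Rightarrow> real \<Rightarrow> real) \<Rightarrow> bool" where
  "unifbox U R G g \<longleftrightarrow> (\<forall>e>0. \<exists>N. \<forall>n\<ge>N. \<forall>u\<in>{0..U}. \<forall>r\<in>{0..R}. \<bar>G n u r - g u r\<bar> \<le> e)"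

lemma unifbox_tendsto:
  assumes "unifbox U R G g" "u \<in> {0..U}" "r \<in> {0..R}"
  shows "(\<lambda>n. G n u r) \<longlonglongrightarrow> g u r"
proof (rule LIMSEQ_I)
  fix e :: real assume "e > 0"
  then have "e / 2 > 0" by simp
  with assms(1) obtain N where "\<forall>n\<ge>N. \<forall>u\<in>{0..U}. \<forall>r\<in>{0..R}. \<bar>G n u r - g u r\<bar> \<le> e / 2"
    unfolding unifbox_def by blast
  then have "\<forall>n\<ge>N. \<bar>G n u r - g u r\<bar> \<le> e / 2" using assms(2,3) by blast
  then show "\<exists>N. \<forall>n\<ge>N. norm (G n u r - g u r) < e" using \<open>e > 0\<close> by (intro exI[of _ N]) force
qed

text \<open>Equicontinuity of \<open>W\<close> is assumed in r only. Interpolation between two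
  members of the sequence makes \<open>W\<close> uniformly Cauchy; interpolation between two times
  of the limit transfers the continuity in u from g to w.\<close>

lemma unifbox_deriv:
  assumes R: "R > 0" and dG: "\<And>n. derr U R (G n) (W n)"
    and equi: "\<And>e. e > 0 \<Longrightarrow> \<exists>\<eta>>0. \<forall>n. \<forall>u\<in>{0..U}. \<forall>r\<in>{0..R}. \<forall>r'\<in>{0..R}. \<bar>r - r'\<bar> \<le> \<eta> \<longrightarrow> \<bar>W n u r - W n u r'\<bar> \<le> e"
    and G: "unifbox U R G g" and g: "contbox U R g"
  defines "w \<equiv> \<lambda>u r. lim (\<lambda>n. W n u r)"
  shows "unifbox U R W w" "derr U R g w" "contbox U R w"
proof -
  have cauchy: "\<exists>N. \<forall>n\<ge>N. \<forall>k\<ge>N. \<forall>u\<in>{0..U}. \<forall>r\<in>{0..R}. \<bar>W n u r - W k u r\<bar> \<le> e" if e: "e > 0" for e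
  proof -
    obtain \<eta>' where eta': "\<eta>' > 0" "\<forall>n. \<forall>u\<in>{0..U}. \<forall>r\<in>{0..R}. \<forall>r'\<in>{0..R}. \<bar>r - r'\<bar> \<le> \<eta>' \<longrightarrow> \<bar>W n u r - W n u r'\<bar> \<le> e / 4"
      using equi[of "e / 4"] e by auto
    define \<eta> where "\<eta> = min \<eta>' (R / 2)"
    have eta: "0 < \<eta>" "\<eta> \<le> R / 2" "\<eta> \<le> \<eta>'" using eta' R by (auto simp: \<eta>_def)
    \<comment> \<open>Two members of the sequence differ by 2 \<delta>, so interpolation gives e/2 +
      4 \<delta> / \<eta> = e.\<close>
    define \<delta> where "\<delta> = e * \<eta> / 8"
    have "\<delta> > 0" using e eta by (simp add: \<delta>_def)
    then obtain N where N: "\<forall>n\<ge>N. \<forall>u\<in>{0..U}. \<forall>r\<in>{0..R}. \<bar>G n u r - g u r\<bar> \<le> \<delta>"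
      using G unfolding unifbox_def by blast
    show ?thesis
    proof (intro exI[of _ N] allI impI ballI)
      fix n k u r assume nk: "N \<le> n" "N \<le> k" and u: "u \<in> {0..U}" and r: "r \<in> {0..R}"
      have "\<bar>W n u r - W k u r\<bar> \<le> 2 * (e / 4) + 2 * (2 * \<delta>) / \<eta>"
      proof (rule deriv_interpolation[OF _ _ _ _ _ eta(1,2) r])
        fix r assume r: "r \<in> {0..R}"
        show "(G n u has_real_derivative W n u r) (at r within {0..R})" "(G k u has_real_derivative W k u r) (at r within {0..R})"
          using dG u r unfolding derr_def by blast+
        have "\<bar>G n u r - g u r\<bar> \<le> \<delta>" "\<bar>G k u r - g u r\<bar> \<le> \<delta>" using N nk u r by blast+
        then show "\<bar>G n u r - G k u r\<bar> \<le> 2 * \<delta>" by linarith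
      next
        fix r r' assume "r \<in> {0..R}" "r' \<in> {0..R}" "\<bar>r - r'\<bar> \<le> \<eta>"
        then show "\<bar>W n u r - W n u r'\<bar> \<le> e / 4" "\<bar>W k u r - W k u r'\<bar> \<le> e / 4"
          using eta'(2) u eta(3) by (meson order_trans)+
      qed
      also have "2 * (e / 4) + 2 * (2 * \<delta>) / \<eta> = e" using eta by (simp add: \<delta>_def field_simps)
      finally show "\<bar>W n u r - W k u r\<bar> \<le> e" .
    qed
  qed
  have conv: "(\<lambda>n. W n u r) \<longlonglongrightarrow> w u r" if u: "u \<in> {0..U}" and r: "r \<in> {0..R}" for u r
  proof -
    have "Cauchy (\<lambda>n. W n u r)"
    proof (rule CauchyI)
      fix e :: real assume "e > 0"
      then obtain N where "\<forall>n\<ge>N. \<forall>k\<ge>N. \<bar>W n u r - W k u r\<bar> \<le> e / 2"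
        using cauchy[of "e / 2"] u r by (meson half_gt_zero)
      then show "\<exists>M. \<forall>m\<ge>M. \<forall>n\<ge>M. norm (W m u r - W n u r) < e"
        using \<open>e > 0\<close> by (intro exI[of _ N]) force
    qed
    then show ?thesis unfolding w_def by (simp add: Cauchy_convergent_iff convergent_LIMSEQ_iff)
  qed
  show un: "unifbox U R W w"
    unfolding unifbox_def
  proof (intro allI impI)
    fix e :: real assume "e > 0"
    then obtain N where N: "\<forall>n\<ge>N. \<forall>k\<ge>N. \<forall>u\<in>{0..U}. \<forall>r\<in>{0..R}. \<bar>W n u r - W k u r\<bar> \<le> e"
      using cauchy by blast
    show "\<exists>N. \<forall>n\<ge>N. \<forall>u\<in>{0..U}. \<forall>r\<in>{0..R}. \<bar>W n u r - w u r\<bar> \<le> e"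
    proof (intro exI[of _ N] allI impI ballI)
      fix n u r assume n: "N \<le> n" and u: "u \<in> {0..U}" and r: "r \<in> {0..R}"
      have "(\<lambda>k. \<bar>W n u r - W k u r\<bar>) \<longlonglongrightarrow> \<bar>W n u r - w u r\<bar>" using conv[OF u r] by (intro tendsto_intros)
      then show "\<bar>W n u r - w u r\<bar> \<le> e" by (rule LIMSEQ_le_const2) (use N n u r in blast)
    qed
  qed
  show d: "derr U R g w"
    unfolding derr_def
  proof (intro ballI)
    fix u r assume u: "u \<in> {0..U}" and r: "r \<in> {0..R}"
    have "\<exists>f. \<forall>x\<in>{0..R}. (\<lambda>n. G n u x) \<longlonglongrightarrow> f x \<and> (f has_derivative (\<lambda>h. w u x * h)) (at x within {0..R})"
    proof (rule has_derivative_sequence[of "{0..R}" "\<lambda>n. G n u" "\<lambda>n x h. W n u x * h" "\<lambda>x h. w u x * h" r "g u r"])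
      show "(G n u has_derivative (\<lambda>h. W n u x * h)) (at x within {0..R})" if "x \<in> {0..R}" for n x
        using dG[of n] u that unfolding derr_def has_field_derivative_def by blast
      show "\<forall>\<^sub>F n in sequentially. \<forall>x\<in>{0..R}. \<forall>h. norm (W n u x * h - w u x * h) \<le> e * norm h" if "e > 0" for e
      proof -
        obtain N where N: "\<forall>n\<ge>N. \<forall>u\<in>{0..U}. \<forall>r\<in>{0..R}. \<bar>W n u r - w u r\<bar> \<le> e"
          using un \<open>e > 0\<close> unfolding unifbox_def by blast
        show ?thesis unfolding eventually_sequentially
        proof (intro exI[of _ N] allI impI ballI)
          fix n x h assume "N \<le> n" "x \<in> {0..R}"
          then have "\<bar>W n u x - w u x\<bar> \<le> e" using N u by blast
          then show "norm (W n u x * h - w u x * h) \<le> e * norm h"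
            by (simp add: abs_mult mult_right_mono flip: left_diff_distrib)
        qed
      qed
      show "(\<lambda>n. G n u r) \<longlonglongrightarrow> g u r" by (rule unifbox_tendsto[OF G u r])
    qed (use r in auto)
    then obtain f where "\<forall>x\<in>{0..R}. (\<lambda>n. G n u x) \<longlonglongrightarrow> f x \<and> (f has_real_derivative w u x) (at x within {0..R})"
      unfolding has_field_derivative_def by blast
    then have f: "\<And>x. x \<in> {0..R} \<Longrightarrow> (\<lambda>n. G n u x) \<longlonglongrightarrow> f x"
      "\<And>x. x \<in> {0..R} \<Longrightarrow> (f has_real_derivative w u x) (at x within {0..R})"
      by blast+
    have "f x = g u x" if "x \<in> {0..R}" for x
      using LIMSEQ_unique[OF f(1)[OF that] unifbox_tendsto[OF G u that]] .
    then show "(g u has_real_derivative w u r) (at r within {0..R})"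
      using has_field_derivative_transform_within[OF f(2)[OF r] zero_less_one r] by blast
  qed
  have wmod: "\<bar>w u r - w u r'\<bar> \<le> e"
    if e: "\<forall>n. \<forall>u\<in>{0..U}. \<forall>r\<in>{0..R}. \<forall>r'\<in>{0..R}. \<bar>r - r'\<bar> \<le> \<eta> \<longrightarrow> \<bar>W n u r - W n u r'\<bar> \<le> e"
      and *: "u \<in> {0..U}" "r \<in> {0..R}" "r' \<in> {0..R}" "\<bar>r - r'\<bar> \<le> \<eta>" for u r r' \<eta> e
  proof -
    have "(\<lambda>n. \<bar>W n u r - W n u r'\<bar>) \<longlonglongrightarrow> \<bar>w u r - w u r'\<bar>"
      using conv * by (intro tendsto_intros) auto
    then show ?thesis by (rule LIMSEQ_le_const2) (use e * in blast)
  qed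
  show "contbox U R w"
    unfolding contbox_def continuous_on_iff
  proof (intro ballI allI impI)
    fix p and e :: real assume p: "p \<in> {0..U} \<times> {0..R}" and e: "0 < e"
    obtain \<eta>' where eta': "\<eta>' > 0" "\<forall>n. \<forall>u\<in>{0..U}. \<forall>r\<in>{0..R}. \<forall>r'\<in>{0..R}. \<bar>r - r'\<bar> \<le> \<eta>' \<longrightarrow> \<bar>W n u r - W n u r'\<bar> \<le> e / 8"
      using equi[of "e / 8"] e by auto
    define \<eta> where "\<eta> = min \<eta>' (R / 2)"
    have eta: "0 < \<eta>" "\<eta> \<le> R / 2" "\<eta> \<le> \<eta>'" using eta' R by (auto simp: \<eta>_def)
    define \<delta> where "\<delta> = e * \<eta> / 8"
    have delta: "\<delta> > 0" using e eta by (simp add: \<delta>_def)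
    have "uniformly_continuous_on ({0..U} \<times> {0..R}) (\<lambda>p. g (fst p) (snd p))"
      using g unfolding contbox_def by (intro compact_uniformly_continuous compact_Times) auto
    then obtain d where d: "d > 0" "\<And>x x'. x \<in> {0..U} \<times> {0..R} \<Longrightarrow> x' \<in> {0..U} \<times> {0..R} \<Longrightarrow> dist x' x < d \<Longrightarrow>
       dist (g (fst x') (snd x')) (g (fst x) (snd x)) < \<delta>"
      using delta unfolding uniformly_continuous_on_def by blast
    show "\<exists>d>0. \<forall>x'\<in>{0..U} \<times> {0..R}. dist x' p < d \<longrightarrow> dist (w (fst x') (snd x')) (w (fst p) (snd p)) < e"
    proof (intro exI[of _ "min d \<eta>"] conjI ballI impI)
      fix x' assume x': "x' \<in> {0..U} \<times> {0..R}" "dist x' p < min d \<eta>"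
      obtain u r u' r' where ur: "p = (u, r)" "x' = (u', r')" by (cases p, cases x')
      have mem: "u \<in> {0..U}" "r \<in> {0..R}" "u' \<in> {0..U}" "r' \<in> {0..R}" using p x' ur by auto
      have du: "\<bar>u' - u\<bar> < d" "\<bar>r - r'\<bar> \<le> \<eta>"
        using x'(2) dist_fst_le[of x' p] dist_snd_le[of x' p] ur by (auto simp: dist_real_def)
      have "\<bar>w u' r' - w u r'\<bar> \<le> 2 * (e / 8) + 2 * \<delta> / \<eta>"
      proof (rule deriv_interpolation[OF _ _ _ _ _ eta(1,2) mem(4)])
        fix s assume s: "s \<in> {0..R}"
        show "(g u' has_real_derivative w u' s) (at s within {0..R})" "(g u has_real_derivative w u s) (at s within {0..R})"
          using d mem s \<open>derr U R g w\<close> unfolding derr_def by blast+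
        have "dist (u', s) (u, s) < d" using du by (simp add: dist_Pair_Pair dist_real_def)
        then show "\<bar>g u' s - g u s\<bar> \<le> \<delta>" using d(2)[of "(u, s)" "(u', s)"] mem s by (auto simp: dist_real_def)
      next
        fix s s' assume "s \<in> {0..R}" "s' \<in> {0..R}" "\<bar>s - s'\<bar> \<le> \<eta>"
        then show "\<bar>w u' s - w u' s'\<bar> \<le> e / 8" "\<bar>w u s - w u s'\<bar> \<le> e / 8"
          using wmod[OF eta'(2)] mem eta(3) by auto
      qed
      also have "2 * (e / 8) + 2 * \<delta> / \<eta> = e / 2" using eta by (simp add: \<delta>_def field_simps)
      finally have 1: "\<bar>w u' r' - w u r'\<bar> \<le> e / 2" .
      have 2: "\<bar>w u r - w u r'\<bar> \<le> e / 8" using wmod[OF eta'(2)] mem du(2) eta(3) by auto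
      have "\<bar>w u' r' - w u r\<bar> < e" using 1 2 e by linarith
      then show "dist (w (fst x') (snd x')) (w (fst p) (snd p)) < e" using ur by (simp add: dist_real_def)
    qed (use d eta in auto)
  qed
qed

section \<open>Euler polygons and their compactness\<close>

context bondi_run begin

primrec node :: "real \<Rightarrow> nat \<Rightarrow> (real \<Rightarrow> real) \<times> (nat \<Rightarrow> real \<Rightarrow> real)" where
  "node \<tau> 0 = (h0, v0)"
| "node \<tau> (Suc n) = (step_h \<tau> (fst (node \<tau> n)) (snd (node \<tau> n)), step_jet \<tau> (snd (node \<tau> n)))"

definition node_index :: "real \<Rightarrow> real \<Rightarrow> nat" where "node_index \<tau> u = nat \<lfloor>u / \<tau>\<rfloor>"

text \<open>Between nodes a shortened step replaces linear interpolation, so that every value is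
  again in \<open>reach\<close> and inherits its estimates.\<close>

definition polygon :: "real \<Rightarrow> real \<Rightarrow> real \<Rightarrow> real" where
  "polygon \<tau> u = step_h (u - real (node_index \<tau> u) * \<tau>) (fst (node \<tau> (node_index \<tau> u))) (snd (node \<tau> (node_index \<tau> u)))"

definition polygon_jet :: "real \<Rightarrow> real \<Rightarrow> nat \<Rightarrow> real \<Rightarrow> real" where
  "polygon_jet \<tau> u = step_jet (u - real (node_index \<tau> u) * \<tau>) (snd (node \<tau> (node_index \<tau> u)))"

definition LH :: real where "LH = B * CA + CT"

lemma LH_nonneg: "LH \<ge> 0" using B_pos CA_nonneg CT_nonneg by (simp add: LH_def)

lemma jet_Lipschitz:
  assumes "jet m h v" "small (v 0)" "r \<in> {0..R}" "r' \<in> {0..R}"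
  shows "\<bar>h r - h r'\<bar> \<le> B * \<bar>r - r'\<bar>"
  by (rule Icc_Lipschitz[of 0 R h "v 0"]) (use assms in \<open>auto simp: jet_def small_def\<close>)

lemma step_h_Lipschitz:
  assumes j: "jet m h v" and w: "small (v 0)" and s: "0 \<le> s" "s \<le> max_step" "0 \<le> s'" "s' \<le> max_step" and r: "r \<in> {0..R}"
  shows "\<bar>step_h s h v r - step_h s' h v r\<bar> \<le> LH * \<bar>s - s'\<bar>"
proof -
  have "\<bar>h (foot s (v 0) r) - h (foot s' (v 0) r)\<bar> \<le> B * \<bar>foot s (v 0) r - foot s' (v 0) r\<bar>"
    by (rule jet_Lipschitz[OF j w foot_mem[OF w s(1,2) r] foot_mem[OF w s(3,4) r]])
  also have "foot s (v 0) r - foot s' (v 0) r = (s - s') * aa (v 0) r" by (simp add: foot_def algebra_simps)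
  also have "B * \<bar>(s - s') * aa (v 0) r\<bar> \<le> B * (\<bar>s - s'\<bar> * CA)"
    unfolding abs_mult using aa_bound[OF w r] B_pos by (intro mult_left_mono) auto
  finally have 1: "\<bar>h (foot s (v 0) r) - h (foot s' (v 0) r)\<bar> \<le> B * (\<bar>s - s'\<bar> * CA)" .
  have 2: "\<bar>(s - s') * TT (v 0) r\<bar> \<le> \<bar>s - s'\<bar> * CT"
    unfolding abs_mult using TT_bound[OF w r] by (intro mult_left_mono) auto
  have "step_h s h v r - step_h s' h v r = (h (foot s (v 0) r) - h (foot s' (v 0) r)) + (s - s') * TT (v 0) r"
    by (simp add: step_h_def algebra_simps)
  then have "\<bar>step_h s h v r - step_h s' h v r\<bar> \<le> B * (\<bar>s - s'\<bar> * CA) + \<bar>s - s'\<bar> * CT"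
    using 1 2 by linarith
  then show ?thesis by (simp add: LH_def algebra_simps)
qed

context
  fixes \<tau> :: real
  assumes tau: "0 < \<tau>" "\<tau> \<le> max_step"
begin

lemma node_reach: "reach h0 v0 (real n * \<tau>) (fst (node \<tau> n)) (snd (node \<tau> n))"
proof (induction n)
  case 0 show ?case using reach_init by simp
next
  case (Suc n)
  from reach_step[OF Suc, of \<tau>] tau show ?case by (simp add: algebra_simps)
qed

lemma node_index_bounds:
  assumes "0 \<le> u"
  shows "real (node_index \<tau> u) * \<tau> \<le> u" "u < (real (node_index \<tau> u) + 1) * \<tau>"
proof -
  have "real (node_index \<tau> u) = of_int \<lfloor>u / \<tau>\<rfloor>" using assms tau by (simp add: node_index_def)
  then have "real (node_index \<tau> u) \<le> u / \<tau>" "u / \<tau> < real (node_index \<tau> u) + 1" by linarith+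
  then show "real (node_index \<tau> u) * \<tau> \<le> u" "u < (real (node_index \<tau> u) + 1) * \<tau>" using tau by (auto simp: field_simps)
qed

lemma node_index_node: "node_index \<tau> (real n * \<tau>) = n"
  using tau by (simp add: node_index_def)

lemma polygon_node: "polygon \<tau> (real n * \<tau>) = fst (node \<tau> n)" and polygon_jet_node: "polygon_jet \<tau> (real n * \<tau>) = snd (node \<tau> n)"
  by (simp_all add: polygon_def polygon_jet_def node_index_node step_h_0 step_jet_0)

lemma polygon_0: "polygon \<tau> 0 = h0" using polygon_node[of 0] by simp

lemma polygon_reach:
  assumes "0 \<le> u"
  shows "reach h0 v0 u (polygon \<tau> u) (polygon_jet \<tau> u)"
  using reach_step[OF node_reach, of "u - real (node_index \<tau> u) * \<tau>" "node_index \<tau> u"] node_index_bounds[OF assms] tau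
  by (simp add: polygon_def polygon_jet_def algebra_simps)

lemma node_basic:
  assumes "real n * \<tau> \<le> U0"
  shows "jet m (fst (node \<tau> n)) (snd (node \<tau> n))" "small (snd (node \<tau> n) 0)"
  using reach_basic[OF node_reach assms] by auto

lemma polygon_basic:
  assumes "0 \<le> u" "u \<le> U0"
  shows "jet m (polygon \<tau> u) (polygon_jet \<tau> u)" "small (polygon_jet \<tau> u 0)" "r \<in> {0..R} \<Longrightarrow> \<bar>polygon_jet \<tau> u 0 r\<bar> \<le> 2 * M0"
proof -
  show "jet m (polygon \<tau> u) (polygon_jet \<tau> u)" "small (polygon_jet \<tau> u 0)" using reach_basic[OF polygon_reach] assms by auto
  assume "r \<in> {0..R}"
  then have "\<bar>polygon_jet \<tau> u 0 r\<bar> \<le> exp (C0 * u) * M0" using reach_basic[OF polygon_reach] assms by auto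
  also have "\<dots> \<le> exp (C0 * U0) * M0" using assms C0(1) M0_nonneg by (intro mult_right_mono) auto
  finally show "\<bar>polygon_jet \<tau> u 0 r\<bar> \<le> 2 * M0" using U0(2) by simp
qed

lemma node_Lipschitz:
  "real (n + p) * \<tau> \<le> U0 \<Longrightarrow> r \<in> {0..R} \<Longrightarrow> \<bar>fst (node \<tau> (n + p)) r - fst (node \<tau> n) r\<bar> \<le> LH * (real p * \<tau>)"
proof (induction p)
  case (Suc p)
  have le: "real (n + p) * \<tau> \<le> U0" using Suc.prems(1) tau by (simp add: algebra_simps)
  have "\<bar>step_h \<tau> (fst (node \<tau> (n + p))) (snd (node \<tau> (n + p))) r - step_h 0 (fst (node \<tau> (n + p))) (snd (node \<tau> (n + p))) r\<bar> \<le> LH * \<bar>\<tau> - 0\<bar>"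
    using tau by (intro step_h_Lipschitz node_basic[OF le] Suc.prems) auto
  with Suc.IH[OF le Suc.prems(2)] tau show ?case by (simp add: step_h_0 algebra_simps)
qed auto

lemma polygon_Lipschitz_u:
  assumes u: "0 \<le> u" "u \<le> u'" "u' \<le> U0" and r: "r \<in> {0..R}"
  shows "\<bar>polygon \<tau> u' r - polygon \<tau> u r\<bar> \<le> LH * (u' - u)"
proof -
  define n where "n = node_index \<tau> u"
  define n' where "n' = node_index \<tau> u'"
  have b: "real n * \<tau> \<le> u" "u < (real n + 1) * \<tau>" "real n' * \<tau> \<le> u'" "u' < (real n' + 1) * \<tau>"
    using node_index_bounds u by (auto simp: n_def n'_def)
  have H: "polygon \<tau> u = step_h (u - real n * \<tau>) (fst (node \<tau> n)) (snd (node \<tau> n))"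
    "polygon \<tau> u' = step_h (u' - real n' * \<tau>) (fst (node \<tau> n')) (snd (node \<tau> n'))"
    by (simp_all add: polygon_def n_def n'_def)
  have "real n * \<tau> < (real n' + 1) * \<tau>" using b u by linarith
  then have nn': "n \<le> n'" using tau by simp
  show ?thesis
  proof (cases "n = n'")
    case True
    have "\<bar>step_h (u' - real n * \<tau>) (fst (node \<tau> n)) (snd (node \<tau> n)) r - step_h (u - real n * \<tau>) (fst (node \<tau> n)) (snd (node \<tau> n)) r\<bar>
      \<le> LH * \<bar>(u' - real n * \<tau>) - (u - real n * \<tau>)\<bar>"
      by (intro step_h_Lipschitz node_basic r) (use b u tau True in \<open>auto simp: algebra_simps\<close>)
    then show ?thesis using u True by (simp add: H)
  next
    case False
    \<comment> \<open>The interval splits into the rest of the step containing u, p whole steps, and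
      the beginning of the step containing u'.\<close>
    then obtain p where p: "n' = Suc n + p" using nn' by (metis less_iff_Suc_add add_Suc le_neq_implies_less)
    have "real n \<le> real n'" using nn' by simp
    then have nt: "real n * \<tau> \<le> U0" using b u by linarith
    have n't: "real n' * \<tau> \<le> U0" using b u by linarith
    have "\<bar>step_h \<tau> (fst (node \<tau> n)) (snd (node \<tau> n)) r - step_h (u - real n * \<tau>) (fst (node \<tau> n)) (snd (node \<tau> n)) r\<bar>
      \<le> LH * \<bar>\<tau> - (u - real n * \<tau>)\<bar>"
      by (intro step_h_Lipschitz node_basic[OF nt] r) (use b u tau in \<open>auto simp: algebra_simps\<close>)
    then have 1: "\<bar>fst (node \<tau> (Suc n)) r - polygon \<tau> u r\<bar> \<le> LH * (\<tau> - (u - real n * \<tau>))"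
      using b by (simp add: H algebra_simps)
    have 2: "\<bar>fst (node \<tau> n') r - fst (node \<tau> (Suc n)) r\<bar> \<le> LH * (real p * \<tau>)"
      unfolding p by (rule node_Lipschitz[OF _ r]) (use n't p in simp)
    have "\<bar>step_h (u' - real n' * \<tau>) (fst (node \<tau> n')) (snd (node \<tau> n')) r - step_h 0 (fst (node \<tau> n')) (snd (node \<tau> n')) r\<bar>
      \<le> LH * \<bar>(u' - real n' * \<tau>) - 0\<bar>"
      by (intro step_h_Lipschitz node_basic[OF n't] r) (use b u tau in \<open>auto simp: algebra_simps\<close>)
    then have 3: "\<bar>polygon \<tau> u' r - fst (node \<tau> n') r\<bar> \<le> LH * (u' - real n' * \<tau>)"
      using b by (simp add: H step_h_0)
    have "\<bar>polygon \<tau> u' r - polygon \<tau> u r\<bar> \<le> LH * (\<tau> - (u - real n * \<tau>)) + LH * (real p * \<tau>) + LH * (u' - real n' * \<tau>)"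
      using 1 2 3 by linarith
    also have "\<dots> = LH * (u' - u)" unfolding p by (simp add: algebra_simps)
    finally show ?thesis .
  qed
qed

lemma polygon_Lipschitz:
  assumes "u \<in> {0..U0}" "u' \<in> {0..U0}" "r \<in> {0..R}" "r' \<in> {0..R}"
  shows "\<bar>polygon \<tau> u r - polygon \<tau> u' r'\<bar> \<le> LH * \<bar>u - u'\<bar> + B * \<bar>r - r'\<bar>"
proof -
  have "\<bar>polygon \<tau> u r - polygon \<tau> u' r\<bar> \<le> LH * \<bar>u - u'\<bar>"
    using polygon_Lipschitz_u[of u u' r] polygon_Lipschitz_u[of u' u r] assms by (cases "u \<le> u'") (auto simp: abs_minus_commute)
  moreover have "\<bar>polygon \<tau> u' r - polygon \<tau> u' r'\<bar> \<le> B * \<bar>r - r'\<bar>"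
    using polygon_basic[of u'] assms by (intro jet_Lipschitz) auto
  ultimately show ?thesis by linarith
qed

end

text \<open>Compactness is invoked for h alone, since the polygons are Lipschitz in (u, r) jointly
  whereas the jet estimates give equicontinuity in r only. The jets then converge one after the
  other along the same subsequence.\<close>

lemma limit_exists:
  obtains h v ts where "\<And>n::nat. 0 < ts n" "\<And>n. ts n \<le> max_step" "ts \<longlonglongrightarrow> 0"
    "unifbox U0 R (\<lambda>n. polygon (ts n)) h" "contbox U0 R h" "derr U0 R h (v 0)"
    "unifbox U0 R (\<lambda>n u. polygon_jet (ts n) u 0) (v 0)"
    "\<And>i. i < m \<Longrightarrow> derr U0 R (v i) (v (Suc i))" "\<And>i. i \<le> m \<Longrightarrow> contbox U0 R (v i)"
proof -
  define S where "S = {0..U0} \<times> {0..R}"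
  define t where "t n = max_step / (real n + 1)" for n :: nat
  have t: "0 < t n" "t n \<le> max_step" for n using max_step(1) by (auto simp: t_def field_simps)
  define F where "F n p = polygon (t n) (fst p) (snd p)" for n and p :: "real \<times> real"
  have "continuous_on {0..R} h0" using jet0 unfolding jet_def by (meson DERIV_continuous_on)
  then have "bounded (h0 ` {0..R})" by (intro compact_imp_bounded compact_continuous_image compact_Icc)
  then obtain K where K: "\<And>r. r \<in> {0..R} \<Longrightarrow> \<bar>h0 r\<bar> \<le> K" unfolding bounded_iff by (metis imageI real_norm_def)
  have bound: "norm (F n x) \<le> K + LH * U0" if "x \<in> S" for n x
  proof -
    obtain u r where x: "x = (u, r)" "u \<in> {0..U0}" "r \<in> {0..R}" using \<open>x \<in> S\<close> by (auto simp: S_def)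
    have "\<bar>polygon (t n) u r - polygon (t n) 0 r\<bar> \<le> LH * (u - 0)"
      using polygon_Lipschitz_u[OF t, of 0 u r n] x by auto
    moreover have "LH * (u - 0) \<le> LH * U0" using x LH_nonneg by (intro mult_left_mono) auto
    ultimately show ?thesis using K[OF x(3)] polygon_0[OF t] x by (simp add: F_def)
  qed
  have equi: "\<exists>d. 0 < d \<and> (\<forall>n y. y \<in> S \<and> norm (x - y) < d \<longrightarrow> norm (F n x - F n y) < e)" if x: "x \<in> S" and e: "0 < e" for x e
  proof (intro exI[of _ "e / (LH + B)"] conjI allI impI; (elim conjE)?)
    have LB: "LH + B > 0" using LH_nonneg B_pos by simp
    then show "0 < e / (LH + B)" using e by simp
    fix n y assume y: "y \<in> S" "norm (x - y) < e / (LH + B)"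
    have "\<bar>F n x - F n y\<bar> \<le> LH * \<bar>fst x - fst y\<bar> + B * \<bar>snd x - snd y\<bar>"
      unfolding F_def by (rule polygon_Lipschitz[OF t]) (use x y in \<open>auto simp: S_def\<close>)
    also have "\<dots> \<le> LH * norm (x - y) + B * norm (x - y)"
      using LH_nonneg B_pos dist_fst_le[of x y] dist_snd_le[of x y]
      by (intro add_mono mult_left_mono) (auto simp: dist_norm)
    also have "\<dots> = (LH + B) * norm (x - y)" by (simp add: algebra_simps)
    also have "\<dots> < e" using y(2) LB by (simp add: field_simps)
    finally show "norm (F n x - F n y) < e" by simp
  qed
  have "compact S" by (simp add: S_def compact_Times)
  obtain g k where g: "continuous_on S g" "strict_mono (k :: nat \<Rightarrow> nat)"
    "\<And>e. 0 < e \<Longrightarrow> \<exists>N. \<forall>n x. n \<ge> N \<and> x \<in> S \<longrightarrow> norm (F (k n) x - g x) < e"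
    using Arzela_Ascoli[OF \<open>compact S\<close> bound equi] by blast
  define h where "h u r = g (u, r)" for u r
  define ts where "ts n = t (k n)" for n
  have ts: "0 < ts n" "ts n \<le> max_step" for n using t by (auto simp: ts_def)
  have "t \<longlonglongrightarrow> 0" unfolding t_def by real_asymp
  then have ts0: "ts \<longlonglongrightarrow> 0" unfolding ts_def using LIMSEQ_subseq_LIMSEQ[OF _ g(2), of t] by (simp add: o_def)
  have uh: "unifbox U0 R (\<lambda>n. polygon (ts n)) h"
    unfolding unifbox_def
  proof (intro allI impI)
    fix e :: real assume "e > 0"
    then obtain N where N: "\<forall>n x. n \<ge> N \<and> x \<in> S \<longrightarrow> norm (F (k n) x - g x) < e" using g(3) by blast
    show "\<exists>N. \<forall>n\<ge>N. \<forall>u\<in>{0..U0}. \<forall>r\<in>{0..R}. \<bar>polygon (ts n) u r - h u r\<bar> \<le> e"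
    proof (intro exI[of _ N] allI impI ballI)
      fix n u r assume "N \<le> n" "u \<in> {0..U0}" "r \<in> {0..R}"
      then have "norm (F (k n) (u, r) - g (u, r)) < e" using N by (auto simp: S_def)
      then show "\<bar>polygon (ts n) u r - h u r\<bar> \<le> e" by (simp add: F_def h_def ts_def)
    qed
  qed
  have ch: "contbox U0 R h" using g(1) by (simp add: contbox_def h_def S_def)
  define v where "v i u r = lim (\<lambda>n. polygon_jet (ts n) u i r)" for i u r
  have equiV: "\<exists>\<eta>>0. \<forall>n. \<forall>u\<in>{0..U0}. \<forall>r\<in>{0..R}. \<forall>r'\<in>{0..R}. \<bar>r - r'\<bar> \<le> \<eta> \<longrightarrow> \<bar>polygon_jet (ts n) u i r - polygon_jet (ts n) u i r'\<bar> \<le> e"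
    if "i \<le> m" "e > 0" for i e
  proof -
    obtain \<eta> where eta: "\<eta> > 0" "\<forall>u h v. reach h0 v0 u h v \<longrightarrow> u \<le> U0 \<longrightarrow> jets_modulus m \<eta> e v"
      using reach_equicont[OF \<open>e > 0\<close>] by blast
    have "jets_modulus m \<eta> e (polygon_jet (ts n) u)" if "u \<in> {0..U0}" for n u
      using eta(2) polygon_reach[OF ts, of u n] that by auto
    then show ?thesis using eta(1) \<open>i \<le> m\<close> unfolding jets_modulus_def by blast
  qed
  have jets: "jet m (polygon (ts n) u) (polygon_jet (ts n) u)" if "u \<in> {0..U0}" for n u
    using polygon_basic(1)[OF ts] that by auto
  have base: "unifbox U0 R (\<lambda>n u. polygon_jet (ts n) u 0) (v 0)" "derr U0 R h (v 0)" "contbox U0 R (v 0)"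
    using unifbox_deriv[where W = "\<lambda>n u. polygon_jet (ts n) u 0", OF R_pos _ equiV[of 0] uh ch] jets
    unfolding v_def[abs_def] derr_def jet_def by auto
  have all: "i \<le> m \<Longrightarrow> unifbox U0 R (\<lambda>n u. polygon_jet (ts n) u i) (v i) \<and> contbox U0 R (v i) \<and> (i \<noteq> 0 \<longrightarrow> derr U0 R (v (i - 1)) (v i))" for i
  proof (induction i)
    case 0 then show ?case using base by auto
  next
    case (Suc i)
    then have IH: "unifbox U0 R (\<lambda>n u. polygon_jet (ts n) u i) (v i)" "contbox U0 R (v i)" by auto
    have d: "derr U0 R (\<lambda>u. polygon_jet (ts n) u i) (\<lambda>u. polygon_jet (ts n) u (Suc i))" for n
      using jets Suc.prems unfolding derr_def jet_def by auto
    from unifbox_deriv[OF R_pos d equiV[OF Suc.prems] IH] show ?case unfolding v_def[abs_def] by auto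
  qed
  show ?thesis
  proof (rule that[of ts h v, OF ts ts0 uh ch base(2,1)])
    fix i assume "i < m"
    then show "derr U0 R (v i) (v (Suc i))" using all[of "Suc i"] by auto
  next
    fix i assume "i \<le> m"
    then show "contbox U0 R (v i)" using all by auto
  qed
qed

end

section \<open>The evolution problem\<close>

text \<open>Exchange of the partial derivatives when w is not known to be differentiable in u: g is
  written as an integral of F in u, differentiated in r under the integral, and the resulting
  formula for w is differentiated in u.\<close>

lemma deru_mixed:
  assumes R: "R > 0" and g: "derr U R g w" "deru U R g F" and F: "derr U R F Fr" "contbox U R F" "contbox U R Fr"
  shows "deru U R w Fr"
  unfolding deru_def
proof (intro ballI)
  fix u r assume u: "u \<in> {0..U}" and r: "r \<in> {0..R}"
  have FTC: "integral {0..v} (\<lambda>s. F s x) = g v x - g 0 x" if v: "v \<in> {0..U}" and x: "x \<in> {0..R}" for v x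
  proof (rule integral_unique, rule fundamental_theorem_of_calculus)
    fix s assume s: "s \<in> {0..v}"
    have "((\<lambda>v. g v x) has_real_derivative F s x) (at s within {0..U})"
      using g(2) s v x by (auto simp: deru_def)
    then show "((\<lambda>v. g v x) has_vector_derivative F s x) (at s within {0..v})"
      unfolding has_real_derivative_iff_has_vector_derivative[symmetric]
      by (rule has_field_derivative_subset) (use v in auto)
  qed (use v in auto)
  have w: "w v r = w 0 r + integral {0..v} (\<lambda>s. Fr s r)" if v: "v \<in> {0..U}" for v
  proof -
    have 0: "(0::real) \<in> {0..U}" using v by auto
    have "((\<lambda>x. integral (cbox 0 v) (\<lambda>s. F s x)) has_real_derivative integral (cbox 0 v) (\<lambda>s. Fr s r)) (at r within {0..R})"
    proof (rule leibniz_rule_field_derivative)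
      fix x s assume "x \<in> {0..R}" "s \<in> cbox 0 v"
      then show "((\<lambda>x. F s x) has_real_derivative Fr s x) (at x within {0..R})"
        using F(1) v unfolding derr_def by auto
    next
      show "(\<lambda>s. F s x) integrable_on cbox 0 v" if "x \<in> {0..R}" for x
        using continuous_on_subset[OF contbox_u[OF F(2) that], of "{0..v}"] v
        by (auto intro!: integrable_continuous_real)
      have "continuous_on ({0..R} \<times> cbox 0 v) (\<lambda>z. Fr (snd z) (fst z))"
      proof -
        have "continuous_on ({0..R} \<times> cbox 0 v) (\<lambda>z. (snd z, fst z))" by (intro continuous_intros)
        moreover have "(\<lambda>z. (snd z, fst z)) ` ({0..R} \<times> cbox 0 v) \<subseteq> {0..U} \<times> {0..R}" using v by auto
        ultimately show ?thesis using continuous_on_compose2[OF F(3)[unfolded contbox_def]] by fastforce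
      qed
      then show "continuous_on ({0..R} \<times> cbox 0 v) (\<lambda>(x, s). Fr s x)" by (simp add: split_beta)
    qed (use r in auto)
    then have "((\<lambda>x. integral {0..v} (\<lambda>s. F s x)) has_real_derivative integral {0..v} (\<lambda>s. Fr s r)) (at r within {0..R})"
      by simp
    then have "((\<lambda>x. g v x - g 0 x) has_real_derivative integral {0..v} (\<lambda>s. Fr s r)) (at r within {0..R})"
      by (rule has_field_derivative_transform_within[OF _ zero_less_one r]) (rule FTC[OF v])
    moreover have "((\<lambda>x. g v x - g 0 x) has_real_derivative w v r - w 0 r) (at r within {0..R})"
      using g(1) v 0 r by (auto simp: derr_def intro!: derivative_eq_intros)
    ultimately have "integral {0..v} (\<lambda>s. Fr s r) = w v r - w 0 r" using R r by (rule DERIV_Icc_unique)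
    then show ?thesis by simp
  qed
  have "((\<lambda>v. w 0 r + integral {0..v} (\<lambda>s. Fr s r)) has_real_derivative Fr u r) (at u within {0..U})"
    using integral_has_real_derivative[OF contbox_u[OF F(3) r] u] by (auto intro!: derivative_eq_intros)
  then show "((\<lambda>v. w v r) has_real_derivative Fr u r) (at u within {0..U})"
    by (rule has_field_derivative_transform_within[OF _ zero_less_one u]) (rule w[symmetric])
qed

text \<open>By \<open>deru_mixed\<close> the u-derivative of the r-derivative of g is the
  r-derivative of F, so the induction passes from the pair (g, F) to the pair of their
  r-derivatives.\<close>

lemma mixed_Ck_gain:
  assumes R: "R > 0"
  shows "mixed_Ck U R a m g \<Longrightarrow> deru U R g F \<Longrightarrow> (\<And>m'. m = Suc m' \<Longrightarrow> mixed_Ck U R a m' F) \<Longrightarrow> mixed_Ck U R (Suc a) m g"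
proof (induction m arbitrary: g F)
  case (Suc m)
  then obtain g' where g': "contbox U R g" "derr U R g g'" "mixed_Ck U R a m g'" by auto
  have F: "mixed_Ck U R a m F" using Suc.prems(3) by simp
  have "mixed_Ck U R (Suc a) m g'"
  proof (cases m)
    case 0 then show ?thesis using g' by simp
  next
    case (Suc m')
    then obtain Fr where Fr: "derr U R F Fr" "mixed_Ck U R a m' Fr" using F by auto
    have "deru U R g' Fr"
      by (rule deru_mixed[OF R g'(2) Suc.prems(2) Fr(1)]) (use F Fr mixed_Ck_contbox in auto)
    then show ?thesis using Suc.IH[OF g'(3)] Fr Suc by blast
  qed
  then show ?case using g' Suc.prems(2) F by auto
qed auto

context bondi begin

definition rhs :: "(real \<Rightarrow> real \<Rightarrow> real) \<Rightarrow> real \<Rightarrow> real \<Rightarrow> real" where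
  "rhs w u r = w u r * aa (w u) r + TT (w u) r"

lemma mixed_Ck_rhs: "mixed_Ck U R a m w \<Longrightarrow> mixed_Ck U R a m (rhs w)"
  unfolding rhs_def[abs_def] by (intro mixed_Ck_add mixed_Ck_mult mixed_Ck_aa mixed_Ck_TT)

text \<open>The total order stays fixed. Class a for h gives class a for w at one order less, hence
  for \<open>rhs w\<close>, which is the u-derivative of h; this raises a by one.\<close>

lemma mixed_Ck_bootstrap:
  assumes h: "derr U R h w" "deru U R h (rhs w)"
  shows "mixed_Ck U R 0 (Suc m) h \<Longrightarrow> mixed_Ck U R a (Suc m) h"
proof (induction a)
  case (Suc a)
  then have IH: "mixed_Ck U R a (Suc m) h" by simp
  then obtain g where g: "derr U R h g" "mixed_Ck U R a m g" by auto
  have "g u r = w u r" if "u \<in> {0..U}" "r \<in> {0..R}" for u r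
    using g(1) h(1) R_pos that by (intro DERIV_Icc_unique[of "h u" _ r 0 R]) (auto simp: derr_def)
  then have "mixed_Ck U R a m w" using mixed_Ck_cong g(2) by blast
  then show ?case by (intro mixed_Ck_gain[OF R_pos IH h(2)] mixed_Ck_rhs) auto
qed auto

text \<open>w and hu are left general so that the lemma serves both the constructed solution and an
  arbitrary competitor with its \<open>pr\<close> and \<open>pu\<close>.\<close>

lemma is_solution_iff:
  assumes U: "U > 0" and h: "derr U R h w" "deru U R h hu" "contbox U R w"
  shows "is_solution \<kappa> \<Lambda> U R h0 h \<longleftrightarrow> (\<forall>r\<in>{0..R}. h 0 r = h0 r) \<and> (\<forall>u\<in>{0..U}. \<forall>r\<in>{0..R}. hu u r = rhs w u r)"
proof -
  have "pr R h u r = w u r \<and> pu U h u r = hu u r \<and> ftil \<kappa> \<Lambda> h u r = 2 * aa (w u) r \<and>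
      Gfun \<kappa> \<Lambda> h u r * (h u r - ravg (h u) r) = TT (w u) r" if u: "u \<in> {0..U}" and r: "r \<in> {0..R}" for u r
  proof -
    have c: "continuous_on {0..R} (w u)" by (rule contbox_r[OF h(3) u])
    have d: "\<And>r. r \<in> {0..R} \<Longrightarrow> (h u has_real_derivative w u r) (at r within {0..R})" using h(1) u by (auto simp: derr_def)
    have "pr R h u r = w u r"
      using d[OF r] R_pos r unfolding pr_def has_real_derivative_iff_has_vector_derivative
      by (intro vector_derivative_within_cbox[of 0 R, unfolded cbox_interval]) auto
    moreover have "pu U h u r = hu u r"
      using h(2) U u r unfolding deru_def pu_def has_real_derivative_iff_has_vector_derivative
      by (intro vector_derivative_within_cbox[of 0 U, unfolded cbox_interval]) auto
    ultimately show ?thesis using ftil_eq[where H = h and u = u, OF c d r] source_eq[where H = h and u = u, OF c d r] by simp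
  qed
  then have "(pu U h u r - ftil \<kappa> \<Lambda> h u r / 2 * pr R h u r = Gfun \<kappa> \<Lambda> h u r * (h u r - ravg (h u) r)) \<longleftrightarrow> hu u r = rhs w u r"
    if "u \<in> {0..U}" "r \<in> {0..R}" for u r using that by (auto simp: rhs_def algebra_simps)
  then show ?thesis unfolding is_solution_def by auto
qed

end

section \<open>Uniqueness and conservation of the sup norm\<close>

context bondi_small begin

text \<open>The roles are asymmetric: the difference is transported by the coefficient of h1, so
  smallness is asked of h1 only. For h2, boundedness of w2 on the compact box suffices, and
  uniqueness covers competitors that are not small.\<close>

lemma uniqueness:
  assumes U: "U > 0"
    and h1: "contbox U R h1" "derr U R h1 w1" "deru U R h1 (rhs w1)" "contbox U R w1" "\<And>u. u \<in> {0..U} \<Longrightarrow> small (w1 u)"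
    and h2: "contbox U R h2" "derr U R h2 w2" "deru U R h2 (rhs w2)" "contbox U R w2"
    and init: "\<And>r. r \<in> {0..R} \<Longrightarrow> h1 0 r = h2 0 r"
    and ur: "u \<in> {0..U}" "r \<in> {0..R}"
  shows "h1 u r = h2 u r"
proof -
  have "bounded ((\<lambda>p. w2 (fst p) (snd p)) ` ({0..U} \<times> {0..R}))"
    using h2(4) unfolding contbox_def by (intro compact_imp_bounded compact_continuous_image compact_Times) auto
  then obtain M' where M': "\<And>u r. u \<in> {0..U} \<Longrightarrow> r \<in> {0..R} \<Longrightarrow> \<bar>w2 u r\<bar> \<le> M'" unfolding bounded_iff by force
  define M where "M = max B M'"
  have M: "\<bar>w1 u r\<bar> \<le> M" "\<bar>w2 u r\<bar> \<le> M" if "u \<in> {0..U}" "r \<in> {0..R}" for u r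
    using M'[OF that] h1(5)[OF that(1)] that by (auto simp: M_def small_def le_max_iff_disj)
  have M0: "M \<ge> 0" using B_pos by (simp add: M_def)
  obtain C where C: "C \<ge> 0" and Lip:
    "\<And>h1 w1 h2 w2 e r. C1_bounded M h1 w1 \<Longrightarrow> C1_bounded M h2 w2 \<Longrightarrow>
      (\<And>r. r \<in> {0..R} \<Longrightarrow> \<bar>h1 r - h2 r\<bar> \<le> e) \<Longrightarrow> r \<in> {0..R} \<Longrightarrow>
      \<bar>aa w1 r - aa w2 r\<bar> \<le> C * e \<and> \<bar>TT w1 r - TT w2 r\<bar> \<le> C * e"
    using functional_Lipschitz[OF M0] by blast
  define z where "z u r = (h1 u r - h2 u r)\<^sup>2" for u r
  define D where "D = 2 * (M * C + C)"
  have "z u r \<le> exp ((D + 1) * u) * 0"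
  proof (rule transport_maximum_principle[OF U R_pos _ _ _ _ _ _ _ _ _ ur, where a = "\<lambda>u. aa (w1 u)" and C = D])
    show "contbox U R z" using h1(1) h2(1) unfolding contbox_def z_def by (intro continuous_intros)
    show "derr U R z (\<lambda>u r. 2 * (h1 u r - h2 u r) * (w1 u r - w2 u r))"
      using h1(2) h2(2) unfolding derr_def z_def[abs_def] by (auto intro!: derivative_eq_intros)
    show "deru U R z (\<lambda>u r. 2 * (h1 u r - h2 u r) * (rhs w1 u r - rhs w2 u r))"
      using h1(3) h2(3) unfolding deru_def z_def[abs_def] by (auto intro!: derivative_eq_intros)
    show "0 \<le> aa (w1 u) 0" "aa (w1 u) R \<le> 0" if "u \<in> {0..U}" for u
      using aa_0[of "w1 u"] small_aa_R[OF h1(5)[OF that]] h1(5)[OF that] by (auto simp: small_def)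
    show "z 0 r \<le> 0" if "r \<in> {0..R}" for r using init[OF that] by (simp add: z_def)
    fix u r assume u: "u \<in> {0..U}" and r: "r \<in> {0..R}" and mx: "\<And>r'. r' \<in> {0..R} \<Longrightarrow> z u r' \<le> z u r"
    \<comment> \<open>At a maximum in r of the squared difference, its pointwise value is the sup
      norm; this makes the nonlocal Lipschitz estimate usable at a single point.\<close>
    define e where "e = \<bar>h1 u r - h2 u r\<bar>"
    have e: "\<bar>h1 u r' - h2 u r'\<bar> \<le> e" if "r' \<in> {0..R}" for r'
      using mx[OF that] unfolding z_def e_def by (simp add: abs_le_square_iff)
    have L: "\<bar>aa (w1 u) r - aa (w2 u) r\<bar> \<le> C * e \<and> \<bar>TT (w1 u) r - TT (w2 u) r\<bar> \<le> C * e"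
      by (rule Lip[of "h1 u" "w1 u" "h2 u" "w2 u"])
        (use h1(2) h2(2) contbox_r[OF h1(4) u] contbox_r[OF h2(4) u] M u r e in \<open>auto simp: derr_def C1_bounded_def\<close>)
    \<comment> \<open>With the transport by \<open>aa (w1 u)\<close> split off, the change of
      coefficient multiplies w2, which is bounded; no derivative of the difference remains.\<close>
    have eq: "(rhs w1 u r - rhs w2 u r) - aa (w1 u) r * (w1 u r - w2 u r)
       = w2 u r * (aa (w1 u) r - aa (w2 u) r) + (TT (w1 u) r - TT (w2 u) r)"
      by (simp add: rhs_def algebra_simps)
    have "\<bar>w2 u r * (aa (w1 u) r - aa (w2 u) r)\<bar> \<le> M * (C * e)"
      unfolding abs_mult using L M[OF u r] M0 by (intro mult_mono) auto
    then have b: "\<bar>(rhs w1 u r - rhs w2 u r) - aa (w1 u) r * (w1 u r - w2 u r)\<bar> \<le> M * (C * e) + C * e"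
      unfolding eq using L by linarith
    have "2 * (h1 u r - h2 u r) * (rhs w1 u r - rhs w2 u r) - aa (w1 u) r * (2 * (h1 u r - h2 u r) * (w1 u r - w2 u r))
      = 2 * ((h1 u r - h2 u r) * ((rhs w1 u r - rhs w2 u r) - aa (w1 u) r * (w1 u r - w2 u r)))"
      by (simp add: algebra_simps)
    also have "\<dots> \<le> 2 * (e * (M * (C * e) + C * e))"
    proof -
      have "(h1 u r - h2 u r) * ((rhs w1 u r - rhs w2 u r) - aa (w1 u) r * (w1 u r - w2 u r))
        \<le> \<bar>h1 u r - h2 u r\<bar> * \<bar>(rhs w1 u r - rhs w2 u r) - aa (w1 u) r * (w1 u r - w2 u r)\<bar>"
        by (metis abs_ge_self abs_mult)
      also have "\<dots> \<le> e * (M * (C * e) + C * e)" using b by (intro mult_mono) (auto simp: e_def)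
      finally show ?thesis by simp
    qed
    also have "\<dots> = D * (e * e)" by (simp add: D_def algebra_simps)
    also have "e * e = z u r" by (simp add: e_def z_def power2_eq_square)
    finally show "2 * (h1 u r - h2 u r) * (rhs w1 u r - rhs w2 u r) - aa (w1 u) r * (2 * (h1 u r - h2 u r) * (w1 u r - w2 u r)) \<le> D * z u r" .
  qed auto
  then show ?thesis by (simp add: z_def)
qed

lemma sup_bound:
  assumes U: "U > 0"
    and h: "contbox U R h" "derr U R h w" "deru U R h (rhs w)" "contbox U R w" "\<And>u. u \<in> {0..U} \<Longrightarrow> small (w u)"
    and K: "K \<ge> 0" "\<And>r. r \<in> {0..R} \<Longrightarrow> \<bar>h 0 r\<bar> \<le> K"
    and ur: "u \<in> {0..U}" "r \<in> {0..R}"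
  shows "\<bar>h u r\<bar> \<le> K"
proof -
  have main: "(h u r)\<^sup>2 \<le> exp (L * u) * K\<^sup>2" if L: "L > 0" for L
  proof (rule transport_maximum_principle[OF U R_pos _ _ _ _ _ _ _ _ L ur, where a = "\<lambda>u. aa (w u)"])
    show "contbox U R (\<lambda>u r. (h u r)\<^sup>2)" using h(1) unfolding contbox_def by (intro continuous_intros)
    show "derr U R (\<lambda>u r. (h u r)\<^sup>2) (\<lambda>u r. 2 * h u r * w u r)"
      using h(2) unfolding derr_def by (auto intro!: derivative_eq_intros)
    show "deru U R (\<lambda>u r. (h u r)\<^sup>2) (\<lambda>u r. 2 * h u r * rhs w u r)"
      using h(3) unfolding deru_def by (auto intro!: derivative_eq_intros)
    show "0 \<le> aa (w u) 0" "aa (w u) R \<le> 0" if "u \<in> {0..U}" for u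
      using aa_0[of "w u"] small_aa_R[OF h(5)[OF that]] h(5)[OF that] by (auto simp: small_def)
    show "(h 0 r)\<^sup>2 \<le> K\<^sup>2" if "r \<in> {0..R}" for r using K(1) K(2)[OF that] by (simp add: abs_le_square_iff[symmetric])
    fix u r assume u: "u \<in> {0..U}" and r: "r \<in> {0..R}" and mx: "\<And>r'. r' \<in> {0..R} \<Longrightarrow> (h u r')\<^sup>2 \<le> (h u r)\<^sup>2"
    have wc: "continuous_on {0..R} (w u)" and d: "\<And>r. r \<in> {0..R} \<Longrightarrow> (h u has_real_derivative w u r) (at r within {0..R})"
      using contbox_r[OF h(4) u] h(2) u by (auto simp: derr_def)
    have "\<bar>Av 0 (h u) r\<bar> \<le> \<bar>h u r\<bar>"
      by (rule Av_abs_le'[OF contbox_r[OF h(1) u] r]) (use mx in \<open>simp add: abs_le_square_iff\<close>)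
    then have "\<bar>h u r * Av 0 (h u) r\<bar> \<le> h u r * h u r"
      unfolding abs_mult using mult_left_mono[of "\<bar>Av 0 (h u) r\<bar>" "\<bar>h u r\<bar>" "\<bar>h u r\<bar>"] by (simp flip: abs_mult)
    then have "0 \<le> h u r * (h u r - Av 0 (h u) r)" by (simp add: algebra_simps)
    moreover have "r * Av 1 (w u) r = h u r - Av 0 (h u) r"
      using Av_parts[OF d wc r, of 0] by (simp add: One_nat_def)
    ultimately have "GG (w u) r * (h u r * (r * Av 1 (w u) r)) \<le> 0"
      using small_GG_nonpos[OF h(5)[OF u] r] by (simp add: mult_nonpos_nonneg)
    then show "2 * h u r * rhs w u r - aa (w u) r * (2 * h u r * w u r) \<le> 0 * (h u r)\<^sup>2"
      by (simp add: rhs_def TT_def algebra_simps)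
  qed auto
  \<comment> \<open>The maximum principle requires L > 0 strictly; letting L tend to 0 removes the
    exponential and leaves the sharp constant.\<close>
  have "((\<lambda>L. exp (L * u) * K\<^sup>2) \<longlongrightarrow> exp (0 * u) * K\<^sup>2) (at_right 0)"
    by (intro tendsto_intros)
  then have "(h u r)\<^sup>2 \<le> exp (0 * u) * K\<^sup>2"
    by (rule tendsto_lowerbound) (auto simp: eventually_at_filter main intro!: always_eventually)
  then show ?thesis using K(1) by (simp add: abs_le_square_iff[symmetric])
qed

end

section \<open>The limit solves the equation\<close>

context bondi_run begin

text \<open>The u-derivative of the polygon between nodes: the coefficients are frozen at the last
  node and only the foot moves.\<close>

definition polygon_du :: "real \<Rightarrow> real \<Rightarrow> real \<Rightarrow> real" where
  "polygon_du \<tau> r s = (let j = node_index \<tau> s; w = snd (node \<tau> j) 0 in w (foot (s - real j * \<tau>) w r) * aa w r + TT w r)"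

lemma node_index_unique:
  assumes "0 < \<tau>" "real j * \<tau> \<le> s" "s < (real j + 1) * \<tau>"
  shows "node_index \<tau> s = j"
proof -
  have "\<lfloor>s / \<tau>\<rfloor> = int j"
    by (rule floor_unique) (use assms in \<open>auto simp: field_simps\<close>)
  then show ?thesis by (simp add: node_index_def)
qed

lemma polygon_deriv:
  assumes tau: "0 < \<tau>" "\<tau> \<le> max_step" and s: "real j * \<tau> < s" "s < (real j + 1) * \<tau>" "s \<le> U0" and r: "r \<in> {0..R}"
  shows "((\<lambda>s. polygon \<tau> s r) has_real_derivative polygon_du \<tau> r s) (at s)"
proof -
  define h where "h = fst (node \<tau> j)"
  define v where "v = snd (node \<tau> j)"
  have "real j * \<tau> \<le> U0" using s by linarith
  then have j: "jet m h v" and w: "small (v 0)" using node_basic[OF tau] by (auto simp: h_def v_def)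
  have y: "foot (s' - real j * \<tau>) (v 0) r \<in> {0..R}" if "s' \<in> {real j * \<tau>..(real j + 1) * \<tau>}" for s'
    by (rule foot_mem[OF w _ _ r]) (use that tau in \<open>auto simp: algebra_simps\<close>)
  have s': "s \<in> {real j * \<tau>..(real j + 1) * \<tau>}" using s by auto
  have "((\<lambda>s. foot (s - real j * \<tau>) (v 0) r) has_real_derivative aa (v 0) r) (at s within {real j * \<tau>..(real j + 1) * \<tau>})"
    unfolding foot_def by (auto intro!: derivative_eq_intros)
  moreover have "(h has_real_derivative v 0 (foot (s - real j * \<tau>) (v 0) r)) (at (foot (s - real j * \<tau>) (v 0) r) within {0..R})"
    using j y[OF s'] unfolding jet_def by blast
  ultimately have "((\<lambda>s. h (foot (s - real j * \<tau>) (v 0) r)) has_real_derivative v 0 (foot (s - real j * \<tau>) (v 0) r) * aa (v 0) r)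
      (at s within {real j * \<tau>..(real j + 1) * \<tau>})"
    by (intro DERIV_chain_within[where g = h and T = "{0..R}" and y = "\<lambda>s. foot (s - real j * \<tau>) (v 0) r"] y)
  then have "((\<lambda>s. step_h (s - real j * \<tau>) h v r) has_real_derivative v 0 (foot (s - real j * \<tau>) (v 0) r) * aa (v 0) r + TT (v 0) r)
      (at s within {real j * \<tau>..(real j + 1) * \<tau>})"
    unfolding step_h_def by (auto intro!: derivative_eq_intros)
  then have "((\<lambda>s. step_h (s - real j * \<tau>) h v r) has_real_derivative v 0 (foot (s - real j * \<tau>) (v 0) r) * aa (v 0) r + TT (v 0) r) (at s)"
    using s by (simp add: at_within_Icc_at)
  moreover have "v 0 (foot (s - real j * \<tau>) (v 0) r) * aa (v 0) r + TT (v 0) r = polygon_du \<tau> r s"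
    using node_index_unique[OF tau(1), of j s] s by (simp add: polygon_du_def Let_def v_def)
  ultimately have "((\<lambda>s. step_h (s - real j * \<tau>) h v r) has_real_derivative polygon_du \<tau> r s) (at s)" by simp
  then show ?thesis
  proof (rule has_field_derivative_transform_within_open[where S = "{real j * \<tau><..<(real j + 1) * \<tau>}"])
    fix x assume "x \<in> {real j * \<tau><..<(real j + 1) * \<tau>}"
    then have "node_index \<tau> x = j" using node_index_unique[OF tau(1)] by auto
    then show "step_h (x - real j * \<tau>) h v r = polygon \<tau> x r" by (simp add: polygon_def h_def v_def)
  qed (use s in auto)
qed

text \<open>The slope may jump at the nodes; these are finitely many and form the exceptional set S
  of the fundamental theorem.\<close>

lemma polygon_integral:
  assumes tau: "0 < \<tau>" "\<tau> \<le> max_step" and u: "u \<in> {0..U0}" and r: "r \<in> {0..R}"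
  shows "(polygon_du \<tau> r has_integral polygon \<tau> u r - h0 r) {0..u}"
proof -
  define S where "S = (\<lambda>j. real j * \<tau>) ` {..node_index \<tau> u}"
  have "(polygon_du \<tau> r has_integral polygon \<tau> u r - polygon \<tau> 0 r) {0..u}"
  proof (rule fundamental_theorem_of_calculus_interior_strong[of S])
    fix x assume x: "x \<in> {0<..<u} - S"
    define j where "j = node_index \<tau> x"
    have b: "real j * \<tau> \<le> x" "x < (real j + 1) * \<tau>" using node_index_bounds[OF tau, of x] x by (auto simp: j_def)
    have "real j * \<tau> < (real (node_index \<tau> u) + 1) * \<tau>" using b x node_index_bounds(2)[OF tau, of u] u by auto
    then have "j \<le> node_index \<tau> u" using tau by simp
    then have "real j * \<tau> \<noteq> x" using x by (auto simp: S_def)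
    with b have "((\<lambda>s. polygon \<tau> s r) has_real_derivative polygon_du \<tau> r x) (at x)"
      by (intro polygon_deriv[OF tau _ _ _ r, of j]) (use x u in auto)
    then show "((\<lambda>s. polygon \<tau> s r) has_vector_derivative polygon_du \<tau> r x) (at x)"
      by (simp add: has_real_derivative_iff_has_vector_derivative)
  next
    show "continuous_on {0..u} (\<lambda>s. polygon \<tau> s r)"
    proof (rule lipschitz_on_continuous_on[of LH], rule lipschitz_onI)
      fix x y assume "x \<in> {0..u}" "y \<in> {0..u}"
      then show "dist (polygon \<tau> x r) (polygon \<tau> y r) \<le> LH * dist x y"
        using polygon_Lipschitz[OF tau, of x y r r] u r by (auto simp: dist_real_def)
    qed (rule LH_nonneg)
  qed (use u in \<open>auto simp: S_def\<close>)
  then show ?thesis by (simp add: polygon_0[OF tau])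
qed

text \<open>Last node and foot differ from (s, r) by at most a multiple of the step size, so uniform
  convergence of the first jet and uniform continuity of its limit give an N independent of
  s.\<close>

lemma polygon_du_converges:
  assumes ts: "\<And>n::nat. 0 < ts n" "\<And>n. ts n \<le> max_step" "ts \<longlonglongrightarrow> 0"
    and un: "unifbox U0 R (\<lambda>n u. polygon_jet (ts n) u 0) w" and w: "contbox U0 R w" "\<And>u. u \<in> {0..U0} \<Longrightarrow> small (w u)"
    and r: "r \<in> {0..R}" and e: "e > 0"
  shows "\<exists>N. \<forall>n\<ge>N. \<forall>s\<in>{0..U0}. \<bar>polygon_du (ts n) r s - rhs w s r\<bar> \<le> e"
proof -
  obtain C where C: "C \<ge> 0" and Lip:
    "\<And>h1 w1 h2 w2 e r. C1_bounded B h1 w1 \<Longrightarrow> C1_bounded B h2 w2 \<Longrightarrow>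
      (\<And>r. r \<in> {0..R} \<Longrightarrow> \<bar>h1 r - h2 r\<bar> \<le> e) \<Longrightarrow> r \<in> {0..R} \<Longrightarrow>
      \<bar>aa w1 r - aa w2 r\<bar> \<le> C * e \<and> \<bar>TT w1 r - TT w2 r\<bar> \<le> C * e"
    using functional_Lipschitz[OF less_imp_le[OF B_pos]] by blast
  \<comment> \<open>The Lipschitz estimate speaks of h; applied to primitives vanishing at 0, it
    turns a bound d on w1 - w2 into d R.\<close>
  have Lip': "\<bar>aa w1 r - aa w2 r\<bar> \<le> C * (d * R) \<and> \<bar>TT w1 r - TT w2 r\<bar> \<le> C * (d * R)"
    if w1: "small w1" and w2: "small w2" and d: "\<And>r. r \<in> {0..R} \<Longrightarrow> \<bar>w1 r - w2 r\<bar> \<le> d" for w1 w2 d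
  proof -
    have c: "continuous_on {0..R} w1" "continuous_on {0..R} w2" using w1 w2 by (auto simp: small_def)
    have d0: "d \<ge> 0" using d[OF r] by linarith
    show ?thesis
    proof (rule Lip)
      show "C1_bounded B (\<lambda>x. integral {0..x} w1) w1" "C1_bounded B (\<lambda>x. integral {0..x} w2) w2"
        using primitive_deriv c w1 w2 by (auto simp: C1_bounded_def small_def)
      fix s assume s: "s \<in> {0..R}"
      have sub: "continuous_on {0..s} w1" "continuous_on {0..s} w2" using c s by (auto intro: continuous_on_subset)
      have "integral {0..s} w1 - integral {0..s} w2 = integral {0..s} (\<lambda>x. w1 x - w2 x)"
        using sub by (intro integral_diff[symmetric] integrable_continuous_real)
      moreover have "norm (integral {0..s} (\<lambda>x. w1 x - w2 x)) \<le> d * (s - 0)"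
        by (rule integral_bound) (use s d sub in \<open>auto intro!: continuous_intros\<close>)
      moreover have "d * (s - 0) \<le> d * R" using s d0 by (intro mult_left_mono) auto
      ultimately show "\<bar>integral {0..s} w1 - integral {0..s} w2\<bar> \<le> d * R" by simp
    qed (rule r)
  qed
  define K where "K = 2 * CA + B * (C * (2 * R)) + C * (2 * R)"
  have K: "K \<ge> 0" using CA_nonneg B_pos C R_pos by (simp add: K_def)
  define e' where "e' = e / (K + 1)"
  have e': "e' > 0" "K * e' \<le> e" using e K by (auto simp: e'_def field_simps)
  have "uniformly_continuous_on ({0..U0} \<times> {0..R}) (\<lambda>p. w (fst p) (snd p))"
    using w(1) unfolding contbox_def by (intro compact_uniformly_continuous compact_Times) auto
  then obtain d where d: "d > 0" "\<And>x x'. x \<in> {0..U0} \<times> {0..R} \<Longrightarrow> x' \<in> {0..U0} \<times> {0..R} \<Longrightarrow> dist x' x < d \<Longrightarrow>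
       dist (w (fst x') (snd x')) (w (fst x) (snd x)) < e'"
    using e'(1) unfolding uniformly_continuous_on_def by blast
  have wd: "\<bar>w t y - w s x\<bar> \<le> e'" if "t \<in> {0..U0}" "s \<in> {0..U0}" "y \<in> {0..R}" "x \<in> {0..R}" "\<bar>t - s\<bar> + \<bar>y - x\<bar> < d" for t s y x
  proof -
    have "dist (t, y) (s, x) \<le> \<bar>t - s\<bar> + \<bar>y - x\<bar>"
      unfolding dist_Pair_Pair dist_real_def by (rule sqrt_sum_squares_le_sum_abs[THEN order_trans]) auto
    then show ?thesis using d(2)[of "(s, x)" "(t, y)"] that by (auto simp: dist_real_def)
  qed
  obtain N1 where N1: "\<forall>n\<ge>N1. \<forall>u\<in>{0..U0}. \<forall>r\<in>{0..R}. \<bar>polygon_jet (ts n) u 0 r - w u r\<bar> \<le> e'"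
    using un e'(1) unfolding unifbox_def by blast
  \<comment> \<open>Time moves by at most the step size and the foot by at most \<open>CA\<close>
    times it, hence the factor 1 + \<open>CA\<close>.\<close>
  have "d / (1 + CA) > 0" using d CA_nonneg by simp
  then obtain N2 where N2: "\<forall>n\<ge>N2. norm (ts n - 0) < d / (1 + CA)" using LIMSEQ_D[OF ts(3)] by blast
  show ?thesis
  proof (intro exI[of _ "max N1 N2"] allI impI ballI)
    fix n s assume n: "max N1 N2 \<le> n" and s: "s \<in> {0..U0}"
    note tau = ts(1)[of n] ts(2)[of n]
    let ?\<tau> = "ts n"
    have "norm (?\<tau> - 0) < d / (1 + CA)" using N2 n by auto
    then have tn: "?\<tau> * (1 + CA) < d" using tau CA_nonneg by (simp add: pos_less_divide_eq)
    define j where "j = node_index ?\<tau> s"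
    define t where "t = real j * ?\<tau>"
    define q where "q = snd (node ?\<tau> j) 0"
    define y where "y = foot (s - t) q r"
    have b: "t \<le> s" "s < t + ?\<tau>" using node_index_bounds[OF tau, of s] s by (auto simp: t_def j_def algebra_simps)
    have t: "t \<in> {0..U0}" using b s tau by (auto simp: t_def)
    have q: "q = polygon_jet ?\<tau> t 0" using polygon_jet_node[OF tau, of j] by (simp add: q_def t_def)
    have sq: "small q" unfolding q using polygon_basic[OF tau] t by auto
    have y: "y \<in> {0..R}" unfolding y_def by (rule foot_mem[OF sq _ _ r]) (use b tau in auto)
    have "\<bar>y - r\<bar> = \<bar>s - t\<bar> * \<bar>aa q r\<bar>" by (simp add: y_def foot_def abs_mult)
    also have "\<dots> \<le> ?\<tau> * CA" using b aa_bound[OF sq r] tau by (intro mult_mono) auto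
    finally have yr: "\<bar>y - r\<bar> \<le> ?\<tau> * CA" .
    have near: "\<bar>t - s\<bar> + \<bar>y - r\<bar> < d" "\<bar>t - s\<bar> < d"
    proof -
      have "\<bar>t - s\<bar> \<le> ?\<tau>" using b by auto
      then show "\<bar>t - s\<bar> + \<bar>y - r\<bar> < d" using yr tn by (simp add: algebra_simps)
      then show "\<bar>t - s\<bar> < d" by linarith
    qed
    have n1: "\<bar>q x - w t x\<bar> \<le> e'" if "x \<in> {0..R}" for x unfolding q using N1 n t that by auto
    have "\<bar>q x - w s x\<bar> \<le> 2 * e'" if "x \<in> {0..R}" for x
      using n1[OF that] wd[OF t s that that] near(2) by auto
    from Lip'[OF sq w(2)[OF s] this]
    have L: "\<bar>aa q r - aa (w s) r\<bar> \<le> C * (2 * e' * R)" "\<bar>TT q r - TT (w s) r\<bar> \<le> C * (2 * e' * R)" by auto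
    have qy: "\<bar>q y - w s r\<bar> \<le> 2 * e'" using n1[OF y] wd[OF t s y r near(1)] by linarith
    have "\<bar>w s r\<bar> \<le> B" using w(2)[OF s] r by (auto simp: small_def)
    from mult_diff_abs_le[OF qy L(1) aa_bound[OF sq r] this]
    have "\<bar>q y * aa q r - w s r * aa (w s) r\<bar> \<le> 2 * e' * CA + B * (C * (2 * e' * R))" .
    then have "\<bar>(q y * aa q r + TT q r) - rhs w s r\<bar> \<le> 2 * e' * CA + B * (C * (2 * e' * R)) + C * (2 * e' * R)"
      unfolding rhs_def using L(2) by linarith
    also have "\<dots> = K * e'" by (simp add: K_def algebra_simps)
    finally have "\<bar>(q y * aa q r + TT q r) - rhs w s r\<bar> \<le> e" using e'(2) by linarith
    moreover have "polygon_du ?\<tau> r s = q y * aa q r + TT q r" by (simp add: polygon_du_def Let_def q_def y_def t_def j_def)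
    ultimately show "\<bar>polygon_du ?\<tau> r s - rhs w s r\<bar> \<le> e" by simp
  qed
qed

text \<open>The limit is taken in the integrated equation, where jumps of \<open>polygon_du\<close>
  at nodes do not matter; continuity of \<open>rhs (v 0)\<close> then restores the
  u-derivative.\<close>

lemma solution_exists:
  obtains h v where "contbox U0 R h" "derr U0 R h (v 0)" "deru U0 R h (rhs (v 0))"
    "\<And>i. i < m \<Longrightarrow> derr U0 R (v i) (v (Suc i))" "\<And>i. i \<le> m \<Longrightarrow> contbox U0 R (v i)"
    "\<And>r. r \<in> {0..R} \<Longrightarrow> h 0 r = h0 r" "\<And>u r. u \<in> {0..U0} \<Longrightarrow> r \<in> {0..R} \<Longrightarrow> \<bar>v 0 u r\<bar> \<le> 2 * M0"
proof (rule limit_exists)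
  fix h v ts assume ts: "\<And>n::nat. 0 < ts n" "\<And>n. ts n \<le> max_step" "ts \<longlonglongrightarrow> 0"
    and h: "unifbox U0 R (\<lambda>n. polygon (ts n)) h" "contbox U0 R h" "derr U0 R h (v 0)"
    and v: "unifbox U0 R (\<lambda>n u. polygon_jet (ts n) u 0) (v 0)"
    "\<And>i. i < m \<Longrightarrow> derr U0 R (v i) (v (Suc i))" "\<And>i. i \<le> m \<Longrightarrow> contbox U0 R (v i)"
  have bound: "\<bar>v 0 u r\<bar> \<le> 2 * M0" if "u \<in> {0..U0}" "r \<in> {0..R}" for u r
  proof -
    have "(\<lambda>n. \<bar>polygon_jet (ts n) u 0 r\<bar>) \<longlonglongrightarrow> \<bar>v 0 u r\<bar>" using unifbox_tendsto[OF v(1) that] by (rule tendsto_rabs)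
    then show ?thesis by (rule LIMSEQ_le_const2) (use polygon_basic(3)[OF ts(1,2)] that in auto)
  qed
  have c0: "contbox U0 R (v 0)" using v(3) by simp
  have small: "small (v 0 u)" if "u \<in> {0..U0}" for u
    using contbox_r[OF c0 that] bound[OF that] M0B unfolding small_def by (meson order_trans)
  have cr: "contbox U0 R (rhs (v 0))" using mixed_Ck_rhs[of U0 0 0 "v 0"] c0 by simp
  have main: "h u r = h0 r + integral {0..u} (\<lambda>s. rhs (v 0) s r)" if u: "u \<in> {0..U0}" and r: "r \<in> {0..R}" for u r
  proof (rule LIMSEQ_unique[OF unifbox_tendsto[OF h(1) u r]], rule LIMSEQ_I)
    fix e :: real assume e: "e > 0"
    define e' where "e' = e / (2 * (u + 1))"
    have e': "e' > 0" using e u by (auto simp: e'_def)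
    have e'u: "e' * u < e"
    proof -
      have "e' * u \<le> e' * (u + 1)" using e' by simp
      also have "\<dots> = e / 2" using u by (simp add: e'_def field_simps)
      finally show ?thesis using e by simp
    qed
    obtain N where N: "\<forall>n\<ge>N. \<forall>s\<in>{0..U0}. \<bar>polygon_du (ts n) r s - rhs (v 0) s r\<bar> \<le> e'"
      using polygon_du_converges[OF ts v(1) c0 small r e'] by blast
    have "continuous_on {0..u} (\<lambda>s. rhs (v 0) s r)"
      by (rule continuous_on_subset[OF contbox_u[OF cr r]]) (use u in auto)
    then have I: "((\<lambda>s. rhs (v 0) s r) has_integral integral {0..u} (\<lambda>s. rhs (v 0) s r)) {0..u}"
      by (intro integrable_integral integrable_continuous_real)
    show "\<exists>N. \<forall>n\<ge>N. norm (polygon (ts n) u r - (h0 r + integral {0..u} (\<lambda>s. rhs (v 0) s r))) < e"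
    proof (intro exI[of _ N] allI impI)
      fix n assume n: "N \<le> n"
      have "((\<lambda>s. polygon_du (ts n) r s - rhs (v 0) s r) has_integral
         (polygon (ts n) u r - h0 r) - integral {0..u} (\<lambda>s. rhs (v 0) s r)) (cbox 0 u)"
        using has_integral_diff[OF polygon_integral[OF ts(1,2) u r] I] by simp
      then have "norm ((polygon (ts n) u r - h0 r) - integral {0..u} (\<lambda>s. rhs (v 0) s r)) \<le> e' * measure lborel (cbox 0 u)"
        by (rule has_integral_bound[rotated]) (use e' N n u in auto)
      also have "\<dots> = e' * u" using u by simp
      finally show "norm (polygon (ts n) u r - (h0 r + integral {0..u} (\<lambda>s. rhs (v 0) s r))) < e"
        using e'u by (simp add: algebra_simps)
    qed
  qed
  have du: "deru U0 R h (rhs (v 0))"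
    unfolding deru_def
  proof (intro ballI)
    fix u r assume u: "u \<in> {0..U0}" and r: "r \<in> {0..R}"
    have "((\<lambda>x. h0 r + integral {0..x} (\<lambda>s. rhs (v 0) s r)) has_real_derivative rhs (v 0) u r) (at u within {0..U0})"
      using integral_has_real_derivative[OF contbox_u[OF cr r] u] by (auto intro!: derivative_eq_intros)
    then show "((\<lambda>v. h v r) has_real_derivative rhs (v 0) u r) (at u within {0..U0})"
      by (rule has_field_derivative_transform_within[OF _ zero_less_one u]) (use main r in auto)
  qed
  have init: "h 0 r = h0 r" if "r \<in> {0..R}" for r using main[of 0 r] U0(1) that by simp
  show thesis by (rule that[OF h(2,3) du v(2,3) init bound])
qed

end

section \<open>From the initial datum to the theorem\<close>

primrec iter_deriv :: "real \<Rightarrow> (real \<Rightarrow> real) \<Rightarrow> nat \<Rightarrow> real \<Rightarrow> real" where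
  "iter_deriv R g 0 = (\<lambda>x. vector_derivative g (at x within {0..R}))"
| "iter_deriv R g (Suc i) = (\<lambda>x. vector_derivative (iter_deriv R g i) (at x within {0..R}))"

lemma iter_deriv_Suc: "iter_deriv R g (Suc i) = iter_deriv R (\<lambda>x. vector_derivative g (at x within {0..R})) i"
  by (induction i) auto

text \<open>The index is shifted by one: \<open>iter_deriv R g i\<close> is the derivative of order
  i + 1, in line with jets of w rather than of h. So a datum of class k = m + 1 has jets up to index
  m.\<close>

lemma Ck1_iter_deriv:
  "Ck1 (Suc m) R g \<Longrightarrow>
    (\<forall>r\<in>{0..R}. (g has_real_derivative iter_deriv R g 0 r) (at r within {0..R})) \<and>
    (\<forall>i<m. \<forall>r\<in>{0..R}. (iter_deriv R g i has_real_derivative iter_deriv R g (Suc i) r) (at r within {0..R})) \<and>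
    (\<forall>i\<le>m. continuous_on {0..R} (iter_deriv R g i))"
proof (induction m arbitrary: g)
  case 0
  then show ?case
    by (auto simp: has_real_derivative_iff_has_vector_derivative vector_derivative_works[symmetric])
next
  case (Suc m)
  let ?g' = "\<lambda>x. vector_derivative g (at x within {0..R})"
  have IH: "(\<forall>r\<in>{0..R}. (?g' has_real_derivative iter_deriv R ?g' 0 r) (at r within {0..R}))"
    "(\<forall>i<m. \<forall>r\<in>{0..R}. (iter_deriv R ?g' i has_real_derivative iter_deriv R ?g' (Suc i) r) (at r within {0..R}))"
    "(\<forall>i\<le>m. continuous_on {0..R} (iter_deriv R ?g' i))"
    using Suc.IH[of ?g'] Suc.prems by auto
  have 1: "\<forall>r\<in>{0..R}. (g has_real_derivative iter_deriv R g 0 r) (at r within {0..R})"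
    using Suc.prems by (auto simp: has_real_derivative_iff_has_vector_derivative vector_derivative_works[symmetric])
  have 2: "(iter_deriv R g i has_real_derivative iter_deriv R g (Suc i) r) (at r within {0..R})"
    if "i < Suc m" "r \<in> {0..R}" for i r
  proof (cases i)
    case 0 then show ?thesis using IH(1) that unfolding iter_deriv_Suc by simp
  next
    case (Suc j)
    then show ?thesis using IH(2) that unfolding Suc iter_deriv_Suc by simp
  qed
  have 3: "continuous_on {0..R} (iter_deriv R g i)" if "i \<le> Suc m" for i
  proof (cases i)
    case 0 then show ?thesis using Suc.prems by auto
  next
    case (Suc j)
    then show ?thesis using IH(3) that unfolding Suc iter_deriv_Suc by simp
  qed
  show ?case using 1 2 3 by blast
qed

context bondi_small begin

lemma well_posed:
  assumes k: "k \<ge> 1" and h0: "Ck1 k R h0" and X: "XR_norm R h0 < B / 2"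
  shows "\<exists>h. Ck2 k U0 R h \<and> is_solution \<kappa> \<Lambda> U0 R h0 h \<and>
             (\<forall>h'. Ck2 k U0 R h' \<and> is_solution \<kappa> \<Lambda> U0 R h0 h' \<longrightarrow> (\<forall>u\<in>{0..U0}. \<forall>r\<in>{0..R}. h' u r = h u r)) \<and>
             (SUP p\<in>{0..U0} \<times> {0..R}. \<bar>h (fst p) (snd p)\<bar>) = (SUP r\<in>{0..R}. \<bar>h0 r\<bar>) \<and>
             (SUP p\<in>{0..U0} \<times> {0..R}. \<bar>h (fst p) (snd p)\<bar>)
               + (SUP p\<in>{0..U0} \<times> {0..R}. \<bar>pr R h (fst p) (snd p)\<bar>) \<le> (1 + 1) * XR_norm R h0"
proof -
  obtain m where m: "k = Suc m" using k by (cases k) auto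
  define v0 where "v0 = iter_deriv R h0"
  define S0 where "S0 = (SUP r\<in>{0..R}. \<bar>h0 r\<bar>)"
  define M0 where "M0 = (SUP r\<in>{0..R}. \<bar>v0 0 r\<bar>)"
  have X_eq: "XR_norm R h0 = S0 + M0" by (simp add: XR_norm_def S0_def M0_def v0_def)
  have jet: "jet m h0 v0" using Ck1_iter_deriv[of m R h0] h0 m by (auto simp: jet_def v0_def)
  have bdd: "bdd_above ((\<lambda>r. \<bar>g r\<bar>) ` {0..R})" if "continuous_on {0..R} g" for g :: "real \<Rightarrow> real"
    by (intro bounded_imp_bdd_above compact_imp_bounded compact_continuous_image continuous_intros that) auto
  have h0c: "continuous_on {0..R} h0" using jet unfolding jet_def by (meson DERIV_continuous_on)
  have v0c: "continuous_on {0..R} (v0 0)" using jet by (auto simp: jet_def)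
  have S0: "\<bar>h0 r\<bar> \<le> S0" if "r \<in> {0..R}" for r unfolding S0_def using bdd[OF h0c] that by (rule cSUP_upper2) auto
  have M0: "\<bar>v0 0 r\<bar> \<le> M0" if "r \<in> {0..R}" for r unfolding M0_def using bdd[OF v0c] that by (rule cSUP_upper2) auto
  have S0_nonneg: "S0 \<ge> 0" using S0[of 0] R_pos by auto
  interpret bondi_run \<kappa> \<Lambda> R B m h0 v0 M0
    by unfold_locales (use jet M0 X X_eq S0_nonneg in auto)
  show ?thesis
  proof (rule solution_exists)
    fix h v assume h: "contbox U0 R h" "derr U0 R h (v 0)" "deru U0 R h (rhs (v 0))"
      "\<And>i. i < m \<Longrightarrow> derr U0 R (v i) (v (Suc i))" "\<And>i. i \<le> m \<Longrightarrow> contbox U0 R (v i)"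
      "\<And>r. r \<in> {0..R} \<Longrightarrow> h 0 r = h0 r" "\<And>u r. u \<in> {0..U0} \<Longrightarrow> r \<in> {0..R} \<Longrightarrow> \<bar>v 0 u r\<bar> \<le> 2 * M0"
    have vc: "contbox U0 R (v 0)" using h(5) by simp
    have sm: "small (v 0 u)" if "u \<in> {0..U0}" for u
      using contbox_r[OF vc that] h(7)[OF that] M0B unfolding small_def by (meson order_trans)
    \<comment> \<open>Downward from the top jet, which is merely continuous: each passage to the
      preceding jet gains one order in r.\<close>
    have "j \<le> m \<Longrightarrow> mixed_Ck U0 R 0 j (v (m - j))" for j
    proof (induction j)
      case (Suc j)
      then have "derr U0 R (v (m - Suc j)) (v (m - j))" using h(4)[of "m - Suc j"] by (simp add: Suc_diff_Suc)
      then show ?case using Suc h(5) by auto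
    qed (use h(5) in auto)
    from this[of m] have "mixed_Ck U0 R 0 m (v 0)" by simp
    then have "mixed_Ck U0 R 0 (Suc m) h" using h(1,2) by auto
    then have "mixed_Ck U0 R (Suc m) (Suc m) h" by (rule mixed_Ck_bootstrap[OF h(2,3)])
    then have C: "Ck2 k U0 R h" unfolding m by (rule mixed_Ck_imp_Ck2[OF U0(1) R_pos])
    have sol: "is_solution \<kappa> \<Lambda> U0 R h0 h" using is_solution_iff[OF U0(1) h(2,3) vc] h(6) by auto
    have uniq: "h' u r = h u r" if h': "Ck2 k U0 R h'" "is_solution \<kappa> \<Lambda> U0 R h0 h'" and ur: "u \<in> {0..U0}" "r \<in> {0..R}" for h' u r
    proof -
      note C1 = Ck2_imp_C1[OF h'(1) k]
      have s: "(\<forall>r\<in>{0..R}. h' 0 r = h0 r)" "(\<forall>u\<in>{0..U0}. \<forall>r\<in>{0..R}. pu U0 h' u r = rhs (pr R h') u r)"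
        using h'(2) is_solution_iff[OF U0(1) C1(2,3,4)] by auto
      have "deru U0 R h' (rhs (pr R h'))" using C1(3) s(2) by (simp add: deru_def)
      from uniqueness[OF U0(1) h(1-3) vc sm C1(1,2) this C1(4) _ ur]
      show ?thesis using h(6) s(1) by simp
    qed
    have hb: "\<bar>h u r\<bar> \<le> S0" if "u \<in> {0..U0}" "r \<in> {0..R}" for u r
      by (rule sup_bound[OF U0(1) h(1-3) vc sm S0_nonneg _ that]) (use S0 h(6) in auto)
    have ne: "{0..U0} \<times> {0..R} \<noteq> {}" "{0..R} \<noteq> {}" using U0 R_pos by auto
    have hbdd: "bdd_above ((\<lambda>p. \<bar>h (fst p) (snd p)\<bar>) ` ({0..U0} \<times> {0..R}))"
      by (rule bdd_aboveI2[of _ _ S0]) (use hb in auto)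
    have SUPh: "(SUP p\<in>{0..U0} \<times> {0..R}. \<bar>h (fst p) (snd p)\<bar>) = S0"
    proof (rule antisym)
      show "(SUP p\<in>{0..U0} \<times> {0..R}. \<bar>h (fst p) (snd p)\<bar>) \<le> S0"
        by (rule cSUP_least[OF ne(1)]) (use hb in auto)
      show "S0 \<le> (SUP p\<in>{0..U0} \<times> {0..R}. \<bar>h (fst p) (snd p)\<bar>)"
        unfolding S0_def
      proof (rule cSUP_least[OF ne(2)])
        fix r assume "r \<in> {0..R}"
        then show "\<bar>h0 r\<bar> \<le> (SUP p\<in>{0..U0} \<times> {0..R}. \<bar>h (fst p) (snd p)\<bar>)"
          using U0 h(6) by (intro cSUP_upper2[OF hbdd, of "(0, r)"]) auto
      qed
    qed
    have SUPw: "(SUP p\<in>{0..U0} \<times> {0..R}. \<bar>pr R h (fst p) (snd p)\<bar>) \<le> 2 * M0"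
    proof (rule cSUP_least[OF ne(1)])
      fix p assume "p \<in> {0..U0} \<times> {0..R}"
      then obtain u r where p: "p = (u, r)" "u \<in> {0..U0}" "r \<in> {0..R}" by auto
      have "pr R h u r = v 0 u r"
        using h(2) R_pos p unfolding derr_def pr_def has_real_derivative_iff_has_vector_derivative
        by (intro vector_derivative_within_cbox[of 0 R, unfolded cbox_interval]) auto
      then show "\<bar>pr R h (fst p) (snd p)\<bar> \<le> 2 * M0" using h(7) p by simp
    qed
    \<comment> \<open>The sup of |h| is exactly \<open>S0\<close> and the derivative at most
      doubles; \<open>S0 + 2 * M0\<close> is at most twice the norm, which gives C* = 1.\<close>
    have "S0 + (SUP p\<in>{0..U0} \<times> {0..R}. \<bar>pr R h (fst p) (snd p)\<bar>) \<le> (1 + 1) * XR_norm R h0"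
      using SUPw S0_nonneg by (simp add: X_eq)
    with SUPh have e: "(SUP p\<in>{0..U0} \<times> {0..R}. \<bar>h (fst p) (snd p)\<bar>)
                 + (SUP p\<in>{0..U0} \<times> {0..R}. \<bar>pr R h (fst p) (snd p)\<bar>) \<le> (1 + 1) * XR_norm R h0" by simp
    have u: "\<forall>h'. Ck2 k U0 R h' \<and> is_solution \<kappa> \<Lambda> U0 R h0 h' \<longrightarrow> (\<forall>u\<in>{0..U0}. \<forall>r\<in>{0..R}. h' u r = h u r)"
      using uniq by blast
    show ?thesis
      by (rule exI[of _ h], intro conjI) (rule C sol u SUPh[unfolded S0_def] e)+
  qed
qed

end

theorem theorem4p1:
  fixes \<kappa> \<Lambda> R :: real
  assumes "\<kappa> > 0" and "\<Lambda> > 0" and "R > sqrt (3 / \<Lambda>)"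
  shows "\<exists>\<delta>>0. \<exists>Cstar>0. \<exists>Uf :: real \<Rightarrow> real.
    \<forall>(k::nat) (h0::real \<Rightarrow> real).
      k \<ge> 1 \<and> Ck1 k R h0 \<and> XR_norm R h0 < \<delta> \<longrightarrow>
        Uf (XR_norm R h0) > 0 \<and>
        (\<exists>h. Ck2 k (Uf (XR_norm R h0)) R h \<and>
             is_solution \<kappa> \<Lambda> (Uf (XR_norm R h0)) R h0 h \<and>
             (\<forall>h'. Ck2 k (Uf (XR_norm R h0)) R h' \<and>
                   is_solution \<kappa> \<Lambda> (Uf (XR_norm R h0)) R h0 h' \<longrightarrow>
                   (\<forall>u\<in>{0..Uf (XR_norm R h0)}. \<forall>r\<in>{0..R}. h' u r = h u r)) \<and>
             (SUP p\<in>{0..Uf (XR_norm R h0)} \<times> {0..R}. \<bar>h (fst p) (snd p)\<bar>)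
               = (SUP r\<in>{0..R}. \<bar>h0 r\<bar>) \<and>
             (SUP p\<in>{0..Uf (XR_norm R h0)} \<times> {0..R}. \<bar>h (fst p) (snd p)\<bar>)
               + (SUP p\<in>{0..Uf (XR_norm R h0)} \<times> {0..R}.
                    \<bar>pr R h (fst p) (snd p)\<bar>)
               \<le> (1 + Cstar) * XR_norm R h0)"
proof -
  have "0 < sqrt (3 / \<Lambda>)" using assms(2) by simp
  then have R: "R > 0" using assms(3) by linarith
  have "(sqrt (3 / \<Lambda>))\<^sup>2 < R\<^sup>2" using assms(3) assms(2) by (intro power_strict_mono) auto
  then have "3 / \<Lambda> < R\<^sup>2" using assms(2) by simp
  then have big: "\<Lambda> * R\<^sup>2 / 3 > 1" using assms(2) by (simp add: field_simps)
  \<comment> \<open>The largest B^2 allowed by both sign conditions, the second one after taking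
    logarithms. It is positive because R > sqrt (3 / \<Lambda>) makes that logarithm
    positive.\<close>
  define Q where "Q = min (8 * \<Lambda> / \<kappa>) (16 * ln (\<Lambda> * R\<^sup>2 / 3) / (\<kappa> * R\<^sup>2))"
  define B where "B = sqrt Q"
  have "ln (\<Lambda> * R\<^sup>2 / 3) > 0" using big by simp
  then have Q: "Q > 0" using assms R by (simp add: Q_def)
  have B: "B > 0" "B\<^sup>2 = Q" using Q by (auto simp: B_def)
  have "\<kappa> * Q \<le> \<kappa> * (8 * \<Lambda> / \<kappa>)" unfolding Q_def using assms(1) by (intro mult_left_mono) auto
  then have 1: "\<kappa> * B\<^sup>2 \<le> 8 * \<Lambda>" using assms(1) B by simp
  have "\<kappa> * R\<^sup>2 * Q \<le> \<kappa> * R\<^sup>2 * (16 * ln (\<Lambda> * R\<^sup>2 / 3) / (\<kappa> * R\<^sup>2))"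
    unfolding Q_def using assms(1) by (intro mult_left_mono) auto
  then have "\<kappa> * R\<^sup>2 * B\<^sup>2 / 16 \<le> ln (\<Lambda> * R\<^sup>2 / 3)" using assms(1) R B by simp
  then have "exp (\<kappa> * R\<^sup>2 * B\<^sup>2 / 16) \<le> exp (ln (\<Lambda> * R\<^sup>2 / 3))" by simp
  then have 2: "exp (\<kappa> * R\<^sup>2 * B\<^sup>2 / 16) \<le> \<Lambda> * R\<^sup>2 / 3" using big by simp
  interpret bondi_small \<kappa> \<Lambda> R B
    by unfold_locales (use assms R B 1 2 in auto)
  \<comment> \<open>The threshold B/2 leaves room for w to double, and the single time
    \<open>U0\<close> serves all admissible data.\<close>
  show ?thesis
    using well_posed U0(1) B(1) by (intro exI[of _ "B / 2"] exI[of _ 1] exI[of _ "\<lambda>_. U0"] conjI allI impI) auto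
qed

end
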